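(* Let $M$ and $\widehat M$ be semi-Riemannian manifolds of equal dimension and equal signature, both isometrically embedded in a semi-Riemannian vector space $(V,(\cdot,\cdot))$. (i) Assume that $(\alpha(t),\widehat\alpha(t),A(t))$ is an intrinsic rolling curve. Let $g(t)=(R(t),s(t))$ be a curve in $\mathrm{SE}(V)$ such that the restriction of $R(t)$ to $T_{\alpha(t)}M$ is equal to $A(t)$ and $s(t)=\widehat\alpha(t)-R(t).\alpha(t)$. Then $g(t)$ satisfies conditions (E1), (E2), (E3), (E4) and (E6) of extrinsic rolling listed in the context. (ii) Conversely, if $g(t)=(R(t),s(t))$ is a curve in $\mathrm{SE}(V)$ that satisfies conditions (E1), (E2), (E3), (E4) and (E6) with respect to curves $\alpha(t)$ in $M$ and $\widehat\alpha(t)$ in $\widehat M$, then $(\alpha(t),\widehat\alpha(t),A(t))$ is an intrinsic rolling curve, where $A(t)$ is the restriction of $R(t)$ to $T_{\alpha(t)}M$. This happens, in particular, if $g(t)$ is a rolling map along $\alpha(t)$.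
   Context: $V$ is a finite-dimensional real vector space with a non-degenerate symmetric bilinear form $(\cdot,\cdot)$; $M,\widehat M\subset V$ are submanifolds whose semi-Riemannian metrics are the restrictions of $(\cdot,\cdot)$. All curves (and vector fields along curves) are absolutely continuous on an interval $I=[0,T]$, and conditions involving derivatives are required for almost every $t$. For $m\in M$, $V=T_mV=T_mM\oplus (T_mM)^\perp$, with components $v=v^\top+v^\perp$; similarly for $\widehat M$. For a tangent vector field $Z(t)$ along a curve, $\frac{D}{dt}Z=(\dot Z)^\top$ is the covariant derivative; for a normal vector field $\Psi(t)$, $\frac{D^\perp}{dt}\Psi=(\dot\Psi)^\perp$ is the normal covariant derivative. $Z$ is (tangent) parallel if $\frac{D}{dt}Z=0$ for almost every $t$. $\mathrm{SO}(V)$ is the identity component of the isometry group of $V$ (preserving orientations of positive definite and negative definite subspaces), and $\mathrm{SE}(V)=\mathrm{SO}(V)\ltimes V$, with elements $g=(R,s)$ acting by $g.v=R.v+s$; its differential at any point is $d_pg\,(v)=R.v$. The tangent spaces of $M$ and $\widehat M$ carry orientations of their positive definite and negative definite subspaces. An isometry $T_mM\to T_{\widehat m}\widehat M$ is called oriented if it preserves the orientation of the positive definite and negative definite subspaces. Intrinsic rolling curve: a triple $(\alpha(t),\widehat\alpha(t),A(t))$ with $\alpha$ a curve in $M$, $\widehat\alpha$ a curve in $\widehat M$, and $A(t):T_{\alpha(t)}M\to T_{\widehat\alpha(t)}\widehat M$ an oriented isometry, such that $\dot{\widehat\alpha}(t)=A(t)\dot\alpha(t)$, and $A(t)X(t)$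 is a parallel vector field in $\widehat M$ along $\widehat\alpha(t)$ if and only if $X(t)$ is a parallel vector field in $M$ along $\alpha(t)$. Extrinsic rolling: an absolutely continuous curve $g(t)$ in $\mathrm{SE}(V)$, $t\in I$, is a rolling map along the curve $\alpha(t)$ in $M$ with development $\widehat\alpha(t)$ in $\widehat M$ if (E1) $g(t).\alpha(t)=\widehat\alpha(t)$ for all $t\in I$; (E2) $d_{\alpha(t)}g(t)\,T_{\alpha(t)}M=T_{\widehat\alpha(t)}\widehat M$ for all $t\in I$; (E3) (no-slip) $\dot{\widehat\alpha}(t)=d_{\alpha(t)}g(t)\,\dot\alpha(t)$ for almost every $t$; (E4) (tangential no-twist) $d_{\alpha(t)}g(t)\frac{D}{dt}Z(t)=\frac{D}{dt}\,d_{\alpha(t)}g(t)Z(t)$ for any tangent vector field $Z(t)$ along $\alpha(t)$ and almost every $t$; (E5) (normal no-twist) $d_{\alpha(t)}g(t)\frac{D^\perp}{dt}\Psi(t)=\frac{D^\perp}{dt}\,d_{\alpha(t)}g(t)\Psi(t)$ for any normal vector field $\Psi(t)$ along $\alpha(t)$ and almost every $t$; (E6) $d_{\alpha(t)}g(t)|_{T_{\alpha(t)}M}:T_{\alpha(t)}M\to T_{\widehat\alpha(t)}\widehat M$ is orientation preserving, i.e. oriented in the sense above. *)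

theory Defs
  imports "HOL-Analysis.Analysis"
begin

section \<open>Scalar products, index and definite frames\<close>

definition nondegenerate_on :: "('a::euclidean_space \<Rightarrow> 'a \<Rightarrow> real) \<Rightarrow> 'a set \<Rightarrow> bool" where
  "nondegenerate_on B W \<longleftrightarrow> (\<forall>v\<in>W. (\<forall>w\<in>W. B v w = 0) \<longrightarrow> v = 0)"

text \<open>
  The type \<^typ>\<open>'a::euclidean_space\<close> plays the role of the vector space \<open>V\<close>. Its own inner product
  only supplies the (canonical) topology; the geometry is that of \<open>B\<close>.
\<close>

definition scalar_product_form :: "('a::euclidean_space \<Rightarrow> 'a \<Rightarrow> real) \<Rightarrow> bool" where
  "scalar_product_form B \<longleftrightarrow> bilinear B \<and> (\<forall>x y. B x y = B y x) \<and> nondegenerate_on B UNIV"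

definition positive_definite_on :: "('a::euclidean_space \<Rightarrow> 'a \<Rightarrow> real) \<Rightarrow> 'a set \<Rightarrow> bool" where
  "positive_definite_on B P \<longleftrightarrow> (\<forall>v\<in>P. v \<noteq> 0 \<longrightarrow> B v v > 0)"

text \<open>
  Everything concerning negative definite subspaces is obtained by passing from \<open>B\<close> to \<open>- B\<close>.
\<close>

definition neg_form :: "('a::euclidean_space \<Rightarrow> 'a \<Rightarrow> real) \<Rightarrow> 'a \<Rightarrow> 'a \<Rightarrow> real" where
  "neg_form B = (\<lambda>x y. - B x y)"

definition pos_index :: "('a::euclidean_space \<Rightarrow> 'a \<Rightarrow> real) \<Rightarrow> 'a set \<Rightarrow> nat" where
  "pos_index B W = Max {dim P |P. subspace P \<and> P \<subseteq> W \<and> positive_definite_on B P}"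

text \<open>
  \<open>pos_frames B W\<close> consists of the ordered bases \<open>(e 0, \<dots>, e (k - 1))\<close> of the maximal positive definite
  subspaces of \<open>W\<close>, padded with zeros to sequences and topologised as a subspace of \<^typ>\<open>nat \<Rightarrow> 'a\<close>
  (product topology). The maximal positive definite subspaces form a contractible space, so for
  \<open>k > 0\<close> there are exactly two connected components, i.e. the two simultaneous, coherent
  orientations of all of them; for \<open>k = 0\<close> there is one.
\<close>

definition pos_frames :: "('a::euclidean_space \<Rightarrow> 'a \<Rightarrow> real) \<Rightarrow> 'a set \<Rightarrow> (nat \<Rightarrow> 'a) set" where
  "pos_frames B W = {e. (\<forall>i < pos_index B W. e i \<in> W) \<and> (\<forall>i \<ge> pos_index B W. e i = 0) \<and>
      inj_on e {..<pos_index B W} \<and> independent (e ` {..<pos_index B W}) \<and>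
      positive_definite_on B (span (e ` {..<pos_index B W}))}"

text \<open>
  An orientation is the pair of the set of positively oriented bases of maximal positive definite
  subspaces and the corresponding set for negative definite subspaces.
\<close>

type_synonym 'a orientation = "(nat \<Rightarrow> 'a) set \<times> (nat \<Rightarrow> 'a) set"

definition orientation_of ::
    "('a::euclidean_space \<Rightarrow> 'a \<Rightarrow> real) \<Rightarrow> 'a set \<Rightarrow> 'a orientation \<Rightarrow> bool" where
  "orientation_of B W \<omega> \<longleftrightarrow>
     fst \<omega> \<in> components (pos_frames B W) \<and> snd \<omega> \<in> components (pos_frames (neg_form B) W)"

definition preserves_orientation ::
    "'a orientation \<Rightarrow> 'a orientation \<Rightarrow> ('a::euclidean_space \<Rightarrow> 'a) \<Rightarrow> bool" where
  "preserves_orientation \<omega> \<omega>' f \<longleftrightarrow>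
     (\<forall>e \<in> fst \<omega>. f \<circ> e \<in> fst \<omega>') \<and> (\<forall>e \<in> snd \<omega>. f \<circ> e \<in> snd \<omega>')"

definition isometry_between ::
    "('a::euclidean_space \<Rightarrow> 'a \<Rightarrow> real) \<Rightarrow> 'a set \<Rightarrow> 'a set \<Rightarrow> ('a \<Rightarrow> 'a) \<Rightarrow> bool" where
  "isometry_between B W W' f \<longleftrightarrow>
     (\<forall>x\<in>W. \<forall>y\<in>W. f (x + y) = f x + f y) \<and> (\<forall>c. \<forall>x\<in>W. f (c *\<^sub>R x) = c *\<^sub>R f x) \<and>
     bij_betw f W W' \<and> (\<forall>x\<in>W. \<forall>y\<in>W. B (f x) (f y) = B x y)"

definition oriented_isometry ::
    "('a::euclidean_space \<Rightarrow> 'a \<Rightarrow> real) \<Rightarrow> 'a set \<Rightarrow> 'a orientation \<Rightarrow> 'a set \<Rightarrow> 'a orientation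
      \<Rightarrow> ('a \<Rightarrow> 'a) \<Rightarrow> bool" where
  "oriented_isometry B W \<omega> W' \<omega>' f \<longleftrightarrow>
     isometry_between B W W' f \<and> preserves_orientation \<omega> \<omega>' f"

text \<open>
  For nondegenerate \<open>W\<close>, \<open>v = tan_part B W v + nor_part B W v\<close> is the decomposition along
  \<open>V = W \<oplus> W\<^sup>\<bottom>\<close>.
\<close>

definition tan_part :: "('a::euclidean_space \<Rightarrow> 'a \<Rightarrow> real) \<Rightarrow> 'a set \<Rightarrow> 'a \<Rightarrow> 'a" where
  "tan_part B W v = (THE w. w \<in> W \<and> (\<forall>u\<in>W. B (v - w) u = 0))"

definition nor_part :: "('a::euclidean_space \<Rightarrow> 'a \<Rightarrow> real) \<Rightarrow> 'a set \<Rightarrow> 'a \<Rightarrow> 'a" where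
  "nor_part B W v = v - tan_part B W v"

definition normal_space :: "('a::euclidean_space \<Rightarrow> 'a \<Rightarrow> real) \<Rightarrow> 'a set \<Rightarrow> 'a set" where
  "normal_space B W = {v. \<forall>u\<in>W. B v u = 0}"


section \<open>Semi-Riemannian submanifolds\<close>

text \<open>
  The following two notions are meant for open sets \<open>S\<close>. The domain being finite-dimensional in all
  uses, \<open>C\<^sup>k\<^sup>+\<^sup>1\<close> means differentiable with all directional derivatives of class \<open>C\<^sup>k\<close>.
\<close>

primrec Ck_on ::
    "nat \<Rightarrow> ('a::real_normed_vector \<Rightarrow> 'b::real_normed_vector) \<Rightarrow> 'a set \<Rightarrow> bool" where
  "Ck_on 0 f S \<longleftrightarrow> continuous_on S f"
| "Ck_on (Suc k) f S \<longleftrightarrow>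
     f differentiable_on S \<and> (\<forall>v. Ck_on k (\<lambda>x. frechet_derivative f (at x) v) S)"

definition smooth_on ::
    "('a::real_normed_vector \<Rightarrow> 'b::real_normed_vector) \<Rightarrow> 'a set \<Rightarrow> bool" where
  "smooth_on f S \<longleftrightarrow> (\<forall>k. Ck_on k f S)"

text \<open>Embedded submanifolds, in terms of slice charts \<open>\<phi>\<close> of the ambient space.\<close>

definition submanifold :: "nat \<Rightarrow> 'a::euclidean_space set \<Rightarrow> bool" where
  "submanifold n M \<longleftrightarrow>
     (\<forall>p\<in>M. \<exists>U U' \<phi> \<psi> S.
        open U \<and> p \<in> U \<and> open U' \<and> homeomorphism U U' \<phi> \<psi> \<and>
        smooth_on \<phi> U \<and> smooth_on \<psi> U' \<and>
        subspace (S :: 'a set) \<and> dim S = n \<and> \<phi> ` (U \<inter> M) = U' \<inter> S)"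

definition tangent_space :: "'a::euclidean_space set \<Rightarrow> 'a \<Rightarrow> 'a set" where
  "tangent_space M p =
     {v. \<exists>\<gamma> \<epsilon>. \<epsilon> > 0 \<and> smooth_on \<gamma> {-\<epsilon><..<\<epsilon>} \<and> \<gamma> ` {-\<epsilon><..<\<epsilon>} \<subseteq> M \<and>
            \<gamma> (0::real) = p \<and> (\<gamma> has_vector_derivative v) (at 0)}"

definition semi_riemannian_submanifold ::
    "('a::euclidean_space \<Rightarrow> 'a \<Rightarrow> real) \<Rightarrow> nat \<Rightarrow> nat \<times> nat \<Rightarrow> 'a set \<Rightarrow> bool" where
  "semi_riemannian_submanifold B n sig M \<longleftrightarrow>
     submanifold n M \<and>
     (\<forall>m\<in>M. nondegenerate_on B (tangent_space M m) \<and>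
            pos_index B (tangent_space M m) = fst sig \<and>
            pos_index (neg_form B) (tangent_space M m) = snd sig)"

definition oriented_by ::
    "('a::euclidean_space \<Rightarrow> 'a \<Rightarrow> real) \<Rightarrow> 'a set \<Rightarrow> ('a \<Rightarrow> 'a orientation) \<Rightarrow> bool" where
  "oriented_by B M \<omega> \<longleftrightarrow> (\<forall>m\<in>M. orientation_of B (tangent_space M m) (\<omega> m))"


section \<open>The groups SO(V) and SE(V)\<close>

definition isometry_group :: "('a::euclidean_space \<Rightarrow> 'a \<Rightarrow> real) \<Rightarrow> ('a \<Rightarrow>\<^sub>L 'a) set" where
  "isometry_group B = {R. \<forall>x y. B (blinfun_apply R x) (blinfun_apply R y) = B x y}"

definition SO :: "('a::euclidean_space \<Rightarrow> 'a \<Rightarrow> real) \<Rightarrow> ('a \<Rightarrow>\<^sub>L 'a) set" where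
  "SO B = connected_component_set (isometry_group B) id_blinfun"

text \<open>Elements of \<open>SE(V) = SO(V) \<ltimes> V\<close> are pairs \<open>(R, s)\<close>; only their action on \<open>V\<close> is needed.\<close>

type_synonym 'a motion = "('a \<Rightarrow>\<^sub>L 'a) \<times> 'a"

definition SE :: "('a::euclidean_space \<Rightarrow> 'a \<Rightarrow> real) \<Rightarrow> 'a motion set" where
  "SE B = SO B \<times> UNIV"

definition se_act :: "'a::euclidean_space motion \<Rightarrow> 'a \<Rightarrow> 'a" where
  "se_act g v = blinfun_apply (fst g) v + snd g"

definition se_diff :: "'a::euclidean_space motion \<Rightarrow> 'a \<Rightarrow> 'a" where
  "se_diff g = blinfun_apply (fst g)"

lemma se_act_has_derivative: "(se_act g has_derivative se_diff g) (at p)"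
  unfolding se_act_def[abs_def] se_diff_def
  by (auto intro!: derivative_eq_intros)


section \<open>Absolutely continuous curves and covariant derivatives\<close>

definition abs_cont_on :: "real set \<Rightarrow> (real \<Rightarrow> 'b::real_normed_vector) \<Rightarrow> bool" where
  "abs_cont_on I f \<longleftrightarrow>
     (\<forall>\<epsilon>>0. \<exists>\<delta>>0. \<forall>(n::nat) a b.
        (\<forall>i<n. a i \<le> b i \<and> {a i..b i} \<subseteq> I) \<and>
        (\<forall>i<n. \<forall>j<n. i \<noteq> j \<longrightarrow> {a i<..<b i} \<inter> {a j<..<b j} = {}) \<and>
        (\<Sum>i<n. b i - a i) < \<delta> \<longrightarrow>
        (\<Sum>i<n. norm (f (b i) - f (a i))) < \<epsilon>)"

text \<open>
  All curves are parametrised by \<open>[0, T]\<close>; values outside this interval are irrelevant, also for the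
  velocity.
\<close>

definition curve_in :: "real \<Rightarrow> 'b::real_normed_vector set \<Rightarrow> (real \<Rightarrow> 'b) \<Rightarrow> bool" where
  "curve_in T S c \<longleftrightarrow> abs_cont_on {0..T} c \<and> (\<forall>t\<in>{0..T}. c t \<in> S)"

definition velocity :: "real \<Rightarrow> (real \<Rightarrow> 'b::real_normed_vector) \<Rightarrow> real \<Rightarrow> 'b" where
  "velocity T c t = vector_derivative c (at t within {0..T})"

definition tangent_field ::
    "real \<Rightarrow> 'a::euclidean_space set \<Rightarrow> (real \<Rightarrow> 'a) \<Rightarrow> (real \<Rightarrow> 'a) \<Rightarrow> bool" where
  "tangent_field T M \<alpha> Z \<longleftrightarrow>
     abs_cont_on {0..T} Z \<and> (\<forall>t\<in>{0..T}. Z t \<in> tangent_space M (\<alpha> t))"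

definition normal_field ::
    "('a::euclidean_space \<Rightarrow> 'a \<Rightarrow> real) \<Rightarrow> real \<Rightarrow> 'a set \<Rightarrow> (real \<Rightarrow> 'a) \<Rightarrow> (real \<Rightarrow> 'a) \<Rightarrow> bool" where
  "normal_field B T M \<alpha> \<Psi> \<longleftrightarrow>
     abs_cont_on {0..T} \<Psi> \<and> (\<forall>t\<in>{0..T}. \<Psi> t \<in> normal_space B (tangent_space M (\<alpha> t)))"

definition cov_deriv ::
    "('a::euclidean_space \<Rightarrow> 'a \<Rightarrow> real) \<Rightarrow> real \<Rightarrow> 'a set \<Rightarrow> (real \<Rightarrow> 'a) \<Rightarrow> (real \<Rightarrow> 'a) \<Rightarrow> real \<Rightarrow> 'a" where
  "cov_deriv B T M \<alpha> Z t = tan_part B (tangent_space M (\<alpha> t)) (velocity T Z t)"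

definition normal_cov_deriv ::
    "('a::euclidean_space \<Rightarrow> 'a \<Rightarrow> real) \<Rightarrow> real \<Rightarrow> 'a set \<Rightarrow> (real \<Rightarrow> 'a) \<Rightarrow> (real \<Rightarrow> 'a) \<Rightarrow> real \<Rightarrow> 'a" where
  "normal_cov_deriv B T M \<alpha> \<Psi> t = nor_part B (tangent_space M (\<alpha> t)) (velocity T \<Psi> t)"

definition parallel_field ::
    "('a::euclidean_space \<Rightarrow> 'a \<Rightarrow> real) \<Rightarrow> real \<Rightarrow> 'a set \<Rightarrow> (real \<Rightarrow> 'a) \<Rightarrow> (real \<Rightarrow> 'a) \<Rightarrow> bool" where
  "parallel_field B T M \<alpha> Z \<longleftrightarrow>
     tangent_field T M \<alpha> Z \<and> (AE t\<in>{0..T} in lebesgue. cov_deriv B T M \<alpha> Z t = 0)"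


section \<open>Intrinsic rolling\<close>

text \<open>
  \<open>A t\<close> is only relevant on the tangent space at \<open>\<alpha> t\<close>. As these spaces vary with \<open>t\<close>, absolute
  continuity of \<open>A\<close> is expressed by the fact that it takes absolutely continuous vector fields to
  absolutely continuous ones (equivalently: its matrix in absolutely continuous frames is absolutely
  continuous).
\<close>

definition intrinsic_rolling ::
    "('a::euclidean_space \<Rightarrow> 'a \<Rightarrow> real) \<Rightarrow> real \<Rightarrow>
     'a set \<Rightarrow> ('a \<Rightarrow> 'a orientation) \<Rightarrow> 'a set \<Rightarrow> ('a \<Rightarrow> 'a orientation) \<Rightarrow>
     (real \<Rightarrow> 'a) \<Rightarrow> (real \<Rightarrow> 'a) \<Rightarrow> (real \<Rightarrow> 'a \<Rightarrow> 'a) \<Rightarrow> bool" where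
  "intrinsic_rolling B T M \<omega> M' \<omega>' \<alpha> \<alpha>' A \<longleftrightarrow>
     curve_in T M \<alpha> \<and> curve_in T M' \<alpha>' \<and>
     (\<forall>t\<in>{0..T}. oriented_isometry B (tangent_space M (\<alpha> t)) (\<omega> (\<alpha> t))
                    (tangent_space M' (\<alpha>' t)) (\<omega>' (\<alpha>' t)) (A t)) \<and>
     (\<forall>X. tangent_field T M \<alpha> X \<longrightarrow> abs_cont_on {0..T} (\<lambda>t. A t (X t))) \<and>
     (AE t\<in>{0..T} in lebesgue. velocity T \<alpha>' t = A t (velocity T \<alpha> t)) \<and>
     (\<forall>X. tangent_field T M \<alpha> X \<longrightarrow>
        (parallel_field B T M' \<alpha>' (\<lambda>t. A t (X t)) \<longleftrightarrow> parallel_field B T M \<alpha> X))"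


section \<open>Extrinsic rolling\<close>

definition maps_base_points :: "real \<Rightarrow> (real \<Rightarrow> 'a) \<Rightarrow> (real \<Rightarrow> 'a) \<Rightarrow> (real \<Rightarrow> 'a::euclidean_space motion) \<Rightarrow> bool" where
  "maps_base_points T \<alpha> \<alpha>' g \<longleftrightarrow> (\<forall>t\<in>{0..T}. se_act (g t) (\<alpha> t) = \<alpha>' t)"

definition maps_tangent_spaces :: "real \<Rightarrow> 'a set \<Rightarrow> 'a set \<Rightarrow> (real \<Rightarrow> 'a) \<Rightarrow> (real \<Rightarrow> 'a) \<Rightarrow>
    (real \<Rightarrow> 'a::euclidean_space motion) \<Rightarrow> bool" where
  "maps_tangent_spaces T M M' \<alpha> \<alpha>' g \<longleftrightarrow>
     (\<forall>t\<in>{0..T}. se_diff (g t) ` tangent_space M (\<alpha> t) = tangent_space M' (\<alpha>' t))"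

definition no_slip :: "real \<Rightarrow> (real \<Rightarrow> 'a) \<Rightarrow> (real \<Rightarrow> 'a) \<Rightarrow> (real \<Rightarrow> 'a::euclidean_space motion) \<Rightarrow> bool" where
  "no_slip T \<alpha> \<alpha>' g \<longleftrightarrow> (AE t\<in>{0..T} in lebesgue. velocity T \<alpha>' t = se_diff (g t) (velocity T \<alpha> t))"

definition tangential_no_twist :: "('a \<Rightarrow> 'a \<Rightarrow> real) \<Rightarrow> real \<Rightarrow> 'a set \<Rightarrow> 'a set \<Rightarrow> (real \<Rightarrow> 'a) \<Rightarrow> (real \<Rightarrow> 'a) \<Rightarrow>
    (real \<Rightarrow> 'a::euclidean_space motion) \<Rightarrow> bool" where
  "tangential_no_twist B T M M' \<alpha> \<alpha>' g \<longleftrightarrow>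
     (\<forall>Z. tangent_field T M \<alpha> Z \<longrightarrow>
        (AE t\<in>{0..T} in lebesgue.
           se_diff (g t) (cov_deriv B T M \<alpha> Z t) =
           cov_deriv B T M' \<alpha>' (\<lambda>r. se_diff (g r) (Z r)) t))"

definition normal_no_twist :: "('a \<Rightarrow> 'a \<Rightarrow> real) \<Rightarrow> real \<Rightarrow> 'a set \<Rightarrow> 'a set \<Rightarrow> (real \<Rightarrow> 'a) \<Rightarrow> (real \<Rightarrow> 'a) \<Rightarrow>
    (real \<Rightarrow> 'a::euclidean_space motion) \<Rightarrow> bool" where
  "normal_no_twist B T M M' \<alpha> \<alpha>' g \<longleftrightarrow>
     (\<forall>\<Psi>. normal_field B T M \<alpha> \<Psi> \<longrightarrow>
        (AE t\<in>{0..T} in lebesgue.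
           se_diff (g t) (normal_cov_deriv B T M \<alpha> \<Psi> t) =
           normal_cov_deriv B T M' \<alpha>' (\<lambda>r. se_diff (g r) (\<Psi> r)) t))"

definition maps_orientations :: "real \<Rightarrow> ('a \<Rightarrow> 'a orientation) \<Rightarrow> ('a \<Rightarrow> 'a orientation) \<Rightarrow>
    (real \<Rightarrow> 'a) \<Rightarrow> (real \<Rightarrow> 'a) \<Rightarrow> (real \<Rightarrow> 'a::euclidean_space motion) \<Rightarrow> bool" where
  "maps_orientations T \<omega> \<omega>' \<alpha> \<alpha>' g \<longleftrightarrow>
     (\<forall>t\<in>{0..T}. preserves_orientation (\<omega> (\<alpha> t)) (\<omega>' (\<alpha>' t)) (se_diff (g t)))"

definition rolling_map ::
    "('a::euclidean_space \<Rightarrow> 'a \<Rightarrow> real) \<Rightarrow> real \<Rightarrow>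
     'a set \<Rightarrow> ('a \<Rightarrow> 'a orientation) \<Rightarrow> 'a set \<Rightarrow> ('a \<Rightarrow> 'a orientation) \<Rightarrow>
     (real \<Rightarrow> 'a) \<Rightarrow> (real \<Rightarrow> 'a) \<Rightarrow> (real \<Rightarrow> 'a motion) \<Rightarrow> bool" where
  "rolling_map B T M \<omega> M' \<omega>' \<alpha> \<alpha>' g \<longleftrightarrow>
     curve_in T M \<alpha> \<and> curve_in T M' \<alpha>' \<and> curve_in T (SE B) g \<and>
     maps_base_points T \<alpha> \<alpha>' g \<and> maps_tangent_spaces T M M' \<alpha> \<alpha>' g \<and> no_slip T \<alpha> \<alpha>' g \<and>
     tangential_no_twist B T M M' \<alpha> \<alpha>' g \<and> normal_no_twist B T M M' \<alpha> \<alpha>' g \<and>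
     maps_orientations T \<omega> \<omega>' \<alpha> \<alpha>' g"

end

theory Submission
  imports Defs
begin

text \<open>
  Matching of base points, tangent spaces and orientations merely rephrases that \<open>R t\<close> restricts to the oriented
  isometry \<open>A t\<close> of tangent spaces, and so does the extrinsic no-slip condition once it is known that the velocity of an
  absolutely continuous curve in \<open>M\<close> exists and is tangent to \<open>M\<close> almost everywhere
  (\<open>curve_velocity_tangent\<close>). The content of the theorem is the equivalence of the tangential no-twist condition
  with the preservation of parallel fields.

  If \<open>R t\<close> commutes with covariant differentiation, then it preserves and reflects parallel fields because it is
  injective (\<open>parallel_field_iff\<close>). Conversely, suppose that parallel fields go to parallel fields. An arbitrary tangent field
  is a combination \<open>Z = \<Sum> \<zeta> b X b\<close> of parallel fields with absolutely continuous coefficients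
  (\<open>exists_parallel_frame\<close>). The Leibniz rule gives \<open>D Z = \<Sum> \<zeta>' b X b\<close> and, as the fields \<open>R (X b)\<close> are parallel too,
  \<open>D (R Z) = \<Sum> \<zeta>' b R (X b)\<close>, which is \<open>R (D Z)\<close> (\<open>tangential_no_twistI\<close>).

  It remains to find enough parallel fields along a curve \<open>\<alpha>\<close> that is only absolutely continuous. The tangent spaces of a
  submanifold depend on the point in a Lipschitz way (\<open>tangent_gap_compact\<close>), hence so do the
  orthogonal projections \<open>P t\<close> onto the tangent spaces at \<open>\<alpha> t\<close> (\<open>tan_part_lipschitz\<close>), and \<open>P\<close> is an absolutely continuous curve of
  operators. Kato's equation \<open>X' = (P' P - P P') X\<close> in the ambient space has a flow by
  isometries that intertwines the projections, and it moves tangent vectors in a parallel way (\<open>transport_of_projections\<close>). So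
  parallel transport becomes a linear equation with integrable coefficients on the whole interval, in which no local
  coordinates occur.

  The analytic basis consists of three facts: absolutely continuous functions are differentiable almost everywhere and are the
  integrals of their derivatives (\<open>abs_cont_on_fundamental_theorem\<close>), which is obtained from the Radon-Nikodym theorem for
  monotone functions; indefinite integrals are absolutely continuous (\<open>abs_cont_on_integral\<close>); and linear equations with
  integrable coefficients have unique solutions (\<open>linear_ode_exists\<close>, \<open>linear_ode_unique\<close>).
\<close>

section \<open>Absolutely continuous functions\<close>

text \<open>
  The index set is arbitrary, since such families arise below by subdivision of other families and as
  divisions of elementary sets.
\<close>

definition nonoverlapping :: "real set \<Rightarrow> 'i set \<Rightarrow> ('i \<Rightarrow> real) \<Rightarrow> ('i \<Rightarrow> real) \<Rightarrow> bool" where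
  "nonoverlapping I J a b \<longleftrightarrow> (\<forall>i\<in>J. a i \<le> b i \<and> {a i..b i} \<subseteq> I) \<and>
     (\<forall>i\<in>J. \<forall>j\<in>J. i \<noteq> j \<longrightarrow> {a i<..<b i} \<inter> {a j<..<b j} = {})"

lemma abs_cont_on_alt:
  "abs_cont_on I f \<longleftrightarrow> (\<forall>\<epsilon>>0. \<exists>\<delta>>0. \<forall>(n::nat) a b. nonoverlapping I {..<n} a b \<longrightarrow>
      (\<Sum>i<n. b i - a i) < \<delta> \<longrightarrow> (\<Sum>i<n. norm (f (b i) - f (a i))) < \<epsilon>)"
  unfolding abs_cont_on_def nonoverlapping_def by (simp only: lessThan_iff Ball_def conj_assoc imp_conjL)

lemma nonoverlapping_mem:
  "nonoverlapping I J a b \<Longrightarrow> i \<in> J \<Longrightarrow> a i \<le> b i"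
  "nonoverlapping I J a b \<Longrightarrow> i \<in> J \<Longrightarrow> a i \<in> I"
  "nonoverlapping I J a b \<Longrightarrow> i \<in> J \<Longrightarrow> b i \<in> I"
  unfolding nonoverlapping_def by force+

lemma abs_cont_onD:
  assumes "abs_cont_on I f" "0 < \<epsilon>"
  shows "\<exists>\<delta>>0. \<forall>(J::'i set) a b. finite J \<longrightarrow> nonoverlapping I J a b \<longrightarrow> (\<Sum>i\<in>J. b i - a i) < \<delta> \<longrightarrow>
      (\<Sum>i\<in>J. norm (f (b i) - f (a i))) < \<epsilon>"
proof -
  obtain \<delta> where \<delta>: "0 < \<delta>" and H: "\<And>(n::nat) a b. nonoverlapping I {..<n} a b \<Longrightarrow>
      (\<Sum>i<n. b i - a i) < \<delta> \<Longrightarrow> (\<Sum>i<n. norm (f (b i) - f (a i))) < \<epsilon>"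
    using assms unfolding abs_cont_on_alt by blast
  show ?thesis
  proof (intro exI[of _ \<delta>] conjI allI impI \<delta>)
    fix J :: "'i set" and a b :: "'i \<Rightarrow> real"
    assume J: "finite J" and ab: "nonoverlapping I J a b" and s: "(\<Sum>i\<in>J. b i - a i) < \<delta>"
    obtain e where e: "bij_betw e {..<card J} J"
      using ex_bij_betw_nat_finite[OF J] by (metis atLeast0LessThan)
    then have e': "e i \<in> J" if "i < card J" for i
      using that bij_betwE by blast
    have e'': "e i \<noteq> e j" if "i < card J" "j < card J" "i \<noteq> j" for i j
      using e that by (auto simp: bij_betw_def inj_on_def)
    have re: "(\<Sum>i<card J. g (e i)) = (\<Sum>i\<in>J. g i)" for g :: "'i \<Rightarrow> real"
      by (rule sum.reindex_bij_betw[OF e])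
    have "nonoverlapping I {..<card J} (a \<circ> e) (b \<circ> e)"
      unfolding nonoverlapping_def
    proof (intro conjI ballI impI)
      fix i j assume "i \<in> {..<card J}" "j \<in> {..<card J}" "i \<noteq> j"
      then have "e i \<in> J" "e j \<in> J" "e i \<noteq> e j" using e' e'' by auto
      then show "{(a \<circ> e) i<..<(b \<circ> e) i} \<inter> {(a \<circ> e) j<..<(b \<circ> e) j} = {}"
        using ab unfolding nonoverlapping_def o_def by blast
    next
      fix i assume "i \<in> {..<card J}"
      then have "e i \<in> J" using e' by auto
      then show "(a \<circ> e) i \<le> (b \<circ> e) i" "{(a \<circ> e) i..(b \<circ> e) i} \<subseteq> I"
        using ab unfolding nonoverlapping_def o_def by blast+
    qed
    moreover have "(\<Sum>i<card J. (b \<circ> e) i - (a \<circ> e) i) < \<delta>"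
      using s re[of "\<lambda>i. b i - a i"] by simp
    ultimately have "(\<Sum>i<card J. norm (f ((b \<circ> e) i) - f ((a \<circ> e) i))) < \<epsilon>"
      by (rule H)
    then show "(\<Sum>i\<in>J. norm (f (b i) - f (a i))) < \<epsilon>"
      using re[of "\<lambda>i. norm (f (b i) - f (a i))"] by simp
  qed
qed

text \<open>
  A function whose increments are controlled linearly by those of two absolutely continuous functions
  is absolutely continuous. All closure properties that follow are instances.
\<close>

lemma abs_cont_on_dominated:
  assumes f: "abs_cont_on I f" and g: "abs_cont_on I g"
    and h: "\<And>s t. s \<in> I \<Longrightarrow> t \<in> I \<Longrightarrow> norm (h t - h s) \<le> C * norm (f t - f s) + D * norm (g t - g s)"
  shows "abs_cont_on I h"
  unfolding abs_cont_on_alt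
proof (intro allI impI)
  fix \<epsilon> :: real assume \<epsilon>: "0 < \<epsilon>"
  define C' where "C' = \<bar>C\<bar> + \<bar>D\<bar> + 1"
  have C': "C' > 0" "C \<le> C'" "D \<le> C'" unfolding C'_def by auto
  have e2: "0 < \<epsilon> / (2 * C')" using \<epsilon> C' by simp
  obtain \<delta>1 where d1: "0 < \<delta>1" and H1: "\<And>(n::nat) a b. nonoverlapping I {..<n} a b \<Longrightarrow>
      (\<Sum>i<n. b i - a i) < \<delta>1 \<Longrightarrow> (\<Sum>i<n. norm (f (b i) - f (a i))) < \<epsilon> / (2 * C')"
    using f e2 unfolding abs_cont_on_alt by blast
  obtain \<delta>2 where d2: "0 < \<delta>2" and H2: "\<And>(n::nat) a b. nonoverlapping I {..<n} a b \<Longrightarrow>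
      (\<Sum>i<n. b i - a i) < \<delta>2 \<Longrightarrow> (\<Sum>i<n. norm (g (b i) - g (a i))) < \<epsilon> / (2 * C')"
    using g e2 unfolding abs_cont_on_alt by blast
  show "\<exists>\<delta>>0. \<forall>(n::nat) a b. nonoverlapping I {..<n} a b \<longrightarrow>
      (\<Sum>i<n. b i - a i) < \<delta> \<longrightarrow> (\<Sum>i<n. norm (h (b i) - h (a i))) < \<epsilon>"
  proof (rule exI[of _ "min \<delta>1 \<delta>2"], intro conjI allI impI)
    fix n :: nat and a b :: "nat \<Rightarrow> real"
    assume A: "nonoverlapping I {..<n} a b" "(\<Sum>i<n. b i - a i) < min \<delta>1 \<delta>2"
    have "norm (h (b i) - h (a i)) \<le> C' * norm (f (b i) - f (a i)) + C' * norm (g (b i) - g (a i))"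
      if "i < n" for i
    proof -
      have "a i \<in> I" "b i \<in> I" using nonoverlapping_mem[OF A(1)] that by auto
      from h[OF this] show ?thesis
        by (rule order_trans) (intro add_mono mult_right_mono C' norm_ge_zero)
    qed
    then have "(\<Sum>i<n. norm (h (b i) - h (a i)))
        \<le> (\<Sum>i<n. C' * norm (f (b i) - f (a i)) + C' * norm (g (b i) - g (a i)))"
      by (intro sum_mono) auto
    also have "\<dots> = C' * (\<Sum>i<n. norm (f (b i) - f (a i))) + C' * (\<Sum>i<n. norm (g (b i) - g (a i)))"
      by (simp add: sum.distrib sum_distrib_left)
    also have "\<dots> < C' * (\<epsilon> / (2 * C')) + C' * (\<epsilon> / (2 * C'))"
      by (intro add_strict_mono mult_strict_left_mono H1 H2 C') (use A in auto)
    also have "\<dots> = \<epsilon>" using C' by (simp add: field_simps)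
    finally show "(\<Sum>i<n. norm (h (b i) - h (a i))) < \<epsilon>" .
  qed (use d1 d2 in auto)
qed

lemma abs_cont_on_lipschitz:
  assumes "abs_cont_on I f"
    and "\<And>s t. s \<in> I \<Longrightarrow> t \<in> I \<Longrightarrow> norm (h t - h s) \<le> C * norm (f t - f s)"
  shows "abs_cont_on I h"
  by (rule abs_cont_on_dominated[OF assms(1) assms(1), of h C 0]) (use assms(2) in auto)

lemma abs_cont_on_cong:
  assumes "abs_cont_on I f" "\<And>t. t \<in> I \<Longrightarrow> h t = f t"
  shows "abs_cont_on I h"
  by (rule abs_cont_on_lipschitz[OF assms(1), of h 1]) (use assms(2) in auto)

lemma abs_cont_on_const: "abs_cont_on I (\<lambda>_. c)"
  unfolding abs_cont_on_def by (auto intro!: exI[of _ 1])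

lemma abs_cont_on_add:
  assumes "abs_cont_on I f" "abs_cont_on I g"
  shows "abs_cont_on I (\<lambda>t. f t + g t)"
proof (rule abs_cont_on_dominated[OF assms, of _ 1 1])
  show "norm (f t + g t - (f s + g s)) \<le> 1 * norm (f t - f s) + 1 * norm (g t - g s)" for s t
    using norm_triangle_ineq[of "f t - f s" "g t - g s"] by (simp add: algebra_simps)
qed

lemma abs_cont_on_diff:
  assumes "abs_cont_on I f" "abs_cont_on I g"
  shows "abs_cont_on I (\<lambda>t. f t - g t)"
proof (rule abs_cont_on_dominated[OF assms, of _ 1 1])
  show "norm (f t - g t - (f s - g s)) \<le> 1 * norm (f t - f s) + 1 * norm (g t - g s)" for s t
    using norm_triangle_ineq4[of "f t - f s" "g t - g s"] by (simp add: algebra_simps)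
qed

lemma abs_cont_on_sum:
  "(\<And>i. i \<in> J \<Longrightarrow> abs_cont_on I (f i)) \<Longrightarrow> abs_cont_on I (\<lambda>t. \<Sum>i\<in>J. f i t)"
  by (induction J rule: infinite_finite_induct) (auto intro: abs_cont_on_const abs_cont_on_add)

lemma abs_cont_on_linear:
  assumes "bounded_linear L" "abs_cont_on I f"
  shows "abs_cont_on I (\<lambda>t. L (f t))"
proof -
  interpret bounded_linear L by fact
  obtain K where K: "\<And>x. norm (L x) \<le> norm x * K" using bounded by blast
  show ?thesis
    by (rule abs_cont_on_lipschitz[OF assms(2), of _ K]) (metis K diff mult.commute)
qed

lemma abs_cont_on_imp_continuous_on:
  assumes f: "abs_cont_on {0..T} f"
  shows "continuous_on {0..T} f"
  unfolding continuous_on_iff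
proof (intro ballI allI impI)
  fix t \<epsilon> :: real assume t: "t \<in> {0..T}" and \<epsilon>: "0 < \<epsilon>"
  obtain \<delta> where \<delta>: "0 < \<delta>" and H: "\<And>(n::nat) a b. nonoverlapping {0..T} {..<n} a b \<Longrightarrow>
      (\<Sum>i<n. b i - a i) < \<delta> \<Longrightarrow> (\<Sum>i<n. norm (f (b i) - f (a i))) < \<epsilon>"
    using f \<epsilon> unfolding abs_cont_on_alt by blast
  have "dist (f s) (f t) < \<epsilon>" if s: "s \<in> {0..T}" "dist s t < \<delta>" for s
  proof -
    have "(\<Sum>i<1. norm (f ((\<lambda>_::nat. max s t) i) - f ((\<lambda>_::nat. min s t) i))) < \<epsilon>"
      by (rule H) (use s t in \<open>auto simp: dist_real_def nonoverlapping_def\<close>)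
    then show ?thesis by (auto simp: dist_norm max_def min_def norm_minus_commute split: if_splits)
  qed
  then show "\<exists>d>0. \<forall>x'\<in>{0..T}. dist x' t < d \<longrightarrow> dist (f x') (f t) < \<epsilon>" using \<delta> by blast
qed

lemma abs_cont_on_bounded:
  assumes "abs_cont_on {0..T} f"
  obtains K where "0 < K" "\<And>t. t \<in> {0..T} \<Longrightarrow> norm (f t) \<le> K"
proof -
  have "bounded (f ` {0..T})"
    by (intro compact_imp_bounded compact_continuous_image abs_cont_on_imp_continuous_on assms compact_Icc)
  then show thesis using that by (auto simp: bounded_pos)
qed

lemma abs_cont_on_bilinear:
  assumes h: "bounded_bilinear h" and f: "abs_cont_on {0..T} f" and g: "abs_cont_on {0..T} g"
  shows "abs_cont_on {0..T} (\<lambda>t. h (f t) (g t))"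
proof -
  interpret bounded_bilinear h by fact
  obtain K where K: "0 \<le> K" "\<And>x y. norm (h x y) \<le> norm x * norm y * K"
    using nonneg_bounded by blast
  obtain F where F: "0 < F" "\<And>t. t \<in> {0..T} \<Longrightarrow> norm (f t) \<le> F" by (rule abs_cont_on_bounded[OF f]) blast
  obtain G where G: "0 < G" "\<And>t. t \<in> {0..T} \<Longrightarrow> norm (g t) \<le> G" by (rule abs_cont_on_bounded[OF g]) blast
  show ?thesis
  proof (rule abs_cont_on_dominated[OF f g, of _ "G * K" "F * K"])
    fix s t assume st: "s \<in> {0..T}" "t \<in> {0..T}"
    have "h (f t) (g t) - h (f s) (g s) = h (f t - f s) (g t) + h (f s) (g t - g s)"
      by (simp add: diff_left diff_right)
    then have "norm (h (f t) (g t) - h (f s) (g s))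
        \<le> norm (h (f t - f s) (g t)) + norm (h (f s) (g t - g s))"
      by (simp add: norm_triangle_ineq)
    also have "\<dots> \<le> norm (f t - f s) * norm (g t) * K + norm (f s) * norm (g t - g s) * K"
      by (intro add_mono K)
    also have "\<dots> \<le> norm (f t - f s) * G * K + F * norm (g t - g s) * K"
      by (intro add_mono mult_right_mono mult_left_mono K G F st) auto
    finally show "norm (h (f t) (g t) - h (f s) (g s)) \<le> G * K * norm (f t - f s) + F * K * norm (g t - g s)"
      by (simp add: mult_ac)
  qed
qed

section \<open>Positive variation\<close>

text \<open>
  Every absolutely continuous real function is a difference of two monotone ones. The first of them is
  the positive variation, the supremum over all partitions of the sum of the positive parts of the
  increments. Partitions are monotone sequences of which only an initial segment is used, and which may
  repeat points: they can then be cut at a point \<open>u\<close> by taking the minimum and the maximum with \<open>u\<close>.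
\<close>

definition rise :: "(real \<Rightarrow> real) \<Rightarrow> real \<Rightarrow> real \<Rightarrow> real" where
  "rise f s t = max 0 (f t - f s)"

definition partition_seq :: "real \<Rightarrow> real \<Rightarrow> nat \<Rightarrow> (nat \<Rightarrow> real) \<Rightarrow> bool" where
  "partition_seq s t n x \<longleftrightarrow> mono x \<and> x 0 = s \<and> x n = t"

definition rises :: "(real \<Rightarrow> real) \<Rightarrow> real \<Rightarrow> real \<Rightarrow> real set" where
  "rises f s t = {\<Sum>i<n. rise f (x i) (x (Suc i)) |n x. partition_seq s t n x}"

definition pos_variation :: "(real \<Rightarrow> real) \<Rightarrow> real \<Rightarrow> real \<Rightarrow> real" where
  "pos_variation f s t = Sup (rises f s t)"

lemma rise_in_rises: "s \<le> t \<Longrightarrow> rise f s t \<in> rises f s t"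
  unfolding rises_def partition_seq_def mem_Collect_eq
  by (rule exI[of _ 1], rule exI[of _ "\<lambda>i. if i = 0 then s else t"]) (auto simp: mono_def)

lemma rises_split:
  assumes r: "r \<in> rises f s t" and u: "s \<le> u" "u \<le> t"
  obtains r1 r2 where "r1 \<in> rises f s u" "r2 \<in> rises f u t" "r \<le> r1 + r2"
proof -
  obtain n x where x: "partition_seq s t n x" and r: "r = (\<Sum>i<n. rise f (x i) (x (Suc i)))"
    using r unfolding rises_def by blast
  define y z where "y = (\<lambda>i. min (x i) u)" and "z = (\<lambda>i. max (x i) u)"
  have "partition_seq s u n y" "partition_seq u t n z"
    using x u unfolding partition_seq_def y_def z_def mono_def by (auto intro: min.coboundedI1 max.coboundedI1)
  moreover have "rise f (x i) (x (Suc i)) \<le> rise f (y i) (y (Suc i)) + rise f (z i) (z (Suc i))" for i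
  proof -
    have "x i \<le> x (Suc i)" using x unfolding partition_seq_def mono_def by auto
    then show ?thesis unfolding rise_def y_def z_def by (auto simp: min_def max_def)
  qed
  then have "r \<le> (\<Sum>i<n. rise f (y i) (y (Suc i))) + (\<Sum>i<n. rise f (z i) (z (Suc i)))"
    unfolding r sum.distrib[symmetric] by (intro sum_mono) auto
  ultimately show thesis by (intro that) (auto simp: rises_def)
qed

lemma rises_extend:
  assumes r: "r \<in> rises f s t" and u: "t \<le> u"
  shows "r + rise f t u \<in> rises f s u"
proof -
  obtain n x where x: "partition_seq s t n x" and r: "r = (\<Sum>i<n. rise f (x i) (x (Suc i)))"
    using r unfolding rises_def by blast
  define y where "y = (\<lambda>i. if i \<le> n then x i else u)"
  have le: "x i \<le> u" if "i \<le> n" for i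
    using x that u unfolding partition_seq_def mono_def by (metis order_trans)
  have "partition_seq s u (Suc n) y"
    using x le unfolding partition_seq_def y_def mono_def by auto
  moreover have "(\<Sum>i<Suc n. rise f (y i) (y (Suc i))) = r + rise f t u"
    using x by (auto simp: r y_def partition_seq_def intro!: sum.cong)
  ultimately show ?thesis unfolding rises_def by force
qed

text \<open>
  Partitions of the members of a short family together form again a nonoverlapping family, of the same
  total length. This transfers the smallness in the definition of absolute continuity from \<open>f\<close> to its
  positive variation.
\<close>

lemma abs_cont_on_rises_small:
  assumes f: "abs_cont_on {0..T} (f::real \<Rightarrow> real)" and \<epsilon>: "0 < \<epsilon>"
  shows "\<exists>\<delta>>0. \<forall>(n::nat) a b r. nonoverlapping {0..T} {..<n} a b \<longrightarrow> (\<Sum>i<n. b i - a i) < \<delta> \<longrightarrow>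
      (\<forall>i<n. r i \<in> rises f (a i) (b i)) \<longrightarrow> (\<Sum>i<n. r i) < \<epsilon>"
proof -
  obtain \<delta> where \<delta>: "0 < \<delta>" and H: "\<And>(J::(nat \<times> nat) set) a b. finite J \<Longrightarrow> nonoverlapping {0..T} J a b \<Longrightarrow>
      (\<Sum>i\<in>J. b i - a i) < \<delta> \<Longrightarrow> (\<Sum>i\<in>J. norm (f (b i) - f (a i))) < \<epsilon>"
    using abs_cont_onD[OF f \<epsilon>] by blast
  show ?thesis
  proof (intro exI[of _ \<delta>] conjI allI impI \<delta>)
    fix n :: nat and a b r :: "nat \<Rightarrow> real"
    assume nab: "nonoverlapping {0..T} {..<n} a b"
      and s: "(\<Sum>i<n. b i - a i) < \<delta>" and r: "\<forall>i<n. r i \<in> rises f (a i) (b i)"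
    have ab: "\<And>i. i < n \<Longrightarrow> a i \<le> b i \<and> {a i..b i} \<subseteq> {0..T}"
      and dis: "\<And>i j. i < n \<Longrightarrow> j < n \<Longrightarrow> i \<noteq> j \<Longrightarrow> {a i<..<b i} \<inter> {a j<..<b j} = {}"
      using nab unfolding nonoverlapping_def by auto
    have "\<exists>m x. partition_seq (a i) (b i) m x \<and> r i = (\<Sum>j<m. rise f (x j) (x (Suc j)))" if "i < n" for i
      using r that unfolding rises_def by blast
    then obtain m x where x: "\<And>i. i < n \<Longrightarrow> partition_seq (a i) (b i) (m i) (x i)"
      and rx: "\<And>i. i < n \<Longrightarrow> r i = (\<Sum>j<m i. rise f (x i j) (x i (Suc j)))"
      by metis
    define J where "J = Sigma {..<n} (\<lambda>i. {..<m i})"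
    define c d where "c = (\<lambda>(i,j). x i j)" and "d = (\<lambda>(i,j). x i (Suc j))"
    have xb: "a i \<le> x i j" "x i j \<le> b i" if "i < n" "j \<le> m i" for i j
      using x[OF that(1)] that(2) unfolding partition_seq_def mono_def
      by (metis zero_le)+
    have mo: "x i j \<le> x i j'" if "i < n" "j \<le> j'" for i j j'
      using x[OF that(1)] that(2) unfolding partition_seq_def mono_def by auto
    have "(\<Sum>p\<in>J. norm (f (d p) - f (c p))) < \<epsilon>"
    proof (rule H)
      show "finite J" unfolding J_def by auto
      have cd1: "c p \<le> d p \<and> {c p..d p} \<subseteq> {0..T}" if p: "p \<in> J" for p
      proof -
        obtain i j where ij: "p = (i,j)" "i < n" "j < m i" using p unfolding J_def by auto
        have "c p \<le> d p" "a i \<le> c p" "d p \<le> b i"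
          using ij mo[of i j "Suc j"] xb[of i j] xb[of i "Suc j"] unfolding c_def d_def by auto
        then show ?thesis using ab[OF ij(2)] by auto
      qed
      have cd2: "{c p<..<d p} \<inter> {c q<..<d q} = {}" if pq: "p \<in> J" "q \<in> J" "p \<noteq> q" for p q
      proof -
        obtain i j where ij: "p = (i,j)" "i < n" "j < m i" using pq unfolding J_def by auto
        obtain i' j' where ij': "q = (i',j')" "i' < n" "j' < m i'" using pq unfolding J_def by auto
        show ?thesis
        proof (cases "i = i'")
          case False
          have "{c p<..<d p} \<subseteq> {a i<..<b i}" "{c q<..<d q} \<subseteq> {a i'<..<b i'}"
            using ij ij' xb[of i j] xb[of i "Suc j"] xb[of i' j'] xb[of i' "Suc j'"]
            unfolding c_def d_def by auto
          with dis[OF ij(2) ij'(2) False] show ?thesis by blast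
        next
          case True
          then have "j < j' \<or> j' < j" using pq ij ij' by auto
          then have "d p \<le> c q \<or> d q \<le> c p"
            using mo[of i "Suc j" j'] mo[of i "Suc j'" j] ij ij' True unfolding c_def d_def by auto
          then show ?thesis by auto
        qed
      qed
      show "nonoverlapping {0..T} J c d"
        unfolding nonoverlapping_def using cd1 cd2 by simp
      have "(\<Sum>j<m i. x i (Suc j) - x i j) = b i - a i" if "i < n" for i
        using x[OF that] sum_lessThan_telescope[of "x i" "m i"] unfolding partition_seq_def by simp
      then have "(\<Sum>i<n. b i - a i) = (\<Sum>i<n. \<Sum>j<m i. x i (Suc j) - x i j)" by simp
      also have "\<dots> = (\<Sum>p\<in>J. d p - c p)"
        by (simp add: J_def c_def d_def sum.Sigma split_beta)
      finally have "(\<Sum>p\<in>J. d p - c p) = (\<Sum>i<n. b i - a i)" by simp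
      then show "(\<Sum>p\<in>J. d p - c p) < \<delta>" using s by simp
    qed
    moreover have "(\<Sum>i<n. r i) = (\<Sum>p\<in>J. rise f (c p) (d p))"
      by (simp add: J_def c_def d_def sum.Sigma split_beta rx)
    moreover have "(\<Sum>p\<in>J. rise f (c p) (d p)) \<le> (\<Sum>p\<in>J. norm (f (d p) - f (c p)))"
      by (intro sum_mono) (auto simp: rise_def)
    ultimately show "(\<Sum>i<n. r i) < \<epsilon>" by linarith
  qed
qed

text \<open>
  On intervals shorter than some \<open>\<delta>\<close> the rises are at most \<open>1\<close>; an arbitrary interval consists of
  finitely many of these.
\<close>

lemma rises_bdd_above:
  assumes f: "abs_cont_on {0..T} f" and st: "0 \<le> s" "s \<le> t" "t \<le> T"
  shows "bdd_above (rises f s t)"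
proof -
  obtain \<delta> where \<delta>: "0 < \<delta>"
    and H: "\<And>(n::nat) a b r. nonoverlapping {0..T} {..<n} a b \<Longrightarrow> (\<Sum>i<n. b i - a i) < \<delta> \<Longrightarrow>
      \<forall>i<n. r i \<in> rises f (a i) (b i) \<Longrightarrow> (\<Sum>i<n. r i) < 1"
    using abs_cont_on_rises_small[OF f zero_less_one] by blast
  have short: "r < 1" if "r \<in> rises f u v" "0 \<le> u" "u \<le> v" "v \<le> T" "v - u < \<delta>" for r u v
    using H[of 1 "\<lambda>_. u" "\<lambda>_. v" "\<lambda>_. r"] that by (auto simp: nonoverlapping_def)
  have "\<forall>v r. u \<le> v \<longrightarrow> v \<le> T \<longrightarrow> v - u \<le> real k * (\<delta>/2) \<longrightarrow> r \<in> rises f u v \<longrightarrow> r \<le> real k + 1"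
    if "0 \<le> u" for u k
  proof (induction k)
    case 0
    then show ?case using short \<delta> that by fastforce
  next
    case (Suc k)
    show ?case
    proof (intro allI impI)
      fix v r assume v: "u \<le> v" "v \<le> T" "v - u \<le> real (Suc k) * (\<delta>/2)" and r: "r \<in> rises f u v"
      define w where "w = max u (v - \<delta>/2)"
      have w: "u \<le> w" "w \<le> v" using v \<delta> unfolding w_def by auto
      have w': "w - u \<le> real k * (\<delta>/2)" "v - w < \<delta>"
        using v \<delta> unfolding w_def by (auto simp: max_def field_simps)
      obtain r1 r2 where "r1 \<in> rises f u w" "r2 \<in> rises f w v" "r \<le> r1 + r2"
        using rises_split[OF r w] by blast
      moreover have "r1 \<le> real k + 1" using Suc w w' v calculation(1) by auto
      moreover have "r2 < 1" using short[of r2 w v] calculation w w' v that by auto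
      ultimately show "r \<le> real (Suc k) + 1" by auto
    qed
  qed
  moreover obtain k :: nat where "(t - s) / (\<delta>/2) \<le> real k" using real_arch_simple by blast
  then have "t - s \<le> real k * (\<delta>/2)" using \<delta> by (simp add: field_simps)
  ultimately show ?thesis using st by (intro bdd_aboveI[of _ "real k + 1"]) auto
qed

lemma pos_variation_subadditive:
  assumes f: "abs_cont_on {0..T} f" and st: "0 \<le> s" "s \<le> u" "u \<le> t" "t \<le> T"
  shows "pos_variation f s t \<le> pos_variation f s u + pos_variation f u t"
  unfolding pos_variation_def
proof (rule cSup_least)
  show "rises f s t \<noteq> {}" using rise_in_rises[of s t f] st by auto
  fix r assume r: "r \<in> rises f s t"
  obtain r1 r2 where *: "r1 \<in> rises f s u" "r2 \<in> rises f u t" "r \<le> r1 + r2"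
    using rises_split[OF r] st by metis
  have "r1 \<le> Sup (rises f s u)" "r2 \<le> Sup (rises f u t)"
    using * st by (auto intro!: cSup_upper rises_bdd_above[OF f])
  with * show "r \<le> Sup (rises f s u) + Sup (rises f u t)" by linarith
qed

lemma pos_variation_extend:
  assumes f: "abs_cont_on {0..T} f" and st: "0 \<le> s" "s \<le> t" "t \<le> u" "u \<le> T"
  shows "pos_variation f s t + rise f t u \<le> pos_variation f s u"
proof -
  have "pos_variation f s t \<le> pos_variation f s u - rise f t u"
    unfolding pos_variation_def
  proof (rule cSup_least)
    show "rises f s t \<noteq> {}" using rise_in_rises[of s t f] st by auto
    fix r assume "r \<in> rises f s t"
    then have "r + rise f t u \<le> Sup (rises f s u)"
      using st by (intro cSup_upper rises_extend rises_bdd_above[OF f]) auto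
    then show "r \<le> Sup (rises f s u) - rise f t u" by linarith
  qed
  then show ?thesis by linarith
qed

lemma abs_cont_on_pos_variation:
  assumes f: "abs_cont_on {0..T} f"
  shows "abs_cont_on {0..T} (pos_variation f 0)"
  unfolding abs_cont_on_alt
proof (intro allI impI)
  fix \<epsilon> :: real assume \<epsilon>: "0 < \<epsilon>"
  then have e2: "0 < \<epsilon>/2" by simp
  obtain \<delta> where \<delta>: "0 < \<delta>"
    and H: "\<And>(n::nat) a b r. nonoverlapping {0..T} {..<n} a b \<Longrightarrow> (\<Sum>i<n. b i - a i) < \<delta> \<Longrightarrow>
      \<forall>i<n. r i \<in> rises f (a i) (b i) \<Longrightarrow> (\<Sum>i<n. r i) < \<epsilon>/2"
    using abs_cont_on_rises_small[OF f e2] by blast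
  show "\<exists>\<delta>>0. \<forall>(n::nat) a b.
        nonoverlapping {0..T} {..<n} a b \<longrightarrow> (\<Sum>i<n. b i - a i) < \<delta> \<longrightarrow>
        (\<Sum>i<n. norm (pos_variation f 0 (b i) - pos_variation f 0 (a i))) < \<epsilon>"
  proof (rule exI[of _ \<delta>], intro conjI allI impI \<delta>)
    fix n :: nat and a b :: "nat \<Rightarrow> real"
    assume A: "nonoverlapping {0..T} {..<n} a b" "(\<Sum>i<n. b i - a i) < \<delta>"
    have ab: "0 \<le> a i" "a i \<le> b i" "b i \<le> T" if "i < n" for i
      using nonoverlapping_mem[OF A(1)] that by auto
    define \<eta> where "\<eta> = \<epsilon> / (2 * (real n + 1))"
    have \<eta>: "\<eta> > 0" "real n * \<eta> < \<epsilon>/2" using \<epsilon> unfolding \<eta>_def by (auto simp: field_simps)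
    have "\<exists>r \<in> rises f (a i) (b i). pos_variation f (a i) (b i) - \<eta> < r" if "i < n" for i
      unfolding pos_variation_def
      using less_cSup_iff[of "rises f (a i) (b i)" "Sup (rises f (a i) (b i)) - \<eta>"] \<eta> ab[OF that]
        rises_bdd_above[OF f, of "a i" "b i"] rise_in_rises[of "a i" "b i" f] by auto
    then obtain r where r: "\<And>i. i < n \<Longrightarrow> r i \<in> rises f (a i) (b i)"
      "\<And>i. i < n \<Longrightarrow> pos_variation f (a i) (b i) - \<eta> < r i" by metis
    have "norm (pos_variation f 0 (b i) - pos_variation f 0 (a i)) \<le> r i + \<eta>" if "i < n" for i
    proof -
      have "pos_variation f 0 (b i) \<le> pos_variation f 0 (a i) + pos_variation f (a i) (b i)"
        using ab[OF that] by (intro pos_variation_subadditive[OF f]) auto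
      moreover have "pos_variation f 0 (a i) + rise f (a i) (b i) \<le> pos_variation f 0 (b i)"
        using ab[OF that] by (intro pos_variation_extend[OF f]) auto
      moreover have "0 \<le> rise f (a i) (b i)" unfolding rise_def by simp
      ultimately show ?thesis using r(2)[OF that] by auto
    qed
    then have "(\<Sum>i<n. norm (pos_variation f 0 (b i) - pos_variation f 0 (a i))) \<le> (\<Sum>i<n. r i + \<eta>)"
      by (intro sum_mono) auto
    also have "\<dots> = (\<Sum>i<n. r i) + real n * \<eta>" by (simp add: sum.distrib)
    also have "\<dots> < \<epsilon>/2 + \<epsilon>/2"
      using A r by (intro add_strict_mono \<eta> H[of n a b r]) auto
    finally show "(\<Sum>i<n. norm (pos_variation f 0 (b i) - pos_variation f 0 (a i))) < \<epsilon>" by simp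
  qed
qed

lemma abs_cont_on_monotone_decomposition:
  assumes f: "abs_cont_on {0..T} (f::real \<Rightarrow> real)"
  obtains p q where "abs_cont_on {0..T} p" "mono_on {0..T} p" "abs_cont_on {0..T} q" "mono_on {0..T} q"
    "\<And>t. f t = p t - q t"
proof (rule that[of "pos_variation f 0" "\<lambda>t. pos_variation f 0 t - f t"])
  show "abs_cont_on {0..T} (pos_variation f 0)" by (rule abs_cont_on_pos_variation[OF f])
  then show "abs_cont_on {0..T} (\<lambda>t. pos_variation f 0 t - f t)" by (rule abs_cont_on_diff[OF _ f])
  have "pos_variation f 0 s \<le> pos_variation f 0 t \<and> pos_variation f 0 s - f s \<le> pos_variation f 0 t - f t"
    if "s \<in> {0..T}" "t \<in> {0..T}" "s \<le> t" for s t
    using pos_variation_extend[OF f, of 0 s t] that unfolding rise_def by (auto simp: max_def split: if_splits)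
  then show "mono_on {0..T} (pos_variation f 0)" "mono_on {0..T} (\<lambda>t. pos_variation f 0 t - f t)"
    by (auto simp: mono_on_def)
qed auto

section \<open>Absolutely continuous functions as indefinite integrals\<close>

lemma absolutely_integrable_on_subinterval_real:
  fixes g :: "real \<Rightarrow> 'a::euclidean_space"
  assumes "g absolutely_integrable_on {0..T}" "0 \<le> a" "b \<le> T"
  shows "g absolutely_integrable_on {a..b}" "g integrable_on {a..b}"
proof -
  show "g absolutely_integrable_on {a..b}"
    by (rule set_integrable_subset[OF assms(1)]) (use assms in auto)
  then show "g integrable_on {a..b}" by (rule set_lebesgue_integral_eq_integral(1))
qed

text \<open>
  The Stieltjes measure of a monotone absolutely continuous function has no singular part: a null set
  lies in an open set of small length, which is exhausted by finite unions of nonoverlapping intervals,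
  and on such a union the Stieltjes measure is a sum of increments of \<open>p\<close>. The function is extended to
  the whole line by the constants \<open>p 0\<close> and \<open>p T\<close>.
\<close>

lemma mono_abs_cont_on_interval_measure:
  fixes p :: "real \<Rightarrow> real"
  assumes p: "abs_cont_on {0..T} p" and mono: "mono_on {0..T} p" and T: "0 \<le> T"
  defines "F \<equiv> \<lambda>x. p (max 0 (min T x))"
  shows "mono F" "continuous_on UNIV F" "absolutely_continuous lborel (interval_measure F)"
proof -
  define cl where "cl = (\<lambda>x. max 0 (min T x))"
  have F: "F x = p (cl x)" for x unfolding F_def cl_def ..
  have cl: "cl x \<in> {0..T}" "x \<le> y \<Longrightarrow> cl x \<le> cl y" for x y using T unfolding cl_def by auto
  have clb: "cl y - cl x \<le> y - x" if "x \<le> y" for x y using that T unfolding cl_def by auto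
  show mF: "mono F" using mono cl unfolding F mono_def mono_on_def by blast
  then have mF': "x \<le> y \<Longrightarrow> F x \<le> F y" for x y by (simp add: monoD)
  have "continuous_on UNIV (p \<circ> cl)"
  proof (rule continuous_on_compose)
    show "continuous_on UNIV cl" unfolding cl_def by (intro continuous_intros)
    show "continuous_on (range cl) p"
      by (rule continuous_on_subset[OF abs_cont_on_imp_continuous_on[OF p]]) (use cl in auto)
  qed
  then show cF: "continuous_on UNIV F" by (simp add: F[abs_def] o_def)
  let ?\<mu> = "interval_measure F"
  have Icc: "emeasure ?\<mu> {a..b} = ennreal (F b - F a)" if "a \<le> b" for a b
    by (rule emeasure_interval_measure_Icc[OF that mF' cF])
  have small: "\<exists>\<delta>>0. \<forall>U. open U \<longrightarrow> emeasure lborel U < ennreal \<delta> \<longrightarrow> emeasure ?\<mu> U \<le> ennreal \<epsilon>"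
    if \<epsilon>: "0 < \<epsilon>" for \<epsilon>
  proof -
    obtain \<delta> where \<delta>: "0 < \<delta>" and H: "\<And>(J::real set set) a b. finite J \<Longrightarrow> nonoverlapping {0..T} J a b \<Longrightarrow>
      (\<Sum>i\<in>J. b i - a i) < \<delta> \<Longrightarrow> (\<Sum>i\<in>J. norm (p (b i) - p (a i))) < \<epsilon>"
      using abs_cont_onD[OF p \<epsilon>] by blast
    have elem: "emeasure ?\<mu> V \<le> ennreal \<epsilon>"
      if d: "d division_of V" and V: "emeasure lborel V < ennreal \<delta>" for d V
    proof -
      note dD = division_ofD[OF d]
      have K: "\<exists>l u. K = {l..u} \<and> l \<le> u \<and> Inf K = l \<and> Sup K = u" if "K \<in> d" for K
        using dD(3,4)[OF that] by fastforce
      have fm: "V \<in> lmeasurable" by (rule lmeasurable_division[OF d])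
      have "(\<Sum>K\<in>d. Sup K - Inf K) = (\<Sum>K\<in>d. measure lebesgue K)"
      proof (intro sum.cong refl)
        fix L assume "L \<in> d"
        then obtain l u where "L = {l..u}" "l \<le> u" "Inf L = l" "Sup L = u" using K by blast
        then show "Sup L - Inf L = measure lebesgue L" by simp
      qed
      also have "\<dots> = measure lebesgue V" by (rule content_division[OF d])
      also have "\<dots> < \<delta>"
      proof -
        have "V \<in> sets lborel"
        proof -
          have "\<Union>d \<in> sets borel"
          proof (rule sets.finite_Union[OF dD(1)], rule subsetI)
            fix L assume "L \<in> d"
            then obtain l u where "L = {l..u}" using K by blast
            then show "L \<in> sets borel" by simp
          qed
          then show ?thesis using dD(6) by simp
        qed
        then have "measure lebesgue V = measure lborel V" by simp
        moreover have "ennreal (measure lborel V) < ennreal \<delta>"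
        proof -
          have "emeasure lborel V \<noteq> \<infinity>" using V by auto
          then show ?thesis using V by (simp add: emeasure_eq_ennreal_measure)
        qed
        ultimately show ?thesis using \<delta> by (simp add: ennreal_less_iff)
      qed
      finally have len: "(\<Sum>K\<in>d. Sup K - Inf K) < \<delta>" .
      define a b where "a = (\<lambda>K. cl (Inf K))" and "b = (\<lambda>K. cl (Sup K :: real))"
      have "(\<Sum>K\<in>d. norm (p (b K) - p (a K))) < \<epsilon>"
      proof (rule H)
        show "finite d" by (rule dD(1))
        have "(\<Sum>K\<in>d. b K - a K) \<le> (\<Sum>K\<in>d. Sup K - Inf K)"
        proof (rule sum_mono)
          fix L assume L: "L \<in> d"
          obtain l u where "l \<le> u" "Inf L = l" "Sup L = u" using K[OF L] by blast
          then show "b L - a L \<le> Sup L - Inf L" using clb unfolding a_def b_def by auto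
        qed
        with len show "(\<Sum>K\<in>d. b K - a K) < \<delta>" by linarith
        show "nonoverlapping {0..T} d a b"
          unfolding nonoverlapping_def
        proof (intro conjI ballI impI)
          show "a K \<le> b K" if L: "K \<in> d" for K
          proof -
            obtain l u where "l \<le> u" "Inf K = l" "Sup K = u" using K[OF L] by blast
            then show ?thesis using cl(2) unfolding a_def b_def by auto
          qed
          show "{a K..b K} \<subseteq> {0..T}" for K
            using cl(1)[of "Inf K"] cl(1)[of "Sup K"] unfolding a_def b_def by simp
          fix K K' assume KK: "K \<in> d" "K' \<in> d" "K \<noteq> K'"
          have clin: "l < x \<and> x < u" if "cl l < x" "x < cl u" for l x u :: real
            using that T unfolding cl_def by (simp add: max_def min_def split: if_splits)
          have sub: "{a L<..<b L} \<subseteq> interior L" if L: "L \<in> d" for L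
          proof -
            obtain l u where "L = {l..u}" "Inf L = l" "Sup L = u" using K[OF L] by blast
            then show ?thesis using clin[of l _ u] unfolding a_def b_def by (simp add: subset_iff)
          qed
          show "{a K<..<b K} \<inter> {a K'<..<b K'} = {}"
            using dD(5)[OF KK] sub[OF KK(1)] sub[OF KK(2)] by blast
        qed
      qed
      have "emeasure ?\<mu> V = emeasure ?\<mu> (\<Union>K\<in>d. K)" using dD(6) by simp
      also have "\<dots> \<le> (\<Sum>K\<in>d. emeasure ?\<mu> K)"
      proof (intro emeasure_subadditive_finite dD(1), rule image_subsetI)
        fix L assume "L \<in> d"
        then obtain l u where "L = {l..u}" using K by blast
        then show "L \<in> sets ?\<mu>" by simp
      qed
      also have "\<dots> = (\<Sum>K\<in>d. ennreal (norm (p (b K) - p (a K))))"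
      proof (intro sum.cong refl)
        fix L assume "L \<in> d"
        then obtain l u where lu: "L = {l..u}" "l \<le> u" "Inf L = l" "Sup L = u" using K by blast
        show "emeasure ?\<mu> L = ennreal (norm (p (b L) - p (a L)))"
          using mF'[of l u] lu Icc[of l u] unfolding a_def b_def F by simp
      qed
      also have "\<dots> = ennreal (\<Sum>K\<in>d. norm (p (b K) - p (a K)))" by (simp add: sum_ennreal)
      also have "\<dots> \<le> ennreal \<epsilon>"
        using \<open>(\<Sum>K\<in>d. norm (p (b K) - p (a K))) < \<epsilon>\<close> by (intro ennreal_leI) auto
      finally show ?thesis .
    qed
    show ?thesis
    proof (intro exI[of _ \<delta>] conjI allI impI \<delta>)
      fix U :: "real set" assume U: "open U" "emeasure lborel U < ennreal \<delta>"
      obtain \<D> where \<D>: "countable \<D>" "\<D> \<subseteq> Pow U" "\<And>X. X \<in> \<D> \<Longrightarrow> \<exists>a b. X = cbox a b" "\<Union>\<D> = U"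
        using open_countable_Union_open_cbox[OF U(1)] by metis
      show "emeasure ?\<mu> U \<le> ennreal \<epsilon>"
      proof (cases "\<D> = {}")
        case True then show ?thesis using \<D> by auto
      next
        case False
        define V where "V n = \<Union> (from_nat_into \<D> ` {..n})" for n
        have fn: "from_nat_into \<D> n \<in> \<D>" for n by (rule from_nat_into[OF False])
        have UV: "(\<Union>n. V n) = U"
        proof
          show "(\<Union>n. V n) \<subseteq> U" unfolding V_def using fn \<D>(4) by blast
          show "U \<subseteq> (\<Union>n. V n)"
          proof
            fix x assume "x \<in> U"
            then obtain X where "X \<in> \<D>" "x \<in> X" using \<D>(4) by blast
            then obtain n where "from_nat_into \<D> n = X" using from_nat_into_surj[OF \<D>(1)] by blast
            then show "x \<in> (\<Union>n. V n)" using \<open>x \<in> X\<close> unfolding V_def by blast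
          qed
        qed
        have Vs: "V n \<in> sets ?\<mu>" for n
        proof -
          have "from_nat_into \<D> i \<in> sets borel" for i using \<D>(3)[OF fn[of i]] by auto
          then show ?thesis unfolding V_def by auto
        qed
        have inc: "incseq V" unfolding V_def incseq_def by force
        have "emeasure ?\<mu> U = (SUP n. emeasure ?\<mu> (V n))"
          using SUP_emeasure_incseq[OF _ inc, of ?\<mu>] Vs UV by (simp add: image_subset_iff)
        also have "\<dots> \<le> ennreal \<epsilon>"
        proof (rule SUP_least)
          fix n
          have "\<exists>a b. X = cbox a b" if "X \<in> from_nat_into \<D> ` {..n}" for X
            using that \<D>(3) fn by blast
          then obtain d where d: "d division_of V n"
            using elementary_unions_intervals[of "from_nat_into \<D> ` {..n}"] unfolding V_def by auto
          have "emeasure lborel (V n) \<le> emeasure lborel U"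
            using UV U(1) by (intro emeasure_mono) auto
          then have "emeasure lborel (V n) < ennreal \<delta>" using U(2) by (rule le_less_trans)
          then show "emeasure ?\<mu> (V n) \<le> ennreal \<epsilon>" by (rule elem[OF d])
        qed
        finally show ?thesis .
      qed
    qed
  qed
  show "absolutely_continuous lborel ?\<mu>"
    unfolding absolutely_continuous_def
  proof
    fix N assume N: "N \<in> null_sets (lborel::real measure)"
    then have Nb: "N \<in> sets borel" by auto
    have "emeasure ?\<mu> N \<le> 0 + ennreal \<epsilon>" if \<epsilon>: "0 < \<epsilon>" for \<epsilon>
    proof -
      obtain \<delta> where \<delta>: "0 < \<delta>" "\<And>U. open U \<Longrightarrow> emeasure lborel U < ennreal \<delta> \<Longrightarrow> emeasure ?\<mu> U \<le> ennreal \<epsilon>"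
        using small[OF \<epsilon>] by blast
      obtain U where U: "open U" "N \<subseteq> U" "emeasure lborel (U - N) < \<delta>"
        using outer_regular_lborel[OF Nb \<delta>(1)] by metis
      have "emeasure lborel U = emeasure lborel (U - N)"
        using emeasure_Diff_null_set[OF N, of U] U(1) by auto
      then have "emeasure ?\<mu> U \<le> ennreal \<epsilon>" using U \<delta>(2) by auto
      moreover have "emeasure ?\<mu> N \<le> emeasure ?\<mu> U" using U by (intro emeasure_mono) auto
      ultimately show ?thesis by simp
    qed
    then have "emeasure ?\<mu> N \<le> 0" by (rule ennreal_le_epsilon)
    then show "N \<in> null_sets ?\<mu>" using Nb by auto
  qed
qed

text \<open>
  The integrand is the Radon-Nikodym derivative of the Stieltjes measure.
\<close>

lemma mono_abs_cont_on_indefinite_integral: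
  fixes p :: "real \<Rightarrow> real"
  assumes p: "abs_cont_on {0..T} p" and mono: "mono_on {0..T} p" and T: "0 \<le> T"
  obtains g where "g absolutely_integrable_on {0..T}" "\<And>t. t \<in> {0..T} \<Longrightarrow> p t = p 0 + integral {0..t} g"
proof -
  define F where "F = (\<lambda>x. p (max 0 (min T x)))"
  let ?\<mu> = "interval_measure F"
  note * = mono_abs_cont_on_interval_measure[OF assms, folded F_def]
  have mF: "x \<le> y \<Longrightarrow> F x \<le> F y" for x y using *(1) by (simp add: monoD)
  have cF: "continuous (at_right a) F" for a
    using *(2) by (simp add: continuous_on_eq_continuous_within continuous_at_imp_continuous_at_within)
  have Fp: "F t = p t" if "t \<in> {0..T}" for t using that unfolding F_def by auto
  have Ioc: "emeasure ?\<mu> {a<..b} = ennreal (F b - F a)" if "a \<le> b" for a b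
    by (rule emeasure_interval_measure_Ioc[OF that mF cF])
  interpret mu: sigma_finite_measure ?\<mu> by (rule sigma_finite_interval_measure[OF mF cF])
  define h where "h = RN_deriv lborel ?\<mu>"
  have h[measurable]: "h \<in> borel_measurable lborel" unfolding h_def by simp
  have dens: "density lborel h = ?\<mu>"
    unfolding h_def by (rule sigma_finite_measure.density_RN_deriv[OF sigma_finite_lborel *(3)]) simp
  have fin: "AE x in lborel. h x \<noteq> \<infinity>"
    unfolding h_def by (rule sigma_finite_measure.RN_deriv_finite[OF sigma_finite_lborel mu.sigma_finite_measure_axioms *(3)]) simp
  define g where "g x = enn2real (h x)" for x
  have hg: "AE x in lborel. h x = ennreal (g x)" using fin by eventually_elim (auto simp: g_def less_top)
  have gm[measurable]: "g \<in> borel_measurable borel" unfolding g_def using h by measurable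
  have bi: "has_bochner_integral lborel (\<lambda>x. indicator {0<..t} x * g x) (F t - F 0)" if t: "0 \<le> t" for t
  proof (rule has_bochner_integral_nn_integral)
    show "(\<lambda>x. indicator {0<..t} x * g x) \<in> borel_measurable lborel" by measurable
    show "0 \<le> F t - F 0" using mF t by simp
    have "(\<integral>\<^sup>+x. ennreal (indicator {0<..t} x * g x) \<partial>lborel) = (\<integral>\<^sup>+x. h x * indicator {0<..t} x \<partial>lborel)"
      by (rule nn_integral_cong_AE, use hg in eventually_elim) (auto simp: indicator_def)
    also have "\<dots> = emeasure (density lborel h) {0<..t}" by (rule emeasure_density[symmetric]) auto
    also have "\<dots> = ennreal (F t - F 0)" using Ioc[OF t] dens by simp
    finally show "(\<integral>\<^sup>+x. ennreal (indicator {0<..t} x * g x) \<partial>lborel) = ennreal (F t - F 0)" .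
  qed (auto simp: g_def)
  have hi: "(g has_integral (F t - F 0)) {0..t}" if t: "0 \<le> t" for t
  proof -
    have "((\<lambda>x. indicator {0<..t} x * g x) has_integral (F t - F 0)) UNIV"
      using has_integral_integral_lborel[OF has_bochner_integral_iff[THEN iffD1, OF bi[OF t], THEN conjunct1]]
        bi[OF t] by (simp add: has_bochner_integral_iff)
    then have "((\<lambda>x. if x \<in> {0<..t} then g x else 0) has_integral (F t - F 0)) UNIV"
      by (rule has_integral_eq[rotated]) auto
    then have "(g has_integral (F t - F 0)) {0<..t}" by (simp only: has_integral_restrict_UNIV)
    then show ?thesis
      by (rule has_integral_spike_set_eq[THEN iffD1, rotated 2]) (auto intro: negligible_subset[of "{0}"])
  qed
  show thesis
  proof (rule that)
    have "g integrable_on {0..T}" using hi[OF T] by blast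
    then show "g absolutely_integrable_on {0..T}"
      by (intro nonnegative_absolutely_integrable_1) (auto simp: g_def)
    show "p t = p 0 + integral {0..t} g" if "t \<in> {0..T}" for t
      using integral_unique[OF hi[of t]] that Fp[of t] Fp[of 0] T by auto
  qed
qed

lemma abs_cont_on_indefinite_integral_real:
  fixes f :: "real \<Rightarrow> real"
  assumes f: "abs_cont_on {0..T} f" and T: "0 \<le> T"
  obtains g where "g absolutely_integrable_on {0..T}" "\<And>t. t \<in> {0..T} \<Longrightarrow> f t = f 0 + integral {0..t} g"
proof -
  obtain p q where pq: "abs_cont_on {0..T} p" "mono_on {0..T} p" "abs_cont_on {0..T} q" "mono_on {0..T} q"
    "\<And>t. f t = p t - q t" by (rule abs_cont_on_monotone_decomposition[OF f]) blast
  obtain g where g: "g absolutely_integrable_on {0..T}" "\<And>t. t \<in> {0..T} \<Longrightarrow> p t = p 0 + integral {0..t} g"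
    by (rule mono_abs_cont_on_indefinite_integral[OF pq(1,2) T]) blast
  obtain h where h: "h absolutely_integrable_on {0..T}" "\<And>t. t \<in> {0..T} \<Longrightarrow> q t = q 0 + integral {0..t} h"
    by (rule mono_abs_cont_on_indefinite_integral[OF pq(3,4) T]) blast
  show thesis
  proof (rule that[of "\<lambda>x. g x - h x"])
    show "(\<lambda>x. g x - h x) absolutely_integrable_on {0..T}" by (rule set_integral_diff(1)[OF g(1) h(1)])
    fix t assume t: "t \<in> {0..T}"
    have "g integrable_on {0..t}" "h integrable_on {0..t}"
      using absolutely_integrable_on_subinterval_real(2)[OF g(1)] absolutely_integrable_on_subinterval_real(2)[OF h(1)] t
      by auto
    then show "f t = f 0 + integral {0..t} (\<lambda>x. g x - h x)"
      using g(2)[OF t] h(2)[OF t] pq(5) by (simp add: integral_diff)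
  qed
qed

lemma abs_cont_on_indefinite_integral:
  fixes f :: "real \<Rightarrow> 'a::euclidean_space"
  assumes f: "abs_cont_on {0..T} f" and T: "0 \<le> T"
  obtains g where "g absolutely_integrable_on {0..T}" "\<And>t. t \<in> {0..T} \<Longrightarrow> f t = f 0 + integral {0..t} g"
proof -
  have "\<exists>g. g absolutely_integrable_on {0..T} \<and> (\<forall>t\<in>{0..T}. f t \<bullet> b = f 0 \<bullet> b + integral {0..t} g)" for b
  proof -
    have "abs_cont_on {0..T} (\<lambda>t. f t \<bullet> b)"
      by (rule abs_cont_on_linear[OF bounded_linear_inner_left f])
    from abs_cont_on_indefinite_integral_real[OF this T] show ?thesis by metis
  qed
  then obtain g where g: "\<And>b. g b absolutely_integrable_on {0..T}"
    "\<And>b t. t \<in> {0..T} \<Longrightarrow> f t \<bullet> b = f 0 \<bullet> b + integral {0..t} (g b)" by metis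
  show thesis
  proof (rule that[of "\<lambda>x. \<Sum>b\<in>Basis. g b x *\<^sub>R b"])
    show "(\<lambda>x. \<Sum>b\<in>Basis. g b x *\<^sub>R b) absolutely_integrable_on {0..T}"
      by (intro absolutely_integrable_sum absolutely_integrable_scaleR_right g) auto
    fix t assume t: "t \<in> {0..T}"
    have gi: "g b integrable_on {0..t}" for b
      using absolutely_integrable_on_subinterval_real(2)[OF g(1)] t by auto
    have "((\<lambda>x. \<Sum>b\<in>Basis. g b x *\<^sub>R b) has_integral (\<Sum>b\<in>Basis. integral {0..t} (g b) *\<^sub>R b)) {0..t}"
      by (intro has_integral_sum finite_Basis has_integral_scaleR_left integrable_integral gi)
    then have "integral {0..t} (\<lambda>x. \<Sum>b\<in>Basis. g b x *\<^sub>R b) = (\<Sum>b\<in>Basis. integral {0..t} (g b) *\<^sub>R b)"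
      by (rule integral_unique)
    then show "f t = f 0 + integral {0..t} (\<lambda>x. \<Sum>b\<in>Basis. g b x *\<^sub>R b)"
      using g(2)[OF t] by (subst euclidean_eq_iff) (simp add: inner_add_left inner_sum_left_Basis)
  qed
qed

section \<open>Differentiation almost everywhere\<close>

lemma AE_lebesgue_negligible:
  assumes "negligible N" "\<And>t. t \<notin> N \<Longrightarrow> P t"
  shows "AE t in lebesgue. P t"
proof (rule AE_I'[of N])
  show "N \<in> null_sets lebesgue" using assms(1) by (simp add: negligible_iff_null_sets)
  show "{t \<in> space lebesgue. \<not> P t} \<subseteq> N" using assms(2) by auto
qed

lemma AE_lebesgue_obtain_negligible:
  assumes "AE t in lebesgue. P t"
  obtains N where "negligible N" "\<And>t. t \<notin> N \<Longrightarrow> P t"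
  using assms by (auto simp: eventually_ae_filter negligible_iff_null_sets)

lemma AE_interior_Icc:
  "AE t\<in>{0..T::real} in lebesgue. t \<in> {0<..<T}"
  by (rule AE_lebesgue_negligible[of "{0,T}"]) auto

lemma indefinite_integral_right_derivative:
  fixes f :: "real \<Rightarrow> 'a::euclidean_space"
  assumes f: "f absolutely_integrable_on UNIV"
  obtains N where "negligible N"
    and "\<And>t \<epsilon>. t \<notin> N \<Longrightarrow> 0 < \<epsilon> \<Longrightarrow> \<exists>d>0. \<forall>h. 0 \<le> h \<and> h < d \<longrightarrow> norm (integral {t..t+h} f - h *\<^sub>R f t) \<le> \<epsilon> * h"
proof -
  have "f integrable_on cbox a b" for a b
    by (metis f set_lebesgue_integral_eq_integral(1) integrable_on_subcbox subset_UNIV)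
  from integrable_ccontinuous_explicit[OF this] obtain N where N: "negligible N"
    and H: "\<And>x e. x \<notin> N \<Longrightarrow> 0 < e \<Longrightarrow> \<exists>d>0. \<forall>h. 0 < h \<and> h < d \<longrightarrow>
                         norm (integral (cbox x (x + h *\<^sub>R One)) f /\<^sub>R h ^ DIM(real) - f x) < e"
    by metis
  show thesis
  proof (rule that[OF N])
    fix t \<epsilon> :: real assume t: "t \<notin> N" and \<epsilon>: "0 < \<epsilon>"
    obtain d where d: "d > 0" "\<And>h. 0 < h \<Longrightarrow> h < d \<Longrightarrow> norm (integral {t..t+h} f /\<^sub>R h - f t) < \<epsilon>"
      using H[OF t \<epsilon>] by auto
    have "norm (integral {t..t+h} f - h *\<^sub>R f t) \<le> \<epsilon> * h" if h: "0 \<le> h" "h < d" for h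
    proof (cases "h = 0")
      case False
      then have h0: "0 < h" using h by simp
      have "integral {t..t+h} f - h *\<^sub>R f t = h *\<^sub>R (integral {t..t+h} f /\<^sub>R h - f t)"
        using h0 by (simp add: scaleR_diff_right)
      then have "norm (integral {t..t+h} f - h *\<^sub>R f t) = h * norm (integral {t..t+h} f /\<^sub>R h - f t)"
        using h0 by simp
      also have "\<dots> \<le> h * \<epsilon>" using d(2)[OF h0 h(2)] h0 by (intro mult_left_mono) auto
      finally show ?thesis by (simp add: mult.commute)
    qed auto
    then show "\<exists>d>0. \<forall>h. 0 \<le> h \<and> h < d \<longrightarrow> norm (integral {t..t+h} f - h *\<^sub>R f t) \<le> \<epsilon> * h"
      using d(1) by blast
  qed
qed

text \<open>
  Lebesgue's differentiation theorem in dimension one. The averages over \<open>{t..t+h}\<close> give the right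
  derivative; the left derivative is the right derivative for the reflected integrand.
\<close>

lemma indefinite_integral_has_vector_derivative_AE:
  fixes g :: "real \<Rightarrow> 'a::euclidean_space"
  assumes g: "g absolutely_integrable_on {0..T}"
    and F: "\<And>t. t \<in> {0..T} \<Longrightarrow> F t = c + integral {0..t} g"
  shows "AE t\<in>{0..T} in lebesgue. (F has_vector_derivative g t) (at t)"
proof -
  define f where "f = (\<lambda>t. indicator {0..T} t *\<^sub>R g t)"
  have f: "f absolutely_integrable_on UNIV"
    using g unfolding f_def set_integrable_def by simp
  have f': "(\<lambda>t. f (- t)) absolutely_integrable_on UNIV"
  proof -
    have "(\<lambda>t. g (- t)) absolutely_integrable_on {-T..-0}"
      using g by (simp only: absolutely_integrable_reflect_real)
    moreover have "(\<lambda>t. f (- t)) = (\<lambda>t. indicator {-T..-0} t *\<^sub>R g (- t))"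
      unfolding f_def by (rule ext) (auto simp: indicator_def)
    ultimately show ?thesis by (simp add: set_integrable_def)
  qed
  obtain N where N: "negligible N"
    and HN: "\<And>t \<epsilon>. t \<notin> N \<Longrightarrow> 0 < \<epsilon> \<Longrightarrow> \<exists>d>0. \<forall>h. 0 \<le> h \<and> h < d \<longrightarrow> norm (integral {t..t+h} f - h *\<^sub>R f t) \<le> \<epsilon> * h"
    by (rule indefinite_integral_right_derivative[OF f]) blast
  obtain N' where N': "negligible N'"
    and HN': "\<And>t \<epsilon>. t \<notin> N' \<Longrightarrow> 0 < \<epsilon> \<Longrightarrow> \<exists>d>0. \<forall>h. 0 \<le> h \<and> h < d \<longrightarrow> norm (integral {t..t+h} (\<lambda>t. f (- t)) - h *\<^sub>R f (- t)) \<le> \<epsilon> * h"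
    by (rule indefinite_integral_right_derivative[OF f']) blast
  have "negligible (uminus ` N')" by (rule negligible_differentiable_image_negligible[OF _ N']) (simp_all add: linear_imp_differentiable_on linear_uminus)
  show ?thesis
  proof (rule AE_lebesgue_negligible[of "N \<union> uminus ` N' \<union> {0,T}"], intro negligible_Un N \<open>negligible (uminus ` N')\<close>)
    fix t assume t: "t \<notin> N \<union> uminus ` N' \<union> {0, T}"
    show "t \<in> {0..T} \<longrightarrow> (F has_vector_derivative g t) (at t)"
    proof
      assume tT: "t \<in> {0..T}"
      have fg: "f t = g t" using tT unfolding f_def by simp
      have diff: "F v - F u = integral {u..v} f" if "0 \<le> u" "u \<le> v" "v \<le> T" for u v
      proof -
        have "integral {0..u} g + integral {u..v} g = integral {0..v} g"
          by (intro Henstock_Kurzweil_Integration.integral_combine absolutely_integrable_on_subinterval_real(2)[OF g])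
            (use that in auto)
        moreover have "integral {u..v} f = integral {u..v} g"
          using that by (intro Henstock_Kurzweil_Integration.integral_cong) (auto simp: f_def)
        ultimately show ?thesis using F[of u] F[of v] that by (simp add: algebra_simps)
      qed
      show "(F has_vector_derivative g t) (at t)"
        unfolding has_vector_derivative_def has_derivative_at_alt
      proof (intro conjI allI impI bounded_linear_scaleR_left)
        fix \<epsilon> :: real assume \<epsilon>: "0 < \<epsilon>"
        obtain d1 where d1: "0 < d1" "\<And>h. 0 \<le> h \<Longrightarrow> h < d1 \<Longrightarrow> norm (integral {t..t+h} f - h *\<^sub>R f t) \<le> \<epsilon> * h"
          using HN[OF _ \<epsilon>, of t] t by blast
        have "- t \<notin> N'" using t by force
        then obtain d2 where d2: "0 < d2" "\<And>h. 0 \<le> h \<Longrightarrow> h < d2 \<Longrightarrow>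
            norm (integral {-t..-t+h} (\<lambda>t. f (- t)) - h *\<^sub>R f t) \<le> \<epsilon> * h"
          using HN'[OF _ \<epsilon>, of "-t"] by auto
        define d where "d = Min {d1, d2, t, T - t}"
        have d: "0 < d" "d \<le> d1" "d \<le> d2" "d \<le> t" "d \<le> T - t"
          using d1 d2 t tT unfolding d_def by auto
        have "norm (F y - F t - (y - t) *\<^sub>R g t) \<le> \<epsilon> * norm (y - t)" if y: "norm (y - t) < d" for y
        proof (cases "t \<le> y")
          case True
          then show ?thesis using d1(2)[of "y - t"] diff[of t y] y d tT fg by auto
        next
          case False
          have "integral {-t..-y} (\<lambda>t. f (- t)) = integral {y..t} f" by simp
          then have "norm (integral {y..t} f - (t - y) *\<^sub>R g t) \<le> \<epsilon> * (t - y)"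
            using d2(2)[of "t - y"] y d False fg by auto
          moreover have "F y - F t - (y - t) *\<^sub>R g t = - (integral {y..t} f - (t - y) *\<^sub>R g t)"
            using diff[of y t] y d tT False by (auto simp: algebra_simps)
          ultimately show ?thesis using False by (simp add: norm_minus_commute)
        qed
        then show "\<exists>d>0. \<forall>y. norm (y - t) < d \<longrightarrow> norm (F y - F t - (y - t) *\<^sub>R g t) \<le> \<epsilon> * norm (y - t)"
          using d(1) by blast
      qed
    qed
  qed auto
qed

lemma velocity_eqI:
  assumes "(F has_vector_derivative v) (at t)" "t \<in> {0..T}" "0 < T"
  shows "velocity T F t = v"
  unfolding velocity_def
  by (rule vector_derivative_within_cbox[of 0 T, simplified, OF _ _ has_vector_derivative_at_within[OF assms(1)]])
    (use assms in auto)

text \<open>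
  The velocity is a derivative within \<open>{0..T}\<close>, so values outside this interval do not affect it.
\<close>

lemma velocity_cong:
  assumes "\<And>s. s \<in> {0..T} \<Longrightarrow> F s = G s" "t \<in> {0..T}"
  shows "velocity T F t = velocity T G t"
proof -
  have "(F has_vector_derivative v) (at t within {0..T}) \<longleftrightarrow> (G has_vector_derivative v) (at t within {0..T})" for v
  proof
    show "(F has_vector_derivative v) (at t within {0..T})" if "(G has_vector_derivative v) (at t within {0..T})"
      by (rule has_vector_derivative_transform[OF assms(2) _ that]) (rule assms(1))
    show "(G has_vector_derivative v) (at t within {0..T})" if "(F has_vector_derivative v) (at t within {0..T})"
      by (rule has_vector_derivative_transform[OF assms(2) _ that]) (simp add: assms(1))
  qed
  then show ?thesis unfolding velocity_def vector_derivative_def by (simp only:)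
qed

proposition abs_cont_on_fundamental_theorem:
  fixes f :: "real \<Rightarrow> 'a::euclidean_space"
  assumes f: "abs_cont_on {0..T} f" and T: "0 < T"
  shows "AE t\<in>{0..T} in lebesgue. (f has_vector_derivative velocity T f t) (at t)"
    and "velocity T f absolutely_integrable_on {0..T}"
    and "t \<in> {0..T} \<Longrightarrow> f t = f 0 + integral {0..t} (velocity T f)"
proof -
  obtain g where g: "g absolutely_integrable_on {0..T}" "\<And>t. t \<in> {0..T} \<Longrightarrow> f t = f 0 + integral {0..t} g"
    by (rule abs_cont_on_indefinite_integral[OF f less_imp_le[OF T]]) blast
  have ae: "AE t\<in>{0..T} in lebesgue. (f has_vector_derivative g t) (at t)"
    by (rule indefinite_integral_has_vector_derivative_AE[OF g])
  then have ae2: "AE t\<in>{0..T} in lebesgue. velocity T f t = g t"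
    by eventually_elim (use velocity_eqI T in blast)
  show "AE t\<in>{0..T} in lebesgue. (f has_vector_derivative velocity T f t) (at t)"
    using ae ae2 by eventually_elim simp
  obtain N where neg: "negligible N" and N: "\<And>t. t \<notin> N \<Longrightarrow> t \<in> {0..T} \<longrightarrow> velocity T f t = g t"
    by (rule AE_lebesgue_obtain_negligible[OF ae2]) blast
  show "velocity T f absolutely_integrable_on {0..T}"
    by (rule absolutely_integrable_spike[OF g(1) neg]) (use N in auto)
  show "f t = f 0 + integral {0..t} (velocity T f)" if "t \<in> {0..T}"
  proof -
    have "integral {0..t} g = integral {0..t} (velocity T f)"
      by (rule integral_spike[OF neg]) (use that N in auto)
    then show ?thesis using g(2)[OF that] by simp
  qed
qed

text \<open>
  The form of the fundamental theorem in which it is applied: an explicit formula for the derivative is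
  known almost everywhere. In particular a function with derivative \<open>0\<close> almost everywhere is constant.
\<close>

lemma abs_cont_on_derivative_integral:
  fixes f :: "real \<Rightarrow> 'a::euclidean_space"
  assumes f: "abs_cont_on {0..T} f" and T: "0 < T"
    and g: "AE t\<in>{0..T} in lebesgue. (f has_vector_derivative g t) (at t)"
  shows "g absolutely_integrable_on {0..T}"
    and "t \<in> {0..T} \<Longrightarrow> f t = f 0 + integral {0..t} g"
proof -
  have "AE t\<in>{0..T} in lebesgue. g t = velocity T f t"
    using g by eventually_elim (auto dest: velocity_eqI[OF _ _ T])
  then obtain N where neg: "negligible N" and N: "\<And>t. t \<notin> N \<Longrightarrow> t \<in> {0..T} \<longrightarrow> g t = velocity T f t"
    by (rule AE_lebesgue_obtain_negligible) blast
  show "g absolutely_integrable_on {0..T}"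
    by (rule absolutely_integrable_spike[OF abs_cont_on_fundamental_theorem(2)[OF f T] neg]) (use N in auto)
  assume t: "t \<in> {0..T}"
  have "integral {0..t} (velocity T f) = integral {0..t} g"
    by (rule integral_spike[OF neg]) (use N t in auto)
  then show "f t = f 0 + integral {0..t} g"
    using abs_cont_on_fundamental_theorem(3)[OF f T t] by simp
qed

text \<open>
  The open intervals are disjoint, so the sum is the integral of a function that is at most \<open>w\<close>.
\<close>

lemma sum_integral_nonoverlapping_le:
  fixes w :: "real \<Rightarrow> real"
  assumes w: "w integrable_on {0..T}" "\<And>t. 0 \<le> w t" and ab: "nonoverlapping {0..T} {..<n::nat} a b"
  shows "(\<Sum>i<n. integral {a i..b i} w) \<le> integral {0..T} w"
proof -
  define u where "u i x = (if x \<in> {a i<..<b i} then w x else 0)" for i x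
  have sub2: "{a i..b i} \<subseteq> {0..T}" if "i < n" for i
    using ab that unfolding nonoverlapping_def by simp
  have sub1: "{a i<..<b i} \<inter> {0..T} = {a i<..<b i}" if "i < n" for i
    using sub2[OF that] greaterThanLessThan_subseteq_atLeastAtMost_iff[of "a i" "b i" "a i" "b i"] by blast
  have wi: "w integrable_on {a i<..<b i}" if "i < n" for i
    using integrable_on_subinterval[OF w(1) sub2[OF that]] by (simp add: integrable_on_Icc_iff_Ioo)
  have ui: "u i integrable_on {0..T}" if "i < n" for i
    unfolding u_def integrable_restrict_Int by (simp only: sub1[OF that] wi[OF that])
  have "integral {a i..b i} w = integral {0..T} (u i)" if "i < n" for i
    unfolding u_def Henstock_Kurzweil_Integration.integral_restrict_Int sub1[OF that]
    by (rule integral_open_interval_real)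
  then have "(\<Sum>i<n. integral {a i..b i} w) = (\<Sum>i<n. integral {0..T} (u i))" by simp
  also have "\<dots> = integral {0..T} (\<lambda>x. \<Sum>i<n. u i x)"
    by (rule Henstock_Kurzweil_Integration.integral_sum[symmetric]) (use ui in auto)
  also have "\<dots> \<le> integral {0..T} w"
  proof (rule integral_le)
    show "(\<lambda>x. \<Sum>i<n. u i x) integrable_on {0..T}"
      by (rule Henstock_Kurzweil_Integration.integrable_sum) (use ui in auto)
    show "w integrable_on {0..T}" by (rule w(1))
    show "(\<Sum>i<n. u i x) \<le> w x" for x
    proof (cases "\<exists>i0<n. x \<in> {a i0<..<b i0}")
      case True
      then obtain i0 where i0: "i0 < n" "x \<in> {a i0<..<b i0}" by blast
      have "u i x = 0" if "i < n" "i \<noteq> i0" for i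
      proof -
        have "{a i<..<b i} \<inter> {a i0<..<b i0} = {}"
          using ab that i0(1) unfolding nonoverlapping_def by blast
        then show ?thesis using i0(2) unfolding u_def by auto
      qed
      then have "(\<Sum>i<n. u i x) = (\<Sum>i\<in>{i0}. u i x)"
        by (intro sum.mono_neutral_right) (use i0 in auto)
      then show ?thesis using w(2) by (simp add: u_def)
    next
      case False
      then have "(\<Sum>i<n. u i x) = 0" by (intro sum.neutral) (auto simp: u_def)
      then show ?thesis using w(2) by simp
    qed
  qed
  finally show ?thesis .
qed

lemma integral_combine_difference:
  fixes g :: "real \<Rightarrow> 'a::euclidean_space"
  assumes g: "g absolutely_integrable_on {0..T}" and "0 \<le> a" "a \<le> b" "b \<le> T"
  shows "integral {0..b} g - integral {0..a} g = integral {a..b} g"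
proof -
  have "integral {0..a} g + integral {a..b} g = integral {0..b} g"
    by (rule Henstock_Kurzweil_Integration.integral_combine[OF assms(2,3) absolutely_integrable_on_subinterval_real(2)[OF g]])
      (use assms in auto)
  then show ?thesis by (simp add: algebra_simps)
qed

text \<open>
  Truncating \<open>norm (g t)\<close> at a high level \<open>N\<close> changes its integral by less than \<open>\<epsilon>/2\<close>, while the truncated
  part contributes at most \<open>N\<close> times the total length of the intervals.
\<close>

lemma abs_cont_on_integral:
  fixes g :: "real \<Rightarrow> 'a::euclidean_space"
  assumes g: "g absolutely_integrable_on {0..T}"
    and F: "\<And>t. t \<in> {0..T} \<Longrightarrow> F t = c + integral {0..t} g"
  shows "abs_cont_on {0..T} F"
  unfolding abs_cont_on_alt
proof (intro allI impI)
  fix \<epsilon> :: real assume \<epsilon>: "0 < \<epsilon>"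
  define k where "k t = norm (g t)" for t
  define kN where "kN N t = min (k t) (real N)" for N t
  have k: "k absolutely_integrable_on {0..T}" unfolding k_def by (rule absolutely_integrable_norm[OF g, unfolded o_def])
  have kN: "kN N absolutely_integrable_on {0..T}" for N
    unfolding kN_def by (intro absolutely_integrable_min_1 k absolutely_integrable_on_const) auto
  have "(\<lambda>N. integral {0..T} (kN N)) \<longlonglongrightarrow> integral {0..T} k"
  proof (rule dominated_convergence(2))
    show "kN N integrable_on {0..T}" for N using kN by (rule set_lebesgue_integral_eq_integral(1))
    show "k integrable_on {0..T}" using k by (rule set_lebesgue_integral_eq_integral(1))
    show "norm (kN N t) \<le> k t" for N t unfolding kN_def k_def by auto
    show "(\<lambda>N. kN N t) \<longlonglongrightarrow> k t" for t
    proof (rule tendsto_eventually)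
      obtain N0 :: nat where "k t \<le> real N0" using real_arch_simple by blast
      then have "kN N t = k t" if "N0 \<le> N" for N using that unfolding kN_def by simp
      then show "\<forall>\<^sub>F N in sequentially. kN N t = k t" by (auto simp: eventually_sequentially)
    qed
  qed
  then obtain N where "norm (integral {0..T} (kN N) - integral {0..T} k) < \<epsilon>/2"
    using \<epsilon> by (metis LIMSEQ_D half_gt_zero le_refl)
  then have N: "integral {0..T} k - integral {0..T} (kN N) < \<epsilon>/2" unfolding real_norm_def by linarith
  define w where "w t = k t - kN N t" for t
  have w: "w absolutely_integrable_on {0..T}" unfolding w_def by (rule set_integral_diff(1)[OF k kN])
  have w0: "0 \<le> w t" for t unfolding w_def kN_def by simp
  have wint: "integral {0..T} w < \<epsilon>/2"
    unfolding w_def using N set_lebesgue_integral_eq_integral(1)[OF k] set_lebesgue_integral_eq_integral(1)[OF kN]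
    by (simp add: Henstock_Kurzweil_Integration.integral_diff)
  define \<delta> where "\<delta> = \<epsilon> / (2 * (real N + 1))"
  have \<delta>: "0 < \<delta>" "real N * \<delta> \<le> \<epsilon>/2" using \<epsilon> unfolding \<delta>_def by (auto simp: field_simps)
  show "\<exists>\<delta>>0. \<forall>(n::nat) a b. nonoverlapping {0..T} {..<n} a b \<longrightarrow>
      (\<Sum>i<n. b i - a i) < \<delta> \<longrightarrow> (\<Sum>i<n. norm (F (b i) - F (a i))) < \<epsilon>"
  proof (intro exI[of _ \<delta>] conjI allI impI \<delta>(1))
    fix n :: nat and a b :: "nat \<Rightarrow> real"
    assume ab: "nonoverlapping {0..T} {..<n} a b" and s: "(\<Sum>i<n. b i - a i) < \<delta>"
    have le: "norm (F (b i) - F (a i)) \<le> integral {a i..b i} w + real N * (b i - a i)" if "i < n" for i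
    proof -
      have i: "a i \<in> {0..T}" "b i \<in> {0..T}" "a i \<le> b i" using nonoverlapping_mem[OF ab] that by auto
      note sub = absolutely_integrable_on_subinterval_real(2)[where T=T and a="a i" and b="b i"]
      have "F (b i) - F (a i) = integral {a i..b i} g"
        using F i integral_combine_difference[OF g, of "a i" "b i"] by simp
      also have "norm \<dots> \<le> integral {a i..b i} (\<lambda>t. w t + real N)"
      proof (rule Henstock_Kurzweil_Integration.integral_norm_bound_integral)
        show "g integrable_on {a i..b i}" using sub[OF g] i by simp
        show "(\<lambda>t. w t + real N) integrable_on {a i..b i}"
          using sub[OF w] i by (intro integrable_add) auto
        show "norm (g t) \<le> w t + real N" for t unfolding w_def kN_def k_def by auto
      qed
      also have "\<dots> = integral {a i..b i} w + integral {a i..b i} (\<lambda>t. real N)"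
        using sub[OF w] i by (intro Henstock_Kurzweil_Integration.integral_add) auto
      also have "integral {a i..b i} (\<lambda>t. real N) = real N * (b i - a i)" using i by simp
      finally show ?thesis .
    qed
    have "(\<Sum>i<n. norm (F (b i) - F (a i))) \<le> (\<Sum>i<n. integral {a i..b i} w + real N * (b i - a i))"
      by (rule sum_mono) (use le in auto)
    also have "\<dots> = (\<Sum>i<n. integral {a i..b i} w) + real N * (\<Sum>i<n. b i - a i)"
      by (simp add: sum.distrib sum_distrib_left)
    also have "\<dots> \<le> integral {0..T} w + real N * \<delta>"
      using s by (intro add_mono mult_left_mono sum_integral_nonoverlapping_le[OF _ w0 ab]
          set_lebesgue_integral_eq_integral(1)[OF w]) auto
    also have "\<dots> < \<epsilon>" using wint \<delta>(2) by linarith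
    finally show "(\<Sum>i<n. norm (F (b i) - F (a i))) < \<epsilon>" .
  qed
qed

lemma abs_cont_on_exp:
  fixes f :: "real \<Rightarrow> real"
  assumes f: "abs_cont_on {0..T} f"
  shows "abs_cont_on {0..T} (\<lambda>t. exp (f t))"
proof -
  obtain M where M: "0 < M" "\<And>t. t \<in> {0..T} \<Longrightarrow> norm (f t) \<le> M"
    by (rule abs_cont_on_bounded[OF f]) blast
  have "norm (exp y - exp x) \<le> exp M * norm (y - x)" if "x \<in> {-M..M}" "y \<in> {-M..M}" for x y :: real
    by (rule field_differentiable_bound[of "{-M..M}" exp exp]) (use that in \<open>auto intro: DERIV_subset[OF DERIV_exp]\<close>)
  then show ?thesis
    by (intro abs_cont_on_lipschitz[OF f, of _ "exp M"]) (use M(2) in \<open>auto simp: abs_le_iff minus_le_iff\<close>)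
qed

section \<open>Linear differential equations with integrable coefficients\<close>

text \<open>
  An integrable bound for the operator norms of \<open>G t\<close> in the equation \<open>X' = G t X\<close>.
\<close>

definition coefficient_bound :: "(real \<Rightarrow> 'a \<Rightarrow> 'a::euclidean_space) \<Rightarrow> real \<Rightarrow> real" where
  "coefficient_bound G t = (\<Sum>b\<in>Basis. norm (G t b))"

lemma linear_sum_Basis:
  fixes L :: "'a::euclidean_space \<Rightarrow> 'b::real_vector"
  assumes "linear L"
  shows "L x = (\<Sum>b\<in>Basis. (x \<bullet> b) *\<^sub>R L b)"
  by (subst euclidean_representation[of x, symmetric]) (simp add: linear_sum[OF assms] linear_cmul[OF assms])

lemma norm_coefficient_bound:
  assumes "linear (G t)"
  shows "norm (G t x) \<le> coefficient_bound G t * norm x"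
proof -
  have "norm (G t x) = norm (\<Sum>b\<in>Basis. (x \<bullet> b) *\<^sub>R G t b)" using linear_sum_Basis[OF assms] by metis
  also have "\<dots> \<le> (\<Sum>b\<in>Basis. norm ((x \<bullet> b) *\<^sub>R G t b))" by (rule norm_sum)
  also have "\<dots> \<le> (\<Sum>b\<in>Basis. norm (G t b) * norm x)"
  proof (rule sum_mono)
    fix b :: 'a assume "b \<in> Basis"
    then have "\<bar>x \<bullet> b\<bar> \<le> norm x" by (rule Basis_le_norm)
    then show "norm ((x \<bullet> b) *\<^sub>R G t b) \<le> norm (G t b) * norm x"
      by (simp add: mult.commute mult_right_mono)
  qed
  also have "\<dots> = coefficient_bound G t * norm x" unfolding coefficient_bound_def by (simp add: sum_distrib_right)
  finally show ?thesis .
qed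

lemma coefficient_bound_integrable:
  assumes "\<And>b. b \<in> Basis \<Longrightarrow> (\<lambda>t. G t b) absolutely_integrable_on {0..T}"
  shows "coefficient_bound G absolutely_integrable_on {0..T}"
  unfolding coefficient_bound_def
  by (intro absolutely_integrable_sum absolutely_integrable_norm[unfolded o_def] assms finite_Basis)

lemma absolutely_integrable_scaleR_continuous:
  fixes f :: "real \<Rightarrow> real" and g :: "real \<Rightarrow> 'a::euclidean_space"
  assumes f: "continuous_on {0..T} f" and g: "g absolutely_integrable_on {0..T}"
  shows "(\<lambda>t. f t *\<^sub>R g t) absolutely_integrable_on {0..T}"
proof (rule absolutely_integrable_bounded_measurable_product[of scaleR])
  show "bilinear (scaleR :: real \<Rightarrow> 'a \<Rightarrow> 'a)" by (simp add: bilinear_conv_bounded_bilinear bounded_bilinear_scaleR)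
  show "f \<in> borel_measurable (lebesgue_on {0..T})"
    by (rule continuous_imp_measurable_on_sets_lebesgue[OF f]) auto
  show "bounded (f ` {0..T})" by (intro compact_imp_bounded compact_continuous_image f) auto
qed (use g in auto)

lemma linear_coefficient_integrable:
  fixes Y :: "real \<Rightarrow> 'a::euclidean_space"
  assumes lin: "\<And>t. linear (G t)" and int: "\<And>b. b \<in> Basis \<Longrightarrow> (\<lambda>t. G t b) absolutely_integrable_on {0..T}"
    and Y: "continuous_on {0..T} Y"
  shows "(\<lambda>t. G t (Y t) :: 'b::euclidean_space) absolutely_integrable_on {0..T}"
proof -
  have "(\<lambda>t. \<Sum>b\<in>Basis. (Y t \<bullet> b) *\<^sub>R G t b) absolutely_integrable_on {0..T}"
    by (intro absolutely_integrable_sum finite_Basis absolutely_integrable_scaleR_continuous int continuous_intros Y)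
  then show ?thesis by (simp add: linear_sum_Basis[OF lin, symmetric])
qed

text \<open>
  With \<open>c = 2\<close> the function \<open>E c\<close> is the weight that makes the integral operator of the equation a contraction; with
  \<open>c = -2\<close> it is the integrating factor in the uniqueness proof.
\<close>

lemma integral_coefficient_exp:
  fixes k :: "real \<Rightarrow> real"
  assumes k: "k absolutely_integrable_on {0..T}" and T: "0 < T"
  defines "E \<equiv> \<lambda>c t. exp (c * integral {0..t} k)"
  shows "abs_cont_on {0..T} (E c)"
    and "AE t\<in>{0..T} in lebesgue. (E c has_vector_derivative c * k t * E c t) (at t)"
    and "t \<in> {0..T} \<Longrightarrow> integral {0..t} (\<lambda>s. c * k s * E c s) = E c t - 1"
    and "(\<lambda>s. c * k s * E c s) absolutely_integrable_on {0..T}"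
proof -
  define K where "K t = integral {0..t} k" for t
  have E: "E c t = exp (c * K t)" for t unfolding E_def K_def ..
  have K: "abs_cont_on {0..T} K" by (rule abs_cont_on_integral[OF k, of K 0]) (simp add: K_def)
  have "abs_cont_on {0..T} (\<lambda>t. c * K t)" by (rule abs_cont_on_linear[OF bounded_linear_mult_right K])
  then show ac: "abs_cont_on {0..T} (E c)" unfolding E[abs_def] by (rule abs_cont_on_exp)
  have "AE t\<in>{0..T} in lebesgue. (K has_vector_derivative k t) (at t)"
    by (rule indefinite_integral_has_vector_derivative_AE[OF k, of K 0]) (simp add: K_def)
  then show ae: "AE t\<in>{0..T} in lebesgue. (E c has_vector_derivative c * k t * E c t) (at t)"
  proof eventually_elim
    case (elim t)
    show ?case
    proof
      assume "t \<in> {0..T}"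
      then have "(K has_field_derivative k t) (at t)"
        using elim by (simp add: has_real_derivative_iff_has_vector_derivative)
      then have "((\<lambda>t. exp (c * K t)) has_field_derivative exp (c * K t) * (c * k t)) (at t)"
        by (intro DERIV_fun_exp DERIV_cmult)
      then show "(E c has_vector_derivative c * k t * E c t) (at t)"
        unfolding E[abs_def] by (simp add: has_real_derivative_iff_has_vector_derivative mult_ac)
    qed
  qed
  show "(\<lambda>s. c * k s * E c s) absolutely_integrable_on {0..T}"
    by (rule abs_cont_on_derivative_integral(1)[OF ac T ae])
  have "E c 0 = 1" unfolding E_def by simp
  then show "integral {0..t} (\<lambda>s. c * k s * E c s) = E c t - 1" if "t \<in> {0..T}"
    using abs_cont_on_derivative_integral(2)[OF ac T ae that] by simp
qed

text \<open>
  Gronwall's argument: if \<open>k\<close> bounds the operator norm of \<open>G\<close>, then \<open>exp (-2 \<integral>k) * (X \<bullet> X)\<close> has a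
  nonpositive derivative almost everywhere, starts at \<open>0\<close>, and is nonnegative.
\<close>

proposition linear_ode_unique:
  fixes X :: "real \<Rightarrow> 'a::euclidean_space"
  assumes T: "0 < T" and lin: "\<And>t. linear (G t)"
    and int: "\<And>b. b \<in> Basis \<Longrightarrow> (\<lambda>t. G t b) absolutely_integrable_on {0..T}"
    and X: "abs_cont_on {0..T} X" "X 0 = 0"
    and ode: "AE t\<in>{0..T} in lebesgue. (X has_vector_derivative G t (X t)) (at t)"
    and t: "t \<in> {0..T}"
  shows "X t = 0"
proof -
  define k where "k = coefficient_bound G"
  have k: "k absolutely_integrable_on {0..T}" unfolding k_def by (rule coefficient_bound_integrable[OF int])
  define E where "E t = exp (-2 * integral {0..t} k)" for t
  note EE = integral_coefficient_exp[OF k T, where c="-2", folded E_def]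
  define g where "g t = E t * (2 * (X t \<bullet> G t (X t)) - 2 * k t * (X t \<bullet> X t))" for t
  have ac: "abs_cont_on {0..T} (\<lambda>t. E t * (X t \<bullet> X t))"
    by (intro abs_cont_on_bilinear[OF bounded_bilinear_mult] abs_cont_on_bilinear[OF bounded_bilinear_inner] X EE(1))
  have ae: "AE t\<in>{0..T} in lebesgue. ((\<lambda>t. E t * (X t \<bullet> X t)) has_vector_derivative g t) (at t)"
    using ode EE(2)
  proof eventually_elim
    case (elim t)
    show ?case
    proof
      assume "t \<in> {0..T}"
      then have 1: "(X has_vector_derivative G t (X t)) (at t)" "(E has_vector_derivative -2 * k t * E t) (at t)"
        using elim by auto
      have "((\<lambda>t. X t \<bullet> X t) has_vector_derivative (X t \<bullet> G t (X t) + G t (X t) \<bullet> X t)) (at t)"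
        by (rule bounded_bilinear.has_vector_derivative[OF bounded_bilinear_inner 1(1) 1(1)])
      from bounded_bilinear.has_vector_derivative[OF bounded_bilinear_mult 1(2) this]
      have "((\<lambda>t. E t * (X t \<bullet> X t)) has_vector_derivative
          (E t * (X t \<bullet> G t (X t) + G t (X t) \<bullet> X t) + -2 * k t * E t * (X t \<bullet> X t))) (at t)" .
      then show "((\<lambda>t. E t * (X t \<bullet> X t)) has_vector_derivative g t) (at t)"
        unfolding g_def by (simp add: inner_commute algebra_simps)
    qed
  qed
  have g0: "g t \<le> 0" for t
  proof -
    have "X t \<bullet> G t (X t) \<le> norm (X t) * norm (G t (X t))" by (rule norm_cauchy_schwarz)
    also have "\<dots> \<le> norm (X t) * (k t * norm (X t))"
      unfolding k_def by (intro mult_left_mono norm_coefficient_bound lin) auto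
    also have "\<dots> = k t * (X t \<bullet> X t)" by (simp add: power2_norm_eq_inner[symmetric] power2_eq_square)
    finally show ?thesis unfolding g_def by (intro mult_nonneg_nonpos) (auto simp: E_def)
  qed
  have gi: "g integrable_on {0..t}"
    using absolutely_integrable_on_subinterval_real(2)[OF abs_cont_on_derivative_integral(1)[OF ac T ae], of 0 t] t by auto
  have "integral {0..t} g \<le> integral {0..t} (\<lambda>t. 0)"
    by (rule integral_le[OF gi]) (auto simp: g0)
  then have "E t * (X t \<bullet> X t) \<le> 0"
    using abs_cont_on_derivative_integral(2)[OF ac T ae t] X(2) by simp
  then show "X t = 0"
    by (metis E_def exp_gt_zero inner_gt_zero_iff mult_pos_pos not_less)
qed

text \<open>
  The integral equation \<open>X t = z + \<integral>G s (X s) ds\<close> is solved by Banach's fixed point theorem. The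
  unknown is \<open>y = X / E\<close> with \<open>E = exp (2 \<integral>k)\<close>, because in the supremum norm of \<open>y\<close> the integral
  operator has Lipschitz constant \<open>1/2\<close> on the whole interval: \<open>\<integral>k E = (E - 1) / 2\<close>.
\<close>

proposition linear_ode_exists:
  fixes z :: "'a::euclidean_space"
  assumes T: "0 < T" and lin: "\<And>t. linear (G t)"
    and int: "\<And>b. b \<in> Basis \<Longrightarrow> (\<lambda>t. G t b) absolutely_integrable_on {0..T}"
  obtains X where "abs_cont_on {0..T} X" "X 0 = z"
    "AE t\<in>{0..T} in lebesgue. (X has_vector_derivative G t (X t)) (at t)"
proof -
  define k where "k = coefficient_bound G"
  have k: "k absolutely_integrable_on {0..T}" unfolding k_def by (rule coefficient_bound_integrable[OF int])
  have k0: "0 \<le> k t" for t unfolding k_def coefficient_bound_def by (simp add: sum_nonneg)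
  define E where "E t = exp (2 * integral {0..t} k)" for t
  note EE = integral_coefficient_exp[OF k T, where c="2", folded E_def]
  have E0: "0 < E t" for t unfolding E_def by simp
  have Ec: "continuous_on {0..T} E" by (rule abs_cont_on_imp_continuous_on[OF EE(1)])
  \<comment> \<open>Precomposing with this retraction yields functions on the whole line, hence elements of a Banach space.\<close>
  define cl where "cl = (\<lambda>x. max 0 (min T x))"
  have cl: "cl x \<in> {0..T}" for x using T unfolding cl_def by auto
  have cl_id: "cl x = x" if "x \<in> {0..T}" for x using that unfolding cl_def by auto
  have cl_cont: "continuous_on UNIV cl" unfolding cl_def by (intro continuous_intros)
  define h where "h y s = G s (E s *\<^sub>R apply_bcontfun y s)" for y :: "real \<Rightarrow>\<^sub>C 'a" and s
  have h: "h y absolutely_integrable_on {0..T}" for y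
    unfolding h_def
    by (rule linear_coefficient_integrable[OF lin int], assumption)
      (rule continuous_on_scaleR[OF Ec continuous_on_apply_bcontfun])
  define V where "V y t = z + integral {0..t} (h y)" for y t
  have V: "abs_cont_on {0..T} (V y)" for y by (rule abs_cont_on_integral[OF h]) (simp add: V_def)
  define F where "F y t = inverse (E (cl t)) *\<^sub>R V y (cl t)" for y t
  have F: "F y \<in> bcontfun" for y
  proof -
    have c: "continuous_on {0..T} (\<lambda>t. inverse (E t) *\<^sub>R V y t)"
      using E0 by (intro continuous_intros Ec abs_cont_on_imp_continuous_on[OF V]) (metis less_irrefl)
    have "continuous_on UNIV ((\<lambda>t. inverse (E t) *\<^sub>R V y t) \<circ> cl)"
      by (rule continuous_on_compose[OF cl_cont continuous_on_subset[OF c]]) (use cl in auto)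
    then have "continuous_on UNIV (F y)" by (simp add: F_def[abs_def] o_def)
    moreover have "bounded ((\<lambda>t. inverse (E t) *\<^sub>R V y t) ` {0..T})"
      by (intro compact_imp_bounded compact_continuous_image c) auto
    then have "bounded (range (F y))"
      by (rule bounded_subset) (use cl in \<open>auto simp: F_def\<close>)
    ultimately show ?thesis by (simp add: bcontfun_def)
  qed
  have contr: "dist (Bcontfun (F y)) (Bcontfun (F z)) \<le> 1/2 * dist y z" for y z
  proof (rule dist_bound)
    fix t
    let ?t = "cl t" let ?d = "dist y z"
    have hd: "norm (h y s - h z s) \<le> ?d / 2 * (2 * k s * E s)" for s
    proof -
      have "h y s - h z s = G s (E s *\<^sub>R (apply_bcontfun y s - apply_bcontfun z s))"
        unfolding h_def by (simp add: linear_diff[OF lin, symmetric] scaleR_diff_right)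
      then have "norm (h y s - h z s) \<le> k s * norm (E s *\<^sub>R (apply_bcontfun y s - apply_bcontfun z s))"
        unfolding k_def using norm_coefficient_bound[of G s] lin by metis
      also have "\<dots> \<le> k s * (E s * ?d)"
        using dist_bounded[of y s z] E0[of s]
        by (intro mult_left_mono k0) (simp add: dist_norm)
      finally show ?thesis by (simp add: mult_ac)
    qed
    have sub: "{0..?t} \<subseteq> {0..T}" using cl[of t] by auto
    have hi: "h y integrable_on {0..?t}" for y
      using absolutely_integrable_on_subinterval_real(2)[OF h, of 0 ?t] cl[of t] by auto
    have ei: "(\<lambda>s. ?d / 2 * (2 * k s * E s)) integrable_on {0..?t}"
      using absolutely_integrable_on_subinterval_real(2)[OF EE(4), of 0 ?t] cl[of t]
      by (intro integrable_on_mult_right) auto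
    have "V y ?t - V z ?t = integral {0..?t} (\<lambda>s. h y s - h z s)"
      unfolding V_def by (simp add: Henstock_Kurzweil_Integration.integral_diff hi)
    also have "norm \<dots> \<le> integral {0..?t} (\<lambda>s. ?d / 2 * (2 * k s * E s))"
      by (rule Henstock_Kurzweil_Integration.integral_norm_bound_integral[OF integrable_diff[OF hi hi] ei hd])
    also have "\<dots> = ?d / 2 * (E ?t - 1)"
      using EE(3)[OF cl] by (simp only: Henstock_Kurzweil_Integration.integral_mult_right)
    also have "\<dots> \<le> ?d / 2 * E ?t" by (intro mult_left_mono) auto
    finally have "norm (V y ?t - V z ?t) \<le> ?d / 2 * E ?t" .
    then have "inverse (E ?t) * norm (V y ?t - V z ?t) \<le> inverse (E ?t) * (?d / 2 * E ?t)"
      using E0[of ?t] by (intro mult_left_mono) auto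
    also have "\<dots> = 1/2 * ?d" using E0[of ?t] by (simp add: field_simps)
    finally have "inverse (E ?t) * norm (V y ?t - V z ?t) \<le> 1/2 * ?d" .
    moreover have "dist (F y t) (F z t) = inverse (E ?t) * norm (V y ?t - V z ?t)"
      using E0[of ?t] by (simp add: F_def dist_norm scaleR_diff_right[symmetric])
    ultimately show "dist (apply_bcontfun (Bcontfun (F y)) t) (apply_bcontfun (Bcontfun (F z)) t) \<le> 1/2 * ?d"
      by (simp add: Bcontfun_inverse F)
  qed
  have "\<exists>!y. Bcontfun (F y) = y"
    by (rule banach_fix_type[of "1/2"]) (use contr in auto)
  then obtain y where y: "Bcontfun (F y) = y" by blast
  define X where "X = V y"
  have yX: "apply_bcontfun y t = inverse (E t) *\<^sub>R X t" if "t \<in> {0..T}" for t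
    using Bcontfun_inverse[OF F, of y] y cl_id[OF that] unfolding X_def F_def by metis
  have hX: "h y t = G t (X t)" if "t \<in> {0..T}" for t
    unfolding h_def yX[OF that] using E0[of t] by simp
  have "AE t\<in>{0..T} in lebesgue. (X has_vector_derivative h y t) (at t)"
    by (rule indefinite_integral_has_vector_derivative_AE[OF h, of X z]) (simp add: X_def V_def)
  then have "AE t\<in>{0..T} in lebesgue. (X has_vector_derivative G t (X t)) (at t)"
    by eventually_elim (use hX in auto)
  moreover have "X 0 = z" unfolding X_def V_def by simp
  ultimately show thesis using V[of y] unfolding X_def[symmetric] by (intro that)
qed

section \<open>Orthogonal projections onto nondegenerate subspaces\<close>

locale scalar_product =
  fixes B :: "'a::euclidean_space \<Rightarrow> 'a \<Rightarrow> real"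
  assumes form: "scalar_product_form B"
begin

lemma bilin: "bilinear B" and commute: "B x y = B y x" and nondegenerate_UNIV: "nondegenerate_on B UNIV"
  using form unfolding scalar_product_form_def by auto

lemma bounded_bilin: "bounded_bilinear B"
  using bilin by (simp add: bilinear_conv_bounded_bilinear)

lemma linear_right: "linear (B x)" and linear_left: "linear (\<lambda>x. B x y)"
  using bilin unfolding bilinear_def by auto

sublocale bounded_bilinear B by (rule bounded_bilin)

lemma zero_on_span:
  assumes "\<And>u. u \<in> S \<Longrightarrow> B v u = 0" "u \<in> span S"
  shows "B v u = 0"
  using linear_eq_0_on_span[OF linear_right assms] .

text \<open>
  The map \<open>\<Phi>\<close> lists the values \<open>B w e\<close> on an orthonormal basis (of the auxiliary Euclidean structure) of
  \<open>W\<close>. It is injective by nondegeneracy, hence onto.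
\<close>

lemma represents_functional:
  assumes W: "subspace W" "nondegenerate_on B W" and f: "linear (f :: 'a \<Rightarrow> real)"
  obtains w where "w \<in> W" "\<And>u. u \<in> W \<Longrightarrow> B w u = f u"
proof -
  obtain E where E: "E \<subseteq> W" "pairwise orthogonal E" "\<And>x. x \<in> E \<Longrightarrow> norm x = 1"
    "independent E" "card E = dim W" "span E = W"
    using orthonormal_basis_subspace[OF W(1)] by metis
  have fin: "finite E" using independent_imp_finite[OF E(4)] .
  define \<Phi> where "\<Phi> w = (\<Sum>e\<in>E. B w e *\<^sub>R e)" for w
  have coord: "(\<Sum>e\<in>E. c e *\<^sub>R e) \<bullet> d = c d" if "d \<in> E" for c :: "'a \<Rightarrow> real" and d
  proof -
    have "(\<Sum>e\<in>E. c e *\<^sub>R e) \<bullet> d = (\<Sum>e\<in>E. if e = d then c e else 0)"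
      unfolding inner_sum_left
    proof (rule sum.cong[OF refl])
      fix e assume "e \<in> E"
      then show "c e *\<^sub>R e \<bullet> d = (if e = d then c e else 0)"
        using E(2) E(3)[OF that] that by (auto simp: pairwise_def orthogonal_def norm_eq_1)
    qed
    then show ?thesis using fin that by (simp add: sum.delta)
  qed
  have lin: "linear \<Phi>"
    unfolding \<Phi>_def by (intro linear_compose_sum ballI linear_compose_scale_right linear_left linear_scaleR_left
      linear_compose[OF linear_left linear_scaleR_left, unfolded o_def])
  have inW: "\<Phi> w \<in> W" for w unfolding \<Phi>_def using W(1) E(1) by (intro subspace_sum subspace_scale) auto
  have ker: "w = 0" if "w \<in> W" "\<Phi> w = 0" for w
  proof -
    have "B w e = 0" if "e \<in> E" for e using coord[OF that, of "B w"] \<open>\<Phi> w = 0\<close> unfolding \<Phi>_def by simp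
    then have "B w u = 0" if "u \<in> W" for u using zero_on_span[of E w u] that E(6) by auto
    then show ?thesis using W(2) \<open>w \<in> W\<close> unfolding nondegenerate_on_def by blast
  qed
  then have "inj_on \<Phi> W" using linear_injective_on_subspace_0[OF lin W(1)] by blast
  then have "dim (\<Phi> ` W) = dim W"
    by (intro dim_image_eq lin) (simp add: span_eq_iff[THEN iffD2, OF W(1)])
  then have onto: "\<Phi> ` W = W"
    by (intro subspace_dim_equal linear_subspace_image lin W(1)) (use inW in auto)
  have "(\<Sum>e\<in>E. f e *\<^sub>R e) \<in> W" using W(1) E(1) by (intro subspace_sum subspace_scale) auto
  then obtain w where w: "w \<in> W" "\<Phi> w = (\<Sum>e\<in>E. f e *\<^sub>R e)" using onto by (metis imageE)
  have "B w e = f e" if "e \<in> E" for e using coord[OF that, of "B w"] coord[OF that, of f] w(2) unfolding \<Phi>_def by simp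
  then have "B w u = f u" if "u \<in> W" for u
    using linear_eq_on_span[OF linear_right f, of E w u] that E(6) by auto
  with w(1) show thesis by (rule that)
qed

text \<open>
  The basis dual to \<^const>\<open>Basis\<close> with respect to \<open>B\<close>; it exchanges \<open>B\<close> with the Euclidean coordinates.
\<close>

lemma dual_basis:
  obtains e where "\<And>b x. b \<in> Basis \<Longrightarrow> B x (e b) = x \<bullet> b"
proof -
  have "\<exists>w. \<forall>x. B x w = x \<bullet> b" for b
  proof -
    have "linear (\<lambda>x. x \<bullet> b)" by (rule bounded_linear.linear[OF bounded_linear_inner_left])
    from represents_functional[OF subspace_UNIV nondegenerate_UNIV this] show ?thesis
      by (metis UNIV_I commute)
  qed
  then show thesis using that by metis
qed

context
  fixes W :: "'a set"
  assumes W: "subspace W" "nondegenerate_on B W"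
begin

lemma tan_part_exists1: "\<exists>!w. w \<in> W \<and> (\<forall>u\<in>W. B (v - w) u = 0)"
proof -
  obtain w where w: "w \<in> W" "\<And>u. u \<in> W \<Longrightarrow> B w u = B v u"
    by (rule represents_functional[OF W linear_right]) blast
  show ?thesis
  proof (rule ex1I[of _ w])
    show "w \<in> W \<and> (\<forall>u\<in>W. B (v - w) u = 0)" using w by (simp add: diff_left)
    fix w' assume w': "w' \<in> W \<and> (\<forall>u\<in>W. B (v - w') u = 0)"
    then have "w' - w \<in> W" "\<forall>u\<in>W. B (w' - w) u = 0"
      using w W(1) by (auto simp: diff_left subspace_diff)
    then have "w' - w = 0" using W(2) unfolding nondegenerate_on_def by blast
    then show "w' = w" by simp
  qed
qed

lemma tan_part_in: "tan_part B W v \<in> W"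
  and tan_part_orthogonal: "u \<in> W \<Longrightarrow> B (v - tan_part B W v) u = 0"
  using theI'[OF tan_part_exists1[of v]] unfolding tan_part_def by auto

lemma tan_part_eqI: "w \<in> W \<Longrightarrow> (\<And>u. u \<in> W \<Longrightarrow> B (v - w) u = 0) \<Longrightarrow> tan_part B W v = w"
  unfolding tan_part_def using tan_part_exists1[of v] by (intro the1_equality) auto

lemma tan_part_id: "w \<in> W \<Longrightarrow> tan_part B W w = w"
  by (rule tan_part_eqI) (auto simp: zero_left)

lemma tan_part_idem: "tan_part B W (tan_part B W v) = tan_part B W v"
  by (rule tan_part_id[OF tan_part_in])

lemma linear_tan_part: "linear (tan_part B W)"
proof (rule linearI)
  fix x y
  show "tan_part B W (x + y) = tan_part B W x + tan_part B W y"
  proof (rule tan_part_eqI)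
    show "tan_part B W x + tan_part B W y \<in> W" by (intro subspace_add W(1) tan_part_in)
    fix u assume "u \<in> W"
    then have "B (x - tan_part B W x) u + B (y - tan_part B W y) u = 0" by (simp add: tan_part_orthogonal)
    then show "B (x + y - (tan_part B W x + tan_part B W y)) u = 0" by (simp add: diff_left add_left)
  qed
next
  fix c x
  show "tan_part B W (c *\<^sub>R x) = c *\<^sub>R tan_part B W x"
  proof (rule tan_part_eqI)
    show "c *\<^sub>R tan_part B W x \<in> W" by (intro subspace_scale W(1) tan_part_in)
    fix u assume "u \<in> W"
    then have "c * B (x - tan_part B W x) u = 0" by (simp add: tan_part_orthogonal)
    then show "B (c *\<^sub>R x - c *\<^sub>R tan_part B W x) u = 0" by (simp add: diff_left scaleR_left right_diff_distrib)
  qed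
qed

lemma tan_part_selfadjoint: "B (tan_part B W x) y = B x (tan_part B W y)"
proof -
  have "B (x - tan_part B W x) (tan_part B W y) = 0" "B (y - tan_part B W y) (tan_part B W x) = 0"
    by (auto intro: tan_part_orthogonal tan_part_in)
  then show ?thesis by (simp add: diff_left) (metis commute)
qed

end

section \<open>Projections onto a varying subspace\<close>

text \<open>
  The subspaces \<open>W t\<close>, which will be the tangent spaces along a curve \<open>\<alpha>\<close>, vary with \<open>t\<close> in such a way that
  the gap between \<open>W s\<close> and \<open>W t\<close> is at most \<open>C * norm (\<alpha> t - \<alpha> s)\<close>. As \<open>B\<close> is indefinite, the orthogonal
  projections need not have norm one, and a bound for them has to use compactness and nondegeneracy.
\<close>

context
  fixes W :: "real \<Rightarrow> 'a set" and \<alpha> :: "real \<Rightarrow> 'a" and T C :: real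
  assumes W: "\<And>t. t \<in> {0..T} \<Longrightarrow> subspace (W t)" "\<And>t. t \<in> {0..T} \<Longrightarrow> nondegenerate_on B (W t)"
    and \<alpha>: "continuous_on {0..T} \<alpha>" and C: "0 \<le> C"
    and gap: "\<And>s t w. s \<in> {0..T} \<Longrightarrow> t \<in> {0..T} \<Longrightarrow> w \<in> W s \<Longrightarrow>
      \<exists>w'\<in>W t. norm (w' - w) \<le> C * norm (\<alpha> t - \<alpha> s) * norm w"
begin

text \<open>
  Otherwise there are unit vectors \<open>w n \<in> W (\<tau> n)\<close> that are projections of vectors tending to zero, so
  \<open>B (w n)\<close> becomes small on \<open>W (\<tau> n)\<close>. By the gap condition a limit of them is a unit vector of some
  \<open>W t\<close> that is orthogonal to \<open>W t\<close>.
\<close>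

lemma tan_part_uniformly_bounded:
  obtains N where "0 \<le> N" "\<And>t v. t \<in> {0..T} \<Longrightarrow> norm (tan_part B (W t) v) \<le> N * norm v"
proof -
  have "\<exists>N\<ge>0. \<forall>t\<in>{0..T}. \<forall>v. norm (tan_part B (W t) v) \<le> N * norm v"
  proof (rule ccontr)
    assume "\<not> ?thesis"
    then have "\<exists>t v. t \<in> {0..T} \<and> real n * norm v < norm (tan_part B (W t) v)" for n :: nat
      by (meson not_less of_nat_0_le_iff)
    then obtain \<tau> v where \<tau>: "\<And>n. \<tau> n \<in> {0..T}" and v: "\<And>n. real n * norm (v n) < norm (tan_part B (W (\<tau> n)) (v n))"
      by metis
    define l where "l n = norm (tan_part B (W (\<tau> n)) (v n))" for n
    define w where "w n = tan_part B (W (\<tau> n)) (v n) /\<^sub>R l n" for n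
    have l: "0 < l n" for n unfolding l_def using v[of n] by (meson le_less_trans mult_nonneg_nonneg norm_ge_zero of_nat_0_le_iff)
    have nw: "norm (w n) = 1" for n using l[of n] unfolding w_def by (simp add: l_def)
    have wW: "w n \<in> W (\<tau> n)" for n
      unfolding w_def by (intro subspace_scale W tan_part_in \<tau>)
    have cp: "compact ({0..T} \<times> sphere (0::'a) 1)" by (intro compact_Times compact_Icc compact_sphere)
    have "\<forall>n. (\<tau> n, w n) \<in> {0..T} \<times> sphere 0 1" using \<tau> nw by simp
    then obtain z r where z: "z \<in> {0..T} \<times> sphere 0 1" "strict_mono (r :: nat \<Rightarrow> nat)"
      "((\<lambda>n. (\<tau> n, w n)) \<circ> r) \<longlonglongrightarrow> z"
      by (rule seq_compactE[OF compact_imp_seq_compact[OF cp]]) blast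
    obtain t w0 where tw: "z = (t, w0)" by (cases z)
    have t: "t \<in> {0..T}" and nw0: "norm w0 = 1" using z(1) tw by auto
    have tl: "(\<lambda>n. \<tau> (r n)) \<longlonglongrightarrow> t" and wl: "(\<lambda>n. w (r n)) \<longlonglongrightarrow> w0"
      using tendsto_fst[OF z(3)] tendsto_snd[OF z(3)] by (auto simp: tw o_def)
    have al: "(\<lambda>n. \<alpha> (\<tau> (r n))) \<longlonglongrightarrow> \<alpha> t"
      by (rule continuous_on_tendsto_compose[OF \<alpha> tl t]) (rule always_eventually, use \<tau> in blast)
    have dl: "(\<lambda>n. C * norm (\<alpha> t - \<alpha> (\<tau> (r n))) * c) \<longlonglongrightarrow> 0" for c
    proof -
      have "(\<lambda>n. C * norm (\<alpha> t - \<alpha> (\<tau> (r n))) * c) \<longlonglongrightarrow> C * norm (\<alpha> t - \<alpha> t) * c"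
        by (intro tendsto_mult tendsto_norm tendsto_diff tendsto_const al)
      then show ?thesis by simp
    qed
    have "\<exists>y\<in>W t. norm (y - w (r n)) \<le> C * norm (\<alpha> t - \<alpha> (\<tau> (r n))) * norm (w (r n))" for n
      by (rule gap[OF \<tau> t wW])
    then obtain y where y: "\<And>n. y n \<in> W t" "\<And>n. norm (y n - w (r n)) \<le> C * norm (\<alpha> t - \<alpha> (\<tau> (r n))) * 1"
      unfolding nw by metis
    have "(\<lambda>n. y n - w (r n)) \<longlonglongrightarrow> 0" by (rule Lim_null_comparison[OF _ dl[of 1]]) (use y(2) in auto)
    from tendsto_add[OF this wl] have "y \<longlonglongrightarrow> w0" by simp
    then have w0W: "w0 \<in> W t"
      using closed_sequentially[OF closed_subspace[OF W(1)[OF t]]] y(1) by blast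
    obtain K where K: "0 \<le> K" "\<And>x y. norm (B x y) \<le> norm x * norm y * K" using nonneg_bounded by blast
    have "B w0 u = 0" if u: "u \<in> W t" for u
    proof -
      have "\<exists>y\<in>W (\<tau> (r n)). norm (y - u) \<le> C * norm (\<alpha> (\<tau> (r n)) - \<alpha> t) * norm u" for n
        by (rule gap[OF t \<tau> u])
      then obtain x where x: "\<And>n. x n \<in> W (\<tau> (r n))" "\<And>n. norm (x n - u) \<le> C * norm (\<alpha> t - \<alpha> (\<tau> (r n))) * norm u"
        by (metis norm_minus_commute)
      have "(\<lambda>n. x n - u) \<longlonglongrightarrow> 0" by (rule Lim_null_comparison[OF _ dl[of "norm u"]]) (use x(2) in auto)
      from tendsto_add[OF this tendsto_const[of u]] have xl: "x \<longlonglongrightarrow> u" by simp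
      have Bl: "(\<lambda>n. B (w (r n)) (x n)) \<longlonglongrightarrow> B w0 u" by (rule tendsto[OF wl xl])
      have small: "norm (B (w (r n)) (x n)) \<le> inverse (real (r n)) * (norm (x n) * K)" if rn: "0 < r n" for n
      proof -
        have o: "B (tan_part B (W (\<tau> (r n))) (v (r n))) (x n) = B (v (r n)) (x n)"
          using tan_part_orthogonal[OF W(1)[OF \<tau>] W(2)[OF \<tau>] x(1)[of n], of "v (r n)"] by (simp add: diff_left)
        have "real (r n) * norm (v (r n)) \<le> l (r n)" using v[of "r n"] unfolding l_def by simp
        then have "inverse (l (r n)) * norm (v (r n)) \<le> inverse (real (r n))"
          using l[of "r n"] rn by (simp add: field_simps)
        then have "inverse (l (r n)) * norm (v (r n)) * (norm (x n) * K) \<le> inverse (real (r n)) * (norm (x n) * K)"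
          using K(1) by (intro mult_right_mono) auto
        moreover have "norm (B (w (r n)) (x n)) = inverse (l (r n)) * norm (B (v (r n)) (x n))"
          unfolding w_def scaleR_left o using l[of "r n"] by (simp add: abs_mult)
        moreover have "inverse (l (r n)) * norm (B (v (r n)) (x n)) \<le> inverse (l (r n)) * (norm (v (r n)) * norm (x n) * K)"
          using l[of "r n"] by (intro mult_left_mono K) auto
        ultimately show ?thesis by (simp add: mult_ac)
      qed
      have "(\<lambda>n. inverse (real (r n)) * (norm (x n) * K)) \<longlonglongrightarrow> 0 * (norm u * K)"
      proof (intro tendsto_mult tendsto_norm xl tendsto_const)
        have "(\<lambda>n. inverse (real n)) \<longlonglongrightarrow> 0" by (rule lim_inverse_n)
        from LIMSEQ_subseq_LIMSEQ[OF this z(2)] show "(\<lambda>n. inverse (real (r n))) \<longlonglongrightarrow> 0" by (simp add: o_def)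
      qed
      then have "(\<lambda>n. inverse (real (r n)) * (norm (x n) * K)) \<longlonglongrightarrow> 0" by simp
      moreover have "\<forall>\<^sub>F n in sequentially. norm (B (w (r n)) (x n)) \<le> inverse (real (r n)) * (norm (x n) * K)"
      proof (rule eventually_sequentiallyI[of 1])
        fix n :: nat assume "1 \<le> n"
        then have "0 < r n" using seq_suble[OF z(2), of n] by linarith
        then show "norm (B (w (r n)) (x n)) \<le> inverse (real (r n)) * (norm (x n) * K)" by (rule small)
      qed
      ultimately have "(\<lambda>n. B (w (r n)) (x n)) \<longlonglongrightarrow> 0" by (rule Lim_null_comparison[rotated])
      with Bl show ?thesis by (rule LIMSEQ_unique)
    qed
    then have "w0 = 0" using W(2)[OF t] w0W unfolding nondegenerate_on_def by blast
    with nw0 show False by simp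
  qed
  then show thesis using that by blast
qed

text \<open>
  For projections \<open>P\<close> and \<open>Q\<close> one has \<open>P - Q = P (1 - Q) - (1 - P) Q\<close>. The gap condition bounds \<open>(1 - P) Q\<close>,
  and \<open>P (1 - Q)\<close> is the adjoint with respect to \<open>B\<close> of an operator \<open>(1 - Q) P\<close> of the same kind.
\<close>

lemma tan_part_lipschitz:
  obtains L where "\<And>s t v. s \<in> {0..T} \<Longrightarrow> t \<in> {0..T} \<Longrightarrow>
    norm (tan_part B (W t) v - tan_part B (W s) v) \<le> L * norm (\<alpha> t - \<alpha> s) * norm v"
proof -
  obtain N where N: "0 \<le> N" "\<And>t v. t \<in> {0..T} \<Longrightarrow> norm (tan_part B (W t) v) \<le> N * norm v"
    by (rule tan_part_uniformly_bounded) blast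
  define \<kappa> where "\<kappa> = (1 + N) * C * N"
  define P where "P t = tan_part B (W t)" for t
  note facts = tan_part_in tan_part_orthogonal tan_part_id linear_tan_part tan_part_selfadjoint
  have P: "P t v \<in> W t" "linear (P t)" "B (P t v) v' = B v (P t v')" "norm (P t v) \<le> N * norm v"
    "u \<in> W t \<Longrightarrow> P t u = u" if "t \<in> {0..T}" for t v v' u
    unfolding P_def using facts[OF W(1)[OF that] W(2)[OF that]] N(2)[OF that] by auto
  have one: "norm (P s x - P t (P s x)) \<le> \<kappa> * norm (\<alpha> t - \<alpha> s) * norm x" if s: "s \<in> {0..T}" and t: "t \<in> {0..T}" for s t x
  proof -
    obtain w where w: "w \<in> W t" "norm (w - P s x) \<le> C * norm (\<alpha> t - \<alpha> s) * norm (P s x)"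
      using gap[OF s t P(1)[OF s]] by blast
    have "P s x - P t (P s x) = (P s x - w) - P t (P s x - w)"
      using P(5)[OF t w(1)] linear_diff[OF P(2)[OF t]] by simp
    then have "norm (P s x - P t (P s x)) \<le> norm (P s x - w) + norm (P t (P s x - w))"
      using norm_triangle_ineq4 by metis
    also have "\<dots> \<le> (1 + N) * norm (P s x - w)" using P(4)[OF t, of "P s x - w"] by (simp add: distrib_right)
    also have "\<dots> \<le> (1 + N) * (C * norm (\<alpha> t - \<alpha> s) * (N * norm x))"
    proof (rule mult_left_mono)
      have "norm (P s x - w) \<le> C * norm (\<alpha> t - \<alpha> s) * norm (P s x)" using w(2) by (simp add: norm_minus_commute)
      also have "\<dots> \<le> C * norm (\<alpha> t - \<alpha> s) * (N * norm x)" using C by (intro mult_left_mono P(4)[OF s]) auto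
      finally show "norm (P s x - w) \<le> C * norm (\<alpha> t - \<alpha> s) * (N * norm x)" .
    qed (use N(1) in simp)
    finally show ?thesis unfolding \<kappa>_def by (simp add: mult_ac)
  qed
  obtain e where e: "\<And>b x. b \<in> Basis \<Longrightarrow> B x (e b) = x \<bullet> b" by (rule dual_basis) blast
  obtain K where K: "0 \<le> K" "\<And>x y. norm (B x y) \<le> norm x * norm y * K" using nonneg_bounded by blast
  define L where "L = (\<Sum>b\<in>Basis. K * \<kappa> * norm (e b))"
  have two: "norm (P t (x - P s x)) \<le> L * norm (\<alpha> t - \<alpha> s) * norm x" if s: "s \<in> {0..T}" and t: "t \<in> {0..T}" for s t x
  proof -
    have "norm (P t (x - P s x)) \<le> (\<Sum>b\<in>Basis. \<bar>P t (x - P s x) \<bullet> b\<bar>)" by (rule norm_le_l1)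
    also have "\<dots> \<le> (\<Sum>b\<in>Basis. K * \<kappa> * norm (e b) * (norm (\<alpha> t - \<alpha> s) * norm x))"
    proof (rule sum_mono)
      fix b :: 'a assume b: "b \<in> Basis"
      have "P t (x - P s x) \<bullet> b = B (x - P s x) (P t (e b))" using e[OF b] P(3)[OF t] by metis
      also have "\<dots> = B x (P t (e b) - P s (P t (e b)))"
        using P(3)[OF s] by (simp add: diff_left diff_right)
      finally have "\<bar>P t (x - P s x) \<bullet> b\<bar> \<le> norm x * norm (P t (e b) - P s (P t (e b))) * K"
        using K(2) by (metis real_norm_def)
      also have "\<dots> \<le> norm x * (\<kappa> * norm (\<alpha> t - \<alpha> s) * norm (e b)) * K"
        using one[OF t s, of "e b"] K(1) by (intro mult_right_mono mult_left_mono) (auto simp: norm_minus_commute)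
      finally show "\<bar>P t (x - P s x) \<bullet> b\<bar> \<le> K * \<kappa> * norm (e b) * (norm (\<alpha> t - \<alpha> s) * norm x)"
        by (simp add: mult_ac)
    qed
    also have "\<dots> = L * norm (\<alpha> t - \<alpha> s) * norm x" unfolding L_def by (simp only: sum_distrib_right mult.assoc)
    finally show ?thesis .
  qed
  show thesis
  proof (rule that[of "L + \<kappa>"])
    fix s t v assume s: "s \<in> {0..T}" and t: "t \<in> {0..T}"
    have "P t v - P s v = P t (v - P s v) - (P s v - P t (P s v))"
      by (simp add: linear_diff[OF P(2)[OF t]])
    then have "norm (P t v - P s v) \<le> norm (P t (v - P s v)) + norm (P s v - P t (P s v))"
      using norm_triangle_ineq4 by metis
    also have "\<dots> \<le> L * norm (\<alpha> t - \<alpha> s) * norm v + \<kappa> * norm (\<alpha> t - \<alpha> s) * norm v"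
      by (intro add_mono one two s t)
    finally show "norm (tan_part B (W t) v - tan_part B (W s) v) \<le> (L + \<kappa>) * norm (\<alpha> t - \<alpha> s) * norm v"
      unfolding P_def by (simp add: distrib_right)
  qed
qed

end

end

section \<open>Parallel transport along a curve of projections\<close>

lemma has_vector_derivative_linear_coefficient:
  fixes P :: "real \<Rightarrow> 'a::euclidean_space \<Rightarrow> 'b::real_normed_vector"
  assumes lin: "\<And>r. linear (P r)" and P': "linear P'"
    and P: "\<And>b. b \<in> Basis \<Longrightarrow> ((\<lambda>r. P r b) has_vector_derivative P' b) (at t)"
    and Y: "(Y has_vector_derivative y') (at t)"
  shows "((\<lambda>r. P r (Y r)) has_vector_derivative (P t y' + P' (Y t))) (at t)"
proof -
  have "((\<lambda>r. (Y r \<bullet> b) *\<^sub>R P r b) has_vector_derivative ((Y t \<bullet> b) *\<^sub>R P' b + (y' \<bullet> b) *\<^sub>R P t b)) (at t)"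
    if "b \<in> Basis" for b
    by (rule bounded_bilinear.has_vector_derivative[OF bounded_bilinear_scaleR _ P[OF that]])
      (rule bounded_linear.has_vector_derivative[OF bounded_linear_inner_left Y])
  then have "((\<lambda>r. \<Sum>b\<in>Basis. (Y r \<bullet> b) *\<^sub>R P r b) has_vector_derivative
      (\<Sum>b\<in>Basis. (Y t \<bullet> b) *\<^sub>R P' b + (y' \<bullet> b) *\<^sub>R P t b)) (at t)"
    by (rule has_vector_derivative_sum)
  then show ?thesis
    by (simp add: linear_sum_Basis[OF lin, symmetric] linear_sum_Basis[OF P', symmetric] sum.distrib add.commute)
qed

context scalar_product
begin

text \<open>
  Kato's construction. The equation \<open>X' = (P' P - P P') X\<close> has a coefficient that is skew with respect to \<open>B\<close>,
  so its flow consists of isometries, and the flow carries the range of \<open>P 0\<close> to the range of \<open>P t\<close>, because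
  \<open>P X\<close> solves the same equation. On the range of \<open>P\<close> the derivative \<open>P' P X - P P' X\<close> is annihilated by \<open>P\<close>,
  as \<open>P P' P = 0\<close>; this says that the transported vectors are parallel.
\<close>

proposition transport_of_projections:
  fixes P :: "real \<Rightarrow> 'a \<Rightarrow> 'a"
  assumes T: "0 < T" and lin: "\<And>t. linear (P t)" and idem: "\<And>t x. P t (P t x) = P t x"
    and selfadj: "\<And>t x y. B (P t x) y = B x (P t y)"
    and ac: "\<And>x. abs_cont_on {0..T} (\<lambda>t. P t x)"
  obtains X where "\<And>x. abs_cont_on {0..T} (X x)" "\<And>x. X x 0 = x"
    "\<And>x t. t \<in> {0..T} \<Longrightarrow> P t (X x t) = X (P 0 x) t"
    "\<And>x y t. t \<in> {0..T} \<Longrightarrow> B (X x t) (X y t) = B x y"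
    "\<And>x. AE t\<in>{0..T} in lebesgue. P t (velocity T (X (P 0 x)) t) = 0"
proof -
  define P' where "P' t x = (\<Sum>b\<in>Basis. (x \<bullet> b) *\<^sub>R velocity T (\<lambda>r. P r b) t)" for t x
  have lin': "linear (P' t)" for t
    unfolding P'_def by (intro linear_compose_sum ballI linear_compose[OF _ linear_scaleR_left, unfolded o_def]
      bounded_linear.linear[OF bounded_linear_inner_left])
  have P'b: "P' t b = velocity T (\<lambda>r. P r b) t" if "b \<in> Basis" for t b
    unfolding P'_def using that by (simp add: inner_Basis if_distrib[of "\<lambda>c. c *\<^sub>R _"] sum.delta cong: if_cong)
  have int': "(\<lambda>t. P' t b) absolutely_integrable_on {0..T}" if "b \<in> Basis" for b
    unfolding P'b[OF that] by (rule abs_cont_on_fundamental_theorem(2)[OF ac T])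
  have "AE t\<in>{0..T} in lebesgue. \<forall>b\<in>Basis. ((\<lambda>r. P r b) has_vector_derivative P' t b) (at t)"
  proof -
    have "AE t in lebesgue. \<forall>b\<in>Basis. t \<in> {0..T} \<longrightarrow> ((\<lambda>r. P r b) has_vector_derivative P' t b) (at t)"
    proof (rule AE_finite_allI[OF finite_Basis])
      fix b :: 'a assume b: "b \<in> Basis"
      show "AE t\<in>{0..T} in lebesgue. ((\<lambda>r. P r b) has_vector_derivative P' t b) (at t)"
        unfolding P'b[OF b] by (rule abs_cont_on_fundamental_theorem(1)[OF ac T])
    qed
    then show ?thesis by eventually_elim blast
  qed
  then have der: "AE t\<in>{0..T} in lebesgue. \<forall>Y y'. (Y has_vector_derivative y') (at t) \<longrightarrow>
      ((\<lambda>r. P r (Y r)) has_vector_derivative (P t y' + P' t (Y t))) (at t)"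
  proof eventually_elim
    case (elim t)
    show ?case
    proof (intro impI allI)
      fix Y :: "real \<Rightarrow> 'a" and y' assume "t \<in> {0..T}" and Y: "(Y has_vector_derivative y') (at t)"
      then have P: "\<And>b. b \<in> Basis \<Longrightarrow> ((\<lambda>r. P r b) has_vector_derivative P' t b) (at t)" using elim by blast
      show "((\<lambda>r. P r (Y r)) has_vector_derivative (P t y' + P' t (Y t))) (at t)"
        by (rule has_vector_derivative_linear_coefficient[OF lin lin' _ Y]) (rule P)
    qed
  qed
  \<comment> \<open>The two identities come from differentiating idempotence and self-adjointness; both hold almost everywhere.\<close>
  define good where "good t \<longleftrightarrow> (\<forall>x. P t (P' t x) + P' t (P t x) = P' t x) \<and> (\<forall>x y. B (P' t x) y = B x (P' t y))" for t
  have good: "AE t\<in>{0..T} in lebesgue. good t"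
    using der
  proof eventually_elim
    case (elim t)
    show ?case
    proof
      assume "t \<in> {0..T}"
      with elim have d: "((\<lambda>r. P r (Y r)) has_vector_derivative (P t y' + P' t (Y t))) (at t)"
        if "(Y has_vector_derivative y') (at t)" for Y y' using that by blast
      have d0: "((\<lambda>r. P r x) has_vector_derivative P' t x) (at t)" for x
        using d[OF has_vector_derivative_const[of x]] by (simp add: linear_0[OF lin])
      have 1: "P t (P' t x) + P' t (P t x) = P' t x" for x
        using vector_derivative_unique_at[OF d[OF d0[of x]]] d0[of x] by (simp add: idem)
      have 2: "B (P' t x) y = B x (P' t y)" for x y
      proof -
        have "((\<lambda>r. B (P r x) y) has_vector_derivative B (P' t x) y) (at t)"
          by (rule bounded_linear.has_vector_derivative[OF bounded_linear_left d0])
        moreover have "((\<lambda>r. B x (P r y)) has_vector_derivative B x (P' t y)) (at t)"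
          by (rule bounded_linear.has_vector_derivative[OF bounded_linear_right d0])
        ultimately show ?thesis using vector_derivative_unique_at by (simp add: selfadj)
      qed
      show "good t" unfolding good_def using 1 2 by blast
    qed
  qed
  have PP'P: "P t (P' t (P t x)) = 0" if "good t" for t x
  proof -
    have "P t (P' t (P t x)) + P' t (P t x) = P' t (P t x)" using that unfolding good_def by (metis idem)
    then show ?thesis by simp
  qed
  \<comment> \<open>Almost everywhere this equals P' P - P P', since P P' = P' - P' P. In the present form integrability is immediate.\<close>
  define G where "G t x = 2 *\<^sub>R P' t (P t x) - P' t x" for t x
  have linG: "linear (G t)" for t
    unfolding G_def by (intro linear_compose_sub linear_compose_scale_right lin'
        linear_compose[OF lin lin', unfolded o_def])
  have intG: "(\<lambda>t. G t b) absolutely_integrable_on {0..T}" if "b \<in> Basis" for b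
  proof -
    have "(\<lambda>t. P' t (P t b)) absolutely_integrable_on {0..T}"
      by (rule linear_coefficient_integrable[OF lin']) (rule int', assumption, rule abs_cont_on_imp_continuous_on[OF ac])
    then show ?thesis unfolding G_def
      by (intro set_integral_diff(1) int' that absolutely_integrable_scaleR_left)
  qed
  have PG: "P t (G t x) = - P t (P' t x)" if "good t" for t x
    unfolding G_def using PP'P[OF that] by (simp add: linear_diff[OF lin] linear_cmul[OF lin])
  have GP: "P' t x + P t (G t x) = G t (P t x)" if "good t" for t x
  proof -
    have "P' t x - P t (P' t x) = P' t (P t x)" using that unfolding good_def by (metis add_diff_cancel_left')
    then show ?thesis unfolding PG[OF that] by (simp add: G_def idem scaleR_2)
  qed
  have skew: "B (G t x) y = - B x (G t y)" if "good t" for t x y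
  proof -
    have a: "B (P' t u) v = B u (P' t v)" for u v using that unfolding good_def by blast
    have p: "P t (P' t y) = P' t y - P' t (P t y)" using that unfolding good_def by (metis add_diff_cancel_right')
    have "B (G t x) y = 2 * B x (P t (P' t y)) - B x (P' t y)"
      unfolding G_def by (simp add: diff_left scaleR_left a selfadj)
    also have "\<dots> = - B x (G t y)" unfolding p G_def by (simp add: diff_right scaleR_right)
    finally show ?thesis .
  qed
  have "\<exists>X. abs_cont_on {0..T} X \<and> X 0 = x \<and> (AE t\<in>{0..T} in lebesgue. (X has_vector_derivative G t (X t)) (at t))" for x
  proof -
    obtain X where "abs_cont_on {0..T} X" "X 0 = x"
      "AE t\<in>{0..T} in lebesgue. (X has_vector_derivative G t (X t)) (at t)"
      by (rule linear_ode_exists[where z=x, OF T linG]) (rule intG, assumption, blast)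
    then show ?thesis by blast
  qed
  then obtain X where X: "\<And>x. abs_cont_on {0..T} (X x)" "\<And>x. X x 0 = x"
    and ode: "\<And>x. AE t\<in>{0..T} in lebesgue. (X x has_vector_derivative G t (X x t)) (at t)" by metis
  have PX: "P t (X x t) = X (P 0 x) t" if t: "t \<in> {0..T}" for x t
  proof -
    have "abs_cont_on {0..T} (\<lambda>t. \<Sum>b\<in>Basis. (X x t \<bullet> b) *\<^sub>R P t b)"
      by (intro abs_cont_on_sum abs_cont_on_bilinear[OF bounded_bilinear_scaleR] ac
          abs_cont_on_linear[OF bounded_linear_inner_left X(1)])
    then have acPX: "abs_cont_on {0..T} (\<lambda>t. P t (X x t))" by (simp only: linear_sum_Basis[OF lin, symmetric])
    have "P t (X x t) - X (P 0 x) t = 0"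
    proof (rule linear_ode_unique[OF T linG _ _ _ _ t])
      show "(\<lambda>t. G t b) absolutely_integrable_on {0..T}" if "b \<in> Basis" for b by (rule intG[OF that])
      show "abs_cont_on {0..T} (\<lambda>t. P t (X x t) - X (P 0 x) t)" by (rule abs_cont_on_diff[OF acPX X(1)])
      show "P 0 (X x 0) - X (P 0 x) 0 = 0" by (simp add: X(2))
      show "AE t\<in>{0..T} in lebesgue. ((\<lambda>t. P t (X x t) - X (P 0 x) t) has_vector_derivative
          G t (P t (X x t) - X (P 0 x) t)) (at t)"
        using der ode[of x] ode[of "P 0 x"] good
      proof eventually_elim
        case (elim t)
        show ?case
        proof
          assume t: "t \<in> {0..T}"
          with elim have "((\<lambda>t. P t (X x t)) has_vector_derivative (P t (G t (X x t)) + P' t (X x t))) (at t)" by blast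
          moreover have "(X (P 0 x) has_vector_derivative G t (X (P 0 x) t)) (at t)" using elim t by blast
          ultimately have "((\<lambda>t. P t (X x t) - X (P 0 x) t) has_vector_derivative
              (P t (G t (X x t)) + P' t (X x t) - G t (X (P 0 x) t))) (at t)"
            by (rule has_vector_derivative_diff)
          moreover have "good t" using elim t by blast
          ultimately show "((\<lambda>t. P t (X x t) - X (P 0 x) t) has_vector_derivative
              G t (P t (X x t) - X (P 0 x) t)) (at t)"
            using GP[of t "X x t"] by (simp add: linear_diff[OF linG] add.commute)
        qed
      qed
    qed
    then show ?thesis by simp
  qed
  show thesis
  proof (rule that[of X, OF X PX])
    fix x y t assume t: "t \<in> {0..T}"
    have acB: "abs_cont_on {0..T} (\<lambda>t. B (X x t) (X y t))"
      by (rule abs_cont_on_bilinear[OF bounded_bilin X(1) X(1)])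
    have "AE t\<in>{0..T} in lebesgue. ((\<lambda>t. B (X x t) (X y t)) has_vector_derivative 0) (at t)"
      using ode[of x] ode[of y] good
    proof eventually_elim
      case (elim t)
      show ?case
      proof
        assume t: "t \<in> {0..T}"
        then have "((\<lambda>t. B (X x t) (X y t)) has_vector_derivative
            (B (X x t) (G t (X y t)) + B (G t (X x t)) (X y t))) (at t)"
          using elim by (intro has_vector_derivative) auto
        moreover have "good t" using elim t by blast
        ultimately show "((\<lambda>t. B (X x t) (X y t)) has_vector_derivative 0) (at t)"
          using skew[of t "X x t" "X y t"] by simp
      qed
    qed
    from abs_cont_on_derivative_integral(2)[OF acB T this t] show "B (X x t) (X y t) = B x y"
      by (simp add: X(2))
  next
    fix x
    show "AE t\<in>{0..T} in lebesgue. P t (velocity T (X (P 0 x)) t) = 0"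
      using ode[of "P 0 x"] good
    proof eventually_elim
      case (elim t)
      show ?case
      proof
        assume t: "t \<in> {0..T}"
        let ?Z = "X (P 0 x) t"
        have "velocity T (X (P 0 x)) t = G t ?Z" using elim t velocity_eqI[OF _ t T] by blast
        moreover have "P t ?Z = ?Z" using PX[OF t, of x] idem by metis
        moreover have g: "good t" using elim t by blast
        ultimately show "P t (velocity T (X (P 0 x)) t) = 0"
          using PG[OF g, of ?Z] PP'P[OF g, of ?Z] by simp
      qed
    qed
  qed
qed

text \<open>
  The values of \<open>X\<close> on a basis and on the basis dual to it are again dual to each other, so the former
  are independent and hence span.
\<close>

lemma isometric_family_expansion:
  assumes X: "\<And>x y. B (X x) (X y) = B x y" and e: "\<And>b x. b \<in> Basis \<Longrightarrow> B x (e b) = x \<bullet> b"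
  shows "v = (\<Sum>b\<in>Basis. B v (X (e b)) *\<^sub>R X b)"
proof -
  define L where "L c = (\<Sum>b\<in>Basis. (c \<bullet> b) *\<^sub>R X b)" for c
  have lin: "linear L"
    unfolding L_def by (intro linear_compose_sum ballI linear_compose[OF _ linear_scaleR_left, unfolded o_def]
      bounded_linear.linear[OF bounded_linear_inner_left])
  have coord: "B (L c) (X (e b)) = c \<bullet> b" if "b \<in> Basis" for b c
  proof -
    have "B (L c) (X (e b)) = (\<Sum>a\<in>Basis. (c \<bullet> a) * B (X a) (X (e b)))"
      unfolding L_def by (simp add: sum_left scaleR_left)
    also have "\<dots> = (\<Sum>a\<in>Basis. if a = b then c \<bullet> a else 0)"
      by (rule sum.cong[OF refl]) (use that in \<open>simp add: X e inner_Basis\<close>)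
    also have "\<dots> = c \<bullet> b" using that by (simp add: sum.delta)
    finally show ?thesis .
  qed
  have "inj L"
  proof (rule injI)
    fix c d assume cd: "L c = L d"
    have "c \<bullet> b = d \<bullet> b" if "b \<in> Basis" for b
      using coord[OF that, of c] coord[OF that, of d] cd by simp
    then show "c = d" by (rule euclidean_eqI)
  qed
  then have "surj L" by (rule linear_injective_imp_surjective[OF lin _ refl])
  then obtain c where c: "v = L c" by (metis surjD)
  have "(\<Sum>b\<in>Basis. B v (X (e b)) *\<^sub>R X b) = (\<Sum>b\<in>Basis. (c \<bullet> b) *\<^sub>R X b)"
    by (rule sum.cong[OF refl]) (simp add: c coord)
  also have "\<dots> = v" unfolding c L_def ..
  finally show ?thesis by simp
qed

text \<open>
  The fields \<open>X b\<close> are transported projections of the standard basis vectors, so they span the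
  \<open>W t\<close> redundantly. For an absolutely continuous field \<open>v\<close> the coefficients \<open>B v (Y b t)\<close> are absolutely
  continuous, as for a basis of parallel fields.
\<close>

proposition parallel_frame:
  fixes W :: "real \<Rightarrow> 'a set" and \<alpha> :: "real \<Rightarrow> 'a"
  assumes T: "0 < T" and W: "\<And>t. t \<in> {0..T} \<Longrightarrow> subspace (W t)" "\<And>t. t \<in> {0..T} \<Longrightarrow> nondegenerate_on B (W t)"
    and \<alpha>: "abs_cont_on {0..T} \<alpha>" and C: "0 \<le> C"
    and gap: "\<And>s t w. s \<in> {0..T} \<Longrightarrow> t \<in> {0..T} \<Longrightarrow> w \<in> W s \<Longrightarrow>
      \<exists>w'\<in>W t. norm (w' - w) \<le> C * norm (\<alpha> t - \<alpha> s) * norm w"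
  obtains X Y :: "'a \<Rightarrow> real \<Rightarrow> 'a" where
    "\<And>b. abs_cont_on {0..T} (X b)" "\<And>b. abs_cont_on {0..T} (Y b)"
    "\<And>b t. t \<in> {0..T} \<Longrightarrow> X b t \<in> W t"
    "\<And>b. AE t\<in>{0..T} in lebesgue. tan_part B (W t) (velocity T (X b) t) = 0"
    "\<And>v t. t \<in> {0..T} \<Longrightarrow> v \<in> W t \<Longrightarrow> v = (\<Sum>b\<in>Basis. B v (Y b t) *\<^sub>R X b t)"
proof -
  \<comment> \<open>Outside {0..T} the subspaces are unspecified; the retraction provides projections for all real parameters.\<close>
  define cl where "cl = (\<lambda>x. max 0 (min T x))"
  have cl: "cl x \<in> {0..T}" "x \<in> {0..T} \<Longrightarrow> cl x = x" for x using T unfolding cl_def by auto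
  define P where "P t = tan_part B (W (cl t))" for t
  have P: "linear (P t)" "P t (P t x) = P t x" "B (P t x) y = B x (P t y)" for t x y
    unfolding P_def using linear_tan_part tan_part_idem tan_part_selfadjoint W[OF cl(1)] by blast+
  obtain L where L: "\<And>s t v. s \<in> {0..T} \<Longrightarrow> t \<in> {0..T} \<Longrightarrow>
      norm (tan_part B (W t) v - tan_part B (W s) v) \<le> L * norm (\<alpha> t - \<alpha> s) * norm v"
  proof (rule tan_part_lipschitz[of T W \<alpha> C])
    show "continuous_on {0..T} \<alpha>" by (rule abs_cont_on_imp_continuous_on[OF \<alpha>])
  qed (use W C gap in blast)+
  have ac: "abs_cont_on {0..T} (\<lambda>t. P t x)" for x
  proof (rule abs_cont_on_lipschitz[OF \<alpha>])
    fix s t assume "s \<in> {0..T}" "t \<in> {0..T}"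
    then show "norm (P t x - P s x) \<le> (L * norm x) * norm (\<alpha> t - \<alpha> s)"
      unfolding P_def using L[of s t x] cl(2) by (simp add: mult_ac)
  qed
  obtain X where X: "\<And>x. abs_cont_on {0..T} (X x)" "\<And>x. X x 0 = x"
    "\<And>x t. t \<in> {0..T} \<Longrightarrow> P t (X x t) = X (P 0 x) t"
    "\<And>x y t. t \<in> {0..T} \<Longrightarrow> B (X x t) (X y t) = B x y"
    "\<And>x. AE t\<in>{0..T} in lebesgue. P t (velocity T (X (P 0 x)) t) = 0"
    by (rule transport_of_projections[OF T P ac]) blast
  obtain e where e: "\<And>b x. b \<in> Basis \<Longrightarrow> B x (e b) = x \<bullet> b" by (rule dual_basis) blast
  have PW: "P t = tan_part B (W t)" if "t \<in> {0..T}" for t unfolding P_def using cl(2)[OF that] by simp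
  show thesis
  proof (rule that[of "\<lambda>b. X (P 0 b)" "\<lambda>b. X (e b)"])
    show "abs_cont_on {0..T} (X (P 0 b))" "abs_cont_on {0..T} (X (e b))" for b by (rule X(1))+
    show "X (P 0 b) t \<in> W t" if "t \<in> {0..T}" for b t
      using X(3)[OF that, of b] tan_part_in[OF W[OF that]] unfolding PW[OF that] by metis
    show "AE t\<in>{0..T} in lebesgue. tan_part B (W t) (velocity T (X (P 0 b)) t) = 0" for b
      using X(5)[of b] by eventually_elim (simp add: PW)
    fix v t assume t: "t \<in> {0..T}" and v: "v \<in> W t"
    have "v = P t v" using tan_part_id[OF W[OF t] v] PW[OF t] by simp
    also have "v = (\<Sum>b\<in>Basis. B v (X (e b) t) *\<^sub>R X b t)"
      by (rule isometric_family_expansion[of "\<lambda>x. X x t"]) (use X(4)[OF t] e in auto)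
    then have "P t v = P t (\<Sum>b\<in>Basis. B v (X (e b) t) *\<^sub>R X b t)" by simp
    also have "\<dots> = (\<Sum>b\<in>Basis. B v (X (e b) t) *\<^sub>R X (P 0 b) t)"
      using X(3)[OF t] by (simp add: linear_sum[OF P(1)] linear_cmul[OF P(1)])
    finally show "v = (\<Sum>b\<in>Basis. B v (X (e b) t) *\<^sub>R X (P 0 b) t)" .
  qed
qed

end

section \<open>Tangent spaces of submanifolds\<close>

lemma differentiable_on_has_frechet_derivative:
  assumes "f differentiable_on S" "open S" "x \<in> S"
  shows "(f has_derivative frechet_derivative f (at x)) (at x)"
  using assms by (metis differentiable_on_eq_differentiable_at frechet_derivative_works)

lemma Ck_on_cong:
  assumes "open J" "\<And>x. x \<in> J \<Longrightarrow> f x = g x" "Ck_on k f J"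
  shows "Ck_on k g J"
  using assms(2,3)
proof (induction k arbitrary: f g)
  case 0
  then show ?case by (simp cong: continuous_on_cong)
next
  case (Suc k)
  have df: "f differentiable (at x)" if "x \<in> J" for x
    using Suc.prems(2) that assms(1) by (simp add: differentiable_on_eq_differentiable_at)
  have eq: "frechet_derivative f (at x) = frechet_derivative g (at x)" if "x \<in> J" for x
    by (rule frechet_derivative_transform_within_open[OF df[OF that] assms(1) that]) (rule Suc.prems(1))
  have "g differentiable (at x)" if "x \<in> J" for x
    using has_derivative_transform_within_open[OF df[OF that, unfolded frechet_derivative_works] assms(1) that, of g]
      Suc.prems(1) by (auto intro: differentiableI)
  moreover have "Ck_on k (\<lambda>x. frechet_derivative g (at x) v) J" for v
    by (rule Suc.IH[of "\<lambda>x. frechet_derivative f (at x) v"]) (use eq Suc.prems(2) in auto)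
  ultimately show ?case using assms(1) by (simp add: differentiable_on_eq_differentiable_at)
qed

text \<open>
  The curves that realise tangent vectors are images of straight lines under the inverse of a chart.
\<close>

lemma Ck_on_compose_line:
  fixes f :: "'a::real_normed_vector \<Rightarrow> 'b::real_normed_vector"
  assumes "open U" "open J" "\<And>s::real. s \<in> J \<Longrightarrow> q + s *\<^sub>R x \<in> U" "Ck_on k f U"
  shows "Ck_on k (\<lambda>s. f (q + s *\<^sub>R x)) J"
  using assms(4)
proof (induction k arbitrary: f)
  case 0
  have "continuous_on J (\<lambda>s. q + s *\<^sub>R x)" by (intro continuous_intros)
  then show ?case using continuous_on_compose2[of U f J "\<lambda>s. q + s *\<^sub>R x"] 0 assms(3) by auto
next
  case (Suc k)
  have D: "((\<lambda>s. f (q + s *\<^sub>R x)) has_derivative (\<lambda>h. frechet_derivative f (at (q + s *\<^sub>R x)) (h *\<^sub>R x))) (at s)"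
    if "s \<in> J" for s
  proof -
    have 1: "((\<lambda>s. q + s *\<^sub>R x) has_derivative (\<lambda>h. h *\<^sub>R x)) (at s)"
      by (auto intro!: derivative_eq_intros)
    have "(f has_derivative frechet_derivative f (at (q + s *\<^sub>R x))) (at (q + s *\<^sub>R x))"
      using Suc.prems assms(1) assms(3)[OF that] by (intro differentiable_on_has_frechet_derivative[of f U]) auto
    from diff_chain_at[OF 1 this] show ?thesis by (simp add: o_def)
  qed
  have A: "Ck_on k (\<lambda>s. frechet_derivative f (at (q + s *\<^sub>R x)) (v *\<^sub>R x)) J" for v
    using Suc.IH[of "\<lambda>y. frechet_derivative f (at y) (v *\<^sub>R x)"] Suc.prems by simp
  have B: "frechet_derivative (\<lambda>s. f (q + s *\<^sub>R x)) (at s) v = frechet_derivative f (at (q + s *\<^sub>R x)) (v *\<^sub>R x)"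
    if "s \<in> J" for s v
    using frechet_derivative_at[OF D[OF that]] by metis
  have "Ck_on k (\<lambda>s. frechet_derivative (\<lambda>s. f (q + s *\<^sub>R x)) (at s) v) J" for v
    by (rule Ck_on_cong[OF assms(2) _ A[of v]]) (simp add: B)
  moreover have "(\<lambda>s. f (q + s *\<^sub>R x)) differentiable_on J"
    using D assms(2) by (auto simp: differentiable_on_eq_differentiable_at differentiable_def)
  ultimately show ?case by simp
qed

text \<open>
  Continuity of the derivative in finitely many directions bounds it near \<open>p\<close>, and the mean value
  inequality on a ball turns the bound into a Lipschitz estimate.
\<close>

lemma C1_on_locally_lipschitz:
  fixes f :: "'a::euclidean_space \<Rightarrow> 'b::real_normed_vector"
  assumes U: "open U" "p \<in> U" and f: "Ck_on (Suc k) f U"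
  obtains r C where "0 < r" "0 \<le> C" "ball p r \<subseteq> U"
    "\<And>x v. x \<in> ball p r \<Longrightarrow> norm (frechet_derivative f (at x) v) \<le> C * norm v"
    "\<And>x y. x \<in> ball p r \<Longrightarrow> y \<in> ball p r \<Longrightarrow> norm (f x - f y) \<le> C * norm (x - y)"
proof -
  let ?D = "\<lambda>x. frechet_derivative f (at x)"
  have cont: "continuous_on U (\<lambda>x. ?D x v)" for v
  proof -
    have "Ck_on k (\<lambda>x. ?D x v) U" using f by simp
    then show ?thesis by (cases k) (auto intro: differentiable_imp_continuous_on)
  qed
  have D: "(f has_derivative ?D x) (at x)" if "x \<in> U" for x
    using differentiable_on_has_frechet_derivative[of f U x] f U(1) that by simp
  have "\<forall>\<^sub>F x in nhds p. norm (?D x b) < norm (?D p b) + 1" for b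
  proof -
    have "isCont (\<lambda>x. norm (?D x b)) p"
      using cont[of b] U by (intro continuous_intros) (simp add: continuous_on_eq_continuous_at)
    then show ?thesis
      by (intro order_tendstoD(2)[of _ "norm (?D p b)"]) (auto simp: isCont_def tendsto_nhds_iff)
  qed
  then have "\<forall>\<^sub>F x in nhds p. \<forall>b\<in>Basis. norm (?D x b) < norm (?D p b) + 1"
    by (intro eventually_ball_finite) auto
  moreover have "\<forall>\<^sub>F x in nhds p. x \<in> U" using U by (rule eventually_nhds_in_open)
  ultimately have "\<forall>\<^sub>F x in nhds p. x \<in> U \<and> (\<forall>b\<in>Basis. norm (?D x b) < norm (?D p b) + 1)"
    by eventually_elim auto
  then obtain r where r: "0 < r" "\<And>x. dist x p < r \<Longrightarrow> x \<in> U \<and> (\<forall>b\<in>Basis. norm (?D x b) < norm (?D p b) + 1)"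
    unfolding eventually_nhds_metric by blast
  define C where "C = (\<Sum>b\<in>Basis. norm (?D p b) + 1)"
  have C0: "0 \<le> C" unfolding C_def by (intro sum_nonneg) auto
  have bound: "norm (?D x v) \<le> C * norm v" if "x \<in> ball p r" for x v
  proof -
    have x: "x \<in> U" "\<And>b. b \<in> Basis \<Longrightarrow> norm (?D x b) \<le> norm (?D p b) + 1"
      using r(2)[of x] that by (auto simp: dist_commute less_imp_le)
    interpret bounded_linear "?D x" by (rule has_derivative_bounded_linear[OF D[OF x(1)]])
    have "?D x v = (\<Sum>b\<in>Basis. (v \<bullet> b) *\<^sub>R ?D x b)"
      by (subst euclidean_representation[of v, symmetric]) (simp only: sum scaleR)
    also have "norm \<dots> \<le> (\<Sum>b\<in>Basis. norm ((v \<bullet> b) *\<^sub>R ?D x b))" by (rule norm_sum)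
    also have "\<dots> \<le> (\<Sum>b\<in>Basis. (norm (?D p b) + 1) * norm v)"
    proof (rule sum_mono)
      fix b :: 'a assume b: "b \<in> Basis"
      have "\<bar>v \<bullet> b\<bar> * norm (?D x b) \<le> norm v * (norm (?D p b) + 1)"
        by (intro mult_mono Basis_le_norm x b) auto
      then show "norm ((v \<bullet> b) *\<^sub>R ?D x b) \<le> (norm (?D p b) + 1) * norm v" by (simp add: mult.commute)
    qed
    also have "\<dots> = C * norm v" unfolding C_def by (simp add: sum_distrib_right)
    finally show ?thesis .
  qed
  show thesis
  proof (rule that[OF r(1) C0 _ bound])
    show sub: "ball p r \<subseteq> U" using r(2) by (auto simp: dist_commute)
    fix x y assume xy: "x \<in> ball p r" "y \<in> ball p r"
    show "norm (f x - f y) \<le> C * norm (x - y)"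
    proof (rule differentiable_bound[OF convex_ball _ _ xy, where f'="?D"])
      show "(f has_derivative ?D z) (at z within ball p r)" if "z \<in> ball p r" for z
        by (rule has_derivative_at_withinI[OF D]) (use sub that in blast)
      show "onorm (?D z) \<le> C" if "z \<in> ball p r" for z
        by (rule onorm_bound[OF C0 bound[OF that]])
    qed
  qed
qed

lemma subspace_contains_derivative:
  fixes f :: "real \<Rightarrow> 'a::euclidean_space"
  assumes S: "subspace S" and f: "(f has_vector_derivative v) (at t)" "f t \<in> S" "\<forall>\<^sub>F s in at t. f s \<in> S"
  shows "v \<in> S"
proof (rule Lim_in_closed_set)
  show "closed S" by (rule closed_subspace[OF S])
  show "((\<lambda>s. (f s - f t) /\<^sub>R (s - t)) \<longlongrightarrow> v) (at t)"
  proof -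
    have "((\<lambda>s. (1 / norm (s - t)) *\<^sub>R (f s - (f t + (s - t) *\<^sub>R v))) \<longlongrightarrow> 0) (at t)"
      using f(1) by (simp add: has_vector_derivative_def has_derivative_within)
    then have A: "((\<lambda>s. norm ((1 / norm (s - t)) *\<^sub>R (f s - (f t + (s - t) *\<^sub>R v)))) \<longlongrightarrow> 0) (at t)"
      by (rule tendsto_norm_zero)
    have B: "norm ((1 / norm (s - t)) *\<^sub>R (f s - (f t + (s - t) *\<^sub>R v))) = norm ((f s - f t) /\<^sub>R (s - t) - v)"
      if "s \<noteq> t" for s
    proof -
      have "(f s - f t) /\<^sub>R (s - t) - v = inverse (s - t) *\<^sub>R (f s - (f t + (s - t) *\<^sub>R v))"
      proof -
        have "v = inverse (s - t) *\<^sub>R ((s - t) *\<^sub>R v)" using that by simp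
        then show ?thesis by (simp only: scaleR_diff_right scaleR_add_right diff_diff_eq)
      qed
      then show ?thesis by (simp add: divide_inverse)
    qed
    have "((\<lambda>s. norm ((f s - f t) /\<^sub>R (s - t) - v)) \<longlongrightarrow> 0) (at t)"
      by (rule Lim_transform_eventually[OF A]) (unfold eventually_at_filter, intro always_eventually allI impI, rule B)
    then show ?thesis by (simp only: tendsto_norm_zero_iff LIM_zero_iff)
  qed
  show "\<forall>\<^sub>F s in at t. (f s - f t) /\<^sub>R (s - t) \<in> S"
    using f(3) by eventually_elim (intro subspace_scale subspace_diff S f(2))
qed auto

locale slice_chart =
  fixes U U' :: "'a::euclidean_space set" and \<phi> \<psi> :: "'a \<Rightarrow> 'a" and S M :: "'a set"
  assumes open_U: "open U" and open_U': "open U'" and homeo: "homeomorphism U U' \<phi> \<psi>"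
    and smooth_phi: "smooth_on \<phi> U" and smooth_psi: "smooth_on \<psi> U'"
    and subspace_S: "subspace S" and slice: "\<phi> ` (U \<inter> M) = U' \<inter> S"
begin

abbreviation "D\<phi> x \<equiv> frechet_derivative \<phi> (at x)"
abbreviation "D\<psi> x \<equiv> frechet_derivative \<psi> (at x)"

lemma phi_in: "m \<in> U \<Longrightarrow> \<phi> m \<in> U'" and psi_phi: "m \<in> U \<Longrightarrow> \<psi> (\<phi> m) = m"
  using homeo unfolding homeomorphism_def by auto

lemma phi_derivative: "m \<in> U \<Longrightarrow> (\<phi> has_derivative D\<phi> m) (at m)"
  using smooth_phi open_U unfolding smooth_on_def
  by (metis Ck_on.simps(2) differentiable_on_has_frechet_derivative)

lemma psi_derivative: "q \<in> U' \<Longrightarrow> (\<psi> has_derivative D\<psi> q) (at q)"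
  using smooth_psi open_U' unfolding smooth_on_def
  by (metis Ck_on.simps(2) differentiable_on_has_frechet_derivative)

lemma linear_D: "m \<in> U \<Longrightarrow> linear (D\<phi> m)" "q \<in> U' \<Longrightarrow> linear (D\<psi> q)"
  using phi_derivative psi_derivative has_derivative_bounded_linear bounded_linear.linear by blast+

lemma Dpsi_Dphi: "D\<psi> (\<phi> m) (D\<phi> m v) = v" if m: "m \<in> U"
proof -
  have 1: "(\<psi> \<circ> \<phi> has_derivative D\<psi> (\<phi> m) \<circ> D\<phi> m) (at m)"
    by (rule diff_chain_at[OF phi_derivative[OF m] psi_derivative[OF phi_in[OF m]]])
  have "((\<lambda>x. x) has_derivative D\<psi> (\<phi> m) \<circ> D\<phi> m) (at m)"
    by (rule has_derivative_transform_within_open[OF 1 open_U m]) (simp add: psi_phi)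
  then have "D\<psi> (\<phi> m) \<circ> D\<phi> m = (\<lambda>x. x)"
    using has_derivative_unique has_derivative_ident by blast
  then show ?thesis by (metis comp_apply)
qed

lemma Dphi_Dpsi: "D\<phi> m (D\<psi> (\<phi> m) x) = x" if m: "m \<in> U"
proof -
  have "inj (D\<phi> m)" by (rule injI) (metis Dpsi_Dphi[OF m])
  then have "surj (D\<phi> m)"
    by (rule linear_injective_imp_surjective[OF linear_D(1)[OF m] _ refl])
  then obtain v where "x = D\<phi> m v" by (metis surjD)
  then show ?thesis by (simp add: Dpsi_Dphi[OF m])
qed

text \<open>
  In the chart the curve stays in the linear space \<open>S\<close>, so its velocity there lies in \<open>S\<close>. Differentiability at a
  single point suffices, so the lemma applies to smooth and to absolutely continuous curves alike.
\<close>

lemma velocity_in_image: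
  assumes m: "m \<in> U \<inter> M" and c: "(c has_vector_derivative v) (at t)" "c t = m" "\<forall>\<^sub>F s in at t. c s \<in> M"
  shows "v \<in> D\<psi> (\<phi> m) ` S"
proof -
  have "((\<phi> \<circ> c) has_derivative (D\<phi> m \<circ> (\<lambda>h. h *\<^sub>R v))) (at t)"
    using diff_chain_at[of c "\<lambda>h. h *\<^sub>R v" t \<phi> "D\<phi> m"] c m phi_derivative by (auto simp: has_vector_derivative_def)
  then have d: "((\<phi> \<circ> c) has_vector_derivative D\<phi> m v) (at t)"
    using m linear_D(1) by (simp add: has_vector_derivative_def o_def linear_cmul)
  have "isCont c t" by (rule has_vector_derivative_continuous[OF c(1)])
  then have "\<forall>\<^sub>F s in at t. c s \<in> U"
    using open_U m c(2) by (auto simp: isCont_def intro: topological_tendstoD)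
  with c(3) have "\<forall>\<^sub>F s in at t. (\<phi> \<circ> c) s \<in> S"
    by eventually_elim (use slice in auto)
  moreover have "(\<phi> \<circ> c) t \<in> S" using slice m c(2) by auto
  ultimately have "D\<phi> m v \<in> S" by (rule subspace_contains_derivative[OF subspace_S d, rotated])
  then show ?thesis using Dpsi_Dphi[of m v] m by (metis IntD1 image_eqI)
qed

lemma image_in_tangent_space:
  assumes m: "m \<in> U \<inter> M" and x: "x \<in> S"
  shows "D\<psi> (\<phi> m) x \<in> tangent_space M m"
proof -
  let ?q = "\<phi> m"
  have q: "?q \<in> U'" "?q \<in> S" using m slice by auto
  obtain r where r: "0 < r" "ball ?q r \<subseteq> U'" using open_U' q(1) by (meson open_contains_ball)
  define \<epsilon> where "\<epsilon> = r / (norm x + 1)"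
  define \<gamma> where "\<gamma> s = \<psi> (?q + s *\<^sub>R x)" for s :: real
  have \<epsilon>: "0 < \<epsilon>" unfolding \<epsilon>_def using r by (simp add: add_nonneg_pos)
  have inU: "?q + s *\<^sub>R x \<in> U'" if "s \<in> {-\<epsilon><..<\<epsilon>}" for s
  proof -
    have "\<bar>s\<bar> * norm x \<le> \<bar>s\<bar> * (norm x + 1)" by (intro mult_left_mono) auto
    also have "\<dots> < \<epsilon> * (norm x + 1)"
      using that by (intro mult_strict_right_mono) (auto simp: add_nonneg_pos)
    also have "\<dots> = r"
    proof -
      have "norm x + 1 \<noteq> 0" using norm_ge_zero[of x] by linarith
      then show ?thesis unfolding \<epsilon>_def by simp
    qed
    finally have "\<bar>s\<bar> * norm x < r" .
    then show ?thesis using r(2) by (auto simp: subset_iff dist_norm)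
  qed
  have "smooth_on \<gamma> {-\<epsilon><..<\<epsilon>}"
    using smooth_psi unfolding smooth_on_def \<gamma>_def
    by (intro allI Ck_on_compose_line[OF open_U' _ inU]) auto
  moreover have "\<gamma> ` {-\<epsilon><..<\<epsilon>} \<subseteq> M"
  proof
    fix y assume "y \<in> \<gamma> ` {-\<epsilon><..<\<epsilon>}"
    then obtain s where s: "s \<in> {-\<epsilon><..<\<epsilon>}" "y = \<gamma> s" by blast
    have "?q + s *\<^sub>R x \<in> U' \<inter> S" using inU[OF s(1)] q x by (auto intro: subspace_add subspace_scale subspace_S)
    then obtain m' where "m' \<in> U \<inter> M" "\<phi> m' = ?q + s *\<^sub>R x" using slice by (metis imageE)
    then show "y \<in> M" using s(2) psi_phi[of m'] by (simp add: \<gamma>_def)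
  qed
  moreover have "\<gamma> 0 = m" unfolding \<gamma>_def using psi_phi m by simp
  moreover have "(\<gamma> has_vector_derivative D\<psi> ?q x) (at 0)"
  proof -
    have 1: "((\<lambda>s::real. ?q + s *\<^sub>R x) has_derivative (\<lambda>h. h *\<^sub>R x)) (at 0)"
      by (auto intro!: derivative_eq_intros)
    have "(\<psi> has_derivative D\<psi> ?q) (at (?q + 0 *\<^sub>R x))" using psi_derivative[OF q(1)] by simp
    from diff_chain_at[OF 1 this] show ?thesis
      unfolding has_vector_derivative_def \<gamma>_def o_def using linear_D(2)[OF q(1)] by (simp add: linear_cmul)
  qed
  ultimately show ?thesis unfolding tangent_space_def using \<epsilon> by blast
qed

lemma tangent_space_eq: "tangent_space M m = D\<psi> (\<phi> m) ` S" if m: "m \<in> U \<inter> M"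
proof
  show "D\<psi> (\<phi> m) ` S \<subseteq> tangent_space M m" using image_in_tangent_space[OF m] by blast
  show "tangent_space M m \<subseteq> D\<psi> (\<phi> m) ` S"
  proof
    fix v assume "v \<in> tangent_space M m"
    then obtain \<gamma> \<epsilon> where *: "0 < \<epsilon>" "\<gamma> ` {-\<epsilon><..<\<epsilon>} \<subseteq> M" "\<gamma> (0::real) = m" "(\<gamma> has_vector_derivative v) (at 0)"
      unfolding tangent_space_def by blast
    have "\<forall>\<^sub>F s in at 0. s \<in> {-\<epsilon><..<\<epsilon>}"
      using *(1) by (intro eventually_at_in_open') auto
    then have "\<forall>\<^sub>F s in at 0. \<gamma> s \<in> M" by eventually_elim (use *(2) in blast)
    then show "v \<in> D\<psi> (\<phi> m) ` S" by (rule velocity_in_image[OF m *(4,3)])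
  qed
qed

text \<open>
  A vector \<open>w' = D\<psi> (\<phi> m') x\<close> tangent at \<open>m'\<close> is compared with \<open>w = D\<psi> (\<phi> m) x\<close>. The derivative of \<open>\<psi>\<close> and
  the map \<open>\<phi>\<close> are Lipschitz near \<open>p\<close>, and \<open>x = D\<phi> m' w'\<close> is bounded by \<open>w'\<close>.
\<close>

lemma tangent_gap:
  assumes p: "p \<in> U \<inter> M"
  obtains r C where "0 < r" "0 \<le> C"
    "\<And>m m' w'. m \<in> M \<inter> ball p r \<Longrightarrow> m' \<in> M \<inter> ball p r \<Longrightarrow> w' \<in> tangent_space M m' \<Longrightarrow>
      \<exists>w\<in>tangent_space M m. norm (w - w') \<le> C * norm (m - m') * norm w'"
proof -
  have C1: "Ck_on (Suc 0) \<phi> U" and C2: "Ck_on (Suc 0) (\<lambda>y. D\<psi> y b) U'" for b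
    using smooth_phi smooth_psi unfolding smooth_on_def by (blast, metis Ck_on.simps(2))
  obtain r1 C1 where r1: "0 < r1" "0 \<le> C1" "ball p r1 \<subseteq> U"
    "\<And>x v. x \<in> ball p r1 \<Longrightarrow> norm (D\<phi> x v) \<le> C1 * norm v"
    "\<And>x y. x \<in> ball p r1 \<Longrightarrow> y \<in> ball p r1 \<Longrightarrow> norm (\<phi> x - \<phi> y) \<le> C1 * norm (x - y)"
    using C1_on_locally_lipschitz[OF open_U _ C1] p by (metis IntD1)
  have q: "\<phi> p \<in> U'" using p phi_in by auto
  have "\<exists>r C. 0 < r \<and> 0 \<le> C \<and> (\<forall>x\<in>ball (\<phi> p) r. \<forall>y\<in>ball (\<phi> p) r. norm (D\<psi> x b - D\<psi> y b) \<le> C * norm (x - y))" for b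
    using C1_on_locally_lipschitz[OF open_U' q C2] by metis
  then obtain r2 C2 where r2: "\<And>b. 0 < r2 b" "\<And>b. 0 \<le> C2 b"
    "\<And>b x y. x \<in> ball (\<phi> p) (r2 b) \<Longrightarrow> y \<in> ball (\<phi> p) (r2 b) \<Longrightarrow> norm (D\<psi> x b - D\<psi> y b) \<le> C2 b * norm (x - y)"
    by metis
  define \<rho> where "\<rho> = Min (r2 ` Basis)"
  have \<rho>: "0 < \<rho>" "\<And>b. b \<in> Basis \<Longrightarrow> \<rho> \<le> r2 b" unfolding \<rho>_def using r2(1) by (auto simp: Min_gr_iff)
  define L where "L = (\<Sum>b\<in>Basis. C2 b)"
  have L0: "0 \<le> L" unfolding L_def using r2(2) by (intro sum_nonneg) auto
  define r where "r = min r1 (\<rho> / (C1 + 1))"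
  have r: "0 < r" "r \<le> r1" unfolding r_def using r1 \<rho> by (auto simp: add_nonneg_pos)
  have phi_ball: "\<phi> m \<in> ball (\<phi> p) \<rho>" if "m \<in> ball p r" for m
  proof -
    have "norm (\<phi> p - \<phi> m) \<le> C1 * norm (p - m)" using r1(5)[of p m] that r r1(1) by auto
    also have "\<dots> \<le> (C1 + 1) * norm (p - m)" by (intro mult_right_mono) auto
    also have "\<dots> < (C1 + 1) * (\<rho> / (C1 + 1))"
      using that r1(2) unfolding r_def by (intro mult_strict_left_mono) (auto simp: dist_norm)
    also have "\<dots> = \<rho>" using r1(2) by simp
    finally show ?thesis by (simp add: dist_norm)
  qed
  show thesis
  proof (rule that[OF r(1), of "L * C1 * C1"])
    show "0 \<le> L * C1 * C1" using L0 r1(2) by simp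
    fix m m' w'
    assume m: "m \<in> M \<inter> ball p r" and m': "m' \<in> M \<inter> ball p r" and w': "w' \<in> tangent_space M m'"
    have mU: "m \<in> U \<inter> M" "m' \<in> U \<inter> M" using m m' r(2) r1(3) by auto
    have mr: "m \<in> ball p r1" "m' \<in> ball p r1" using m m' r(2) by auto
    obtain x where x: "x \<in> S" "w' = D\<psi> (\<phi> m') x" using w' tangent_space_eq[OF mU(2)] by auto
    have xw: "norm x \<le> C1 * norm w'"
      using r1(4)[OF mr(2), of w'] Dphi_Dpsi[of m' x] mU(2) x(2) by simp
    have "norm (D\<psi> (\<phi> m) x - D\<psi> (\<phi> m') x) \<le> L * norm (\<phi> m - \<phi> m') * norm x"
    proof -
      have "linear (D\<psi> (\<phi> m))" "linear (D\<psi> (\<phi> m'))" using linear_D(2) phi_in mU by auto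
      then have lin: "linear (\<lambda>x. D\<psi> (\<phi> m) x - D\<psi> (\<phi> m') x)" by (rule linear_compose_sub)
      have "D\<psi> (\<phi> m) x - D\<psi> (\<phi> m') x = (\<Sum>b\<in>Basis. (x \<bullet> b) *\<^sub>R (D\<psi> (\<phi> m) b - D\<psi> (\<phi> m') b))"
        using linear_sum[OF lin, of "\<lambda>b. (x \<bullet> b) *\<^sub>R b" Basis] linear_cmul[OF lin]
        by (simp add: euclidean_representation)
      then have "norm (D\<psi> (\<phi> m) x - D\<psi> (\<phi> m') x) \<le> (\<Sum>b\<in>Basis. norm ((x \<bullet> b) *\<^sub>R (D\<psi> (\<phi> m) b - D\<psi> (\<phi> m') b)))"
        by (simp only: norm_sum)
      also have "\<dots> \<le> (\<Sum>b\<in>Basis. C2 b * norm (\<phi> m - \<phi> m') * norm x)"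
      proof (rule sum_mono)
        fix b :: 'a assume b: "b \<in> Basis"
        have *: "norm (D\<psi> (\<phi> m) b - D\<psi> (\<phi> m') b) \<le> C2 b * norm (\<phi> m - \<phi> m')"
        proof -
          have "\<phi> m \<in> ball (\<phi> p) \<rho>" "\<phi> m' \<in> ball (\<phi> p) \<rho>"
            using phi_ball[of m] phi_ball[of m'] m m' by simp_all
          then have q: "\<phi> m \<in> ball (\<phi> p) (r2 b)" "\<phi> m' \<in> ball (\<phi> p) (r2 b)"
            using \<rho>(2)[OF b] unfolding mem_ball by linarith+
          show ?thesis by (rule r2(3)[OF q])
        qed
        have "\<bar>x \<bullet> b\<bar> * norm (D\<psi> (\<phi> m) b - D\<psi> (\<phi> m') b) \<le> norm x * (C2 b * norm (\<phi> m - \<phi> m'))"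
          by (rule mult_mono[OF Basis_le_norm[OF b] *]) simp_all
        then show "norm ((x \<bullet> b) *\<^sub>R (D\<psi> (\<phi> m) b - D\<psi> (\<phi> m') b)) \<le> C2 b * norm (\<phi> m - \<phi> m') * norm x"
          by (simp add: mult_ac)
      qed
      also have "\<dots> = L * norm (\<phi> m - \<phi> m') * norm x" unfolding L_def by (simp add: sum_distrib_right)
      finally show ?thesis .
    qed
    also have "\<dots> \<le> L * (C1 * norm (m - m')) * (C1 * norm w')"
      using r1(5)[OF mr] xw L0 r1(2) by (intro mult_mono) auto
    finally have "norm (D\<psi> (\<phi> m) x - w') \<le> L * C1 * C1 * norm (m - m') * norm w'"
      unfolding x(2) by (simp add: mult_ac)
    moreover have "D\<psi> (\<phi> m) x \<in> tangent_space M m" by (rule image_in_tangent_space[OF mU(1) x(1)])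
    ultimately show "\<exists>w\<in>tangent_space M m. norm (w - w') \<le> L * C1 * C1 * norm (m - m') * norm w'" by blast
  qed
qed

end

lemma submanifold_chart:
  assumes "submanifold n M" "p \<in> M"
  obtains U U' \<phi> \<psi> S where "slice_chart U U' \<phi> \<psi> S M" "p \<in> U \<inter> M"
proof -
  obtain U U' \<phi> \<psi> S where "open U" "p \<in> U" "open U'" "homeomorphism U U' \<phi> \<psi>"
        "smooth_on \<phi> U" "smooth_on \<psi> U'" "subspace (S :: 'a set)" "dim S = n" "\<phi> ` (U \<inter> M) = U' \<inter> S"
    using assms unfolding submanifold_def by metis
  then show thesis using assms(2) by (intro that[of U U' \<phi> \<psi> S]) (unfold_locales, auto)
qed

lemma subspace_tangent_space:
  assumes "submanifold n M" "p \<in> M"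
  shows "subspace (tangent_space M p)"
proof -
  obtain U U' \<phi> \<psi> S where c: "slice_chart U U' \<phi> \<psi> S M" and p: "p \<in> U \<inter> M"
    by (rule submanifold_chart[OF assms]) blast
  interpret slice_chart U U' \<phi> \<psi> S M by (rule c)
  show ?thesis
    unfolding tangent_space_eq[OF p] using p by (intro linear_subspace_image linear_D(2) phi_in subspace_S) auto
qed

lemma velocity_in_tangent_space:
  assumes "submanifold n M" and c: "(c has_vector_derivative v) (at t)" "c t \<in> M" "\<forall>\<^sub>F s in at t. c s \<in> M"
  shows "v \<in> tangent_space M (c t)"
proof -
  obtain U U' \<phi> \<psi> S where ch: "slice_chart U U' \<phi> \<psi> S M" and p: "c t \<in> U \<inter> M"
    by (rule submanifold_chart[OF assms(1) c(2)]) blast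
  interpret slice_chart U U' \<phi> \<psi> S M by (rule ch)
  show ?thesis unfolding tangent_space_eq[OF p] by (rule velocity_in_image[OF p c(1) refl c(3)])
qed

text \<open>
  Points of a finite subcover that are close satisfy a local estimate; for points at distance at least \<open>\<rho>\<close> the vector
  \<open>w = 0\<close> will do if the constant is at least \<open>1 / \<rho>\<close>.
\<close>

lemma tangent_gap_compact:
  assumes M: "submanifold n M" and K: "compact K" "K \<subseteq> M"
  obtains C where "0 \<le> C"
    "\<And>m m' w'. m \<in> K \<Longrightarrow> m' \<in> K \<Longrightarrow> w' \<in> tangent_space M m' \<Longrightarrow>
      \<exists>w\<in>tangent_space M m. norm (w - w') \<le> C * norm (m - m') * norm w'"
proof -
  have "\<exists>r C. 0 < r \<and> 0 \<le> C \<and>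
    (\<forall>m\<in>M \<inter> ball p r. \<forall>m'\<in>M \<inter> ball p r. \<forall>w'\<in>tangent_space M m'.
      \<exists>w\<in>tangent_space M m. norm (w - w') \<le> C * norm (m - m') * norm w')" if p: "p \<in> M" for p
  proof -
    obtain U U' \<phi> \<psi> S where c: "slice_chart U U' \<phi> \<psi> S M" and p: "p \<in> U \<inter> M"
      by (rule submanifold_chart[OF M p]) blast
    from slice_chart.tangent_gap[OF this] show ?thesis by metis
  qed
  then obtain r C where r: "\<And>p. p \<in> M \<Longrightarrow> 0 < r p" and C: "\<And>p. p \<in> M \<Longrightarrow> 0 \<le> C p"
    and rC: "\<And>p m m' w'. p \<in> M \<Longrightarrow> m \<in> M \<inter> ball p (r p) \<Longrightarrow> m' \<in> M \<inter> ball p (r p) \<Longrightarrow> w' \<in> tangent_space M m'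
      \<Longrightarrow> \<exists>w\<in>tangent_space M m. norm (w - w') \<le> C p * norm (m - m') * norm w'"
    by metis
  have "K \<subseteq> (\<Union>p\<in>K. ball p (r p / 2))" using r K(2) by fastforce
  then obtain P where P: "P \<subseteq> K" "finite P" "K \<subseteq> (\<Union>p\<in>P. ball p (r p / 2))"
    using compactE_image[OF K(1), of K "\<lambda>p. ball p (r p / 2)"] by (metis open_ball)
  define \<rho> where "\<rho> = Min (insert 1 ((\<lambda>p. r p / 2) ` P))"
  have "0 < \<rho>" unfolding \<rho>_def using P(1,2) r K(2) by (auto simp: Min_gr_iff subset_iff)
  moreover have "\<rho> \<le> r p / 2" if "p \<in> P" for p
    unfolding \<rho>_def by (rule Min_le) (use P(2) that in auto)
  ultimately have \<rho>: "0 < \<rho>" "\<And>p. p \<in> P \<Longrightarrow> \<rho> \<le> r p / 2" by blast+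
  define C' where "C' = (\<Sum>p\<in>P. C p) + 1 / \<rho>"
  have Cp: "0 \<le> C p" if "p \<in> P" for p using C K(2) P(1) that by blast
  have C': "0 \<le> C'" "1 / \<rho> \<le> C'" "\<And>p. p \<in> P \<Longrightarrow> C p \<le> C'"
  proof -
    have "0 \<le> (\<Sum>p\<in>P. C p)" using Cp by (intro sum_nonneg) auto
    moreover have "C p \<le> (\<Sum>p\<in>P. C p)" if "p \<in> P" for p using Cp that P(2) by (intro member_le_sum) auto
    ultimately show "0 \<le> C'" "1 / \<rho> \<le> C'" "\<And>p. p \<in> P \<Longrightarrow> C p \<le> C'"
      unfolding C'_def using \<rho>(1) by (auto intro: add_increasing2)
  qed
  show thesis
  proof (rule that[OF C'(1)])
    fix m m' w' assume m: "m \<in> K" "m' \<in> K" and w': "w' \<in> tangent_space M m'"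
    show "\<exists>w\<in>tangent_space M m. norm (w - w') \<le> C' * norm (m - m') * norm w'"
    proof (cases "norm (m - m') < \<rho>")
      case True
      obtain p where p: "p \<in> P" "dist p m < r p / 2" using P(3) m by force
      have "dist p m' \<le> dist p m + dist m m'" by (rule dist_triangle)
      then have "dist p m' < r p" using p(2) \<rho>(2)[OF p(1)] True by (simp add: dist_norm)
      moreover have "dist p m < r p" using p(2) zero_le_dist[of p m] by linarith
      moreover have "p \<in> M" using p(1) P(1) K(2) by auto
      ultimately obtain w where w: "w \<in> tangent_space M m" "norm (w - w') \<le> C p * norm (m - m') * norm w'"
        using rC[of p m m' w'] m w' K(2) by auto
      have "C p * norm (m - m') * norm w' \<le> C' * norm (m - m') * norm w'"
        by (intro mult_right_mono C'(3) p) auto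
      with w show ?thesis by (metis order_trans)
    next
      case False
      have "1 \<le> (1/\<rho>) * norm (m - m')" using False \<rho>(1) by (simp add: field_simps)
      also have "\<dots> \<le> C' * norm (m - m')" by (intro mult_right_mono C'(2)) auto
      finally have "1 * norm w' \<le> C' * norm (m - m') * norm w'" by (intro mult_right_mono) auto
      moreover have "0 \<in> tangent_space M m"
        using subspace_tangent_space[OF M] m K(2) subspace_0 by blast
      ultimately show ?thesis by (intro bexI[of _ 0]) auto
    qed
  qed
qed

section \<open>Parallel fields and rolling\<close>

lemma curve_velocity_tangent:
  assumes M: "submanifold n M" and \<alpha>: "curve_in T M \<alpha>" and T: "0 < T"
  shows "AE t\<in>{0..T} in lebesgue. velocity T \<alpha> t \<in> tangent_space M (\<alpha> t)"
proof -
  have ac: "abs_cont_on {0..T} \<alpha>" and in_M: "\<And>t. t \<in> {0..T} \<Longrightarrow> \<alpha> t \<in> M"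
    using \<alpha> unfolding curve_in_def by auto
  show ?thesis
    using abs_cont_on_fundamental_theorem(1)[OF ac T] AE_interior_Icc[of T]
  proof eventually_elim
    case (elim t)
    show ?case
    proof
      assume t: "t \<in> {0..T}"
      then have ti: "t \<in> {0<..<T}" and d: "(\<alpha> has_vector_derivative velocity T \<alpha> t) (at t)"
        using elim by blast+
      have "\<forall>\<^sub>F s in at t. s \<in> {0<..<T}" by (rule eventually_at_in_open'[OF open_greaterThanLessThan ti])
      then have "\<forall>\<^sub>F s in at t. \<alpha> s \<in> M" by eventually_elim (simp add: in_M)
      then show "velocity T \<alpha> t \<in> tangent_space M (\<alpha> t)"
        by (rule velocity_in_tangent_space[OF M d in_M[OF t]])
    qed
  qed
qed

lemma velocity_sum_scaleR:
  fixes X :: "'i \<Rightarrow> real \<Rightarrow> 'a::euclidean_space"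
  assumes T: "0 < T" and fin: "finite J"
    and \<zeta>: "\<And>i. i \<in> J \<Longrightarrow> abs_cont_on {0..T} (\<zeta> i)" and X: "\<And>i. i \<in> J \<Longrightarrow> abs_cont_on {0..T} (X i)"
    and Z: "\<And>t. t \<in> {0..T} \<Longrightarrow> Z t = (\<Sum>i\<in>J. \<zeta> i t *\<^sub>R X i t)"
  shows "AE t\<in>{0..T} in lebesgue. velocity T Z t =
    (\<Sum>i\<in>J. \<zeta> i t *\<^sub>R velocity T (X i) t + velocity T (\<zeta> i) t *\<^sub>R X i t)"
proof -
  have "AE t in lebesgue. \<forall>i\<in>J. t \<in> {0..T} \<longrightarrow> (\<zeta> i has_vector_derivative velocity T (\<zeta> i) t) (at t)
      \<and> (X i has_vector_derivative velocity T (X i) t) (at t)"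
  proof (rule AE_finite_allI[OF fin])
    fix i assume i: "i \<in> J"
    show "AE t in lebesgue. t \<in> {0..T} \<longrightarrow> (\<zeta> i has_vector_derivative velocity T (\<zeta> i) t) (at t)
      \<and> (X i has_vector_derivative velocity T (X i) t) (at t)"
      using abs_cont_on_fundamental_theorem(1)[OF \<zeta>[OF i] T] abs_cont_on_fundamental_theorem(1)[OF X[OF i] T]
      by eventually_elim simp
  qed
  then show ?thesis using AE_interior_Icc[of T]
  proof eventually_elim
    case (elim t)
    show ?case
    proof
      assume t: "t \<in> {0..T}"
      then have ti: "t \<in> {0<..<T}" using elim(2) by simp
      have "((\<lambda>t. \<zeta> i t *\<^sub>R X i t) has_vector_derivative
          (\<zeta> i t *\<^sub>R velocity T (X i) t + velocity T (\<zeta> i) t *\<^sub>R X i t)) (at t)" if "i \<in> J" for i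
        using elim(1) t that by (intro bounded_bilinear.has_vector_derivative[OF bounded_bilinear_scaleR]) auto
      then have "((\<lambda>t. \<Sum>i\<in>J. \<zeta> i t *\<^sub>R X i t) has_vector_derivative
          (\<Sum>i\<in>J. \<zeta> i t *\<^sub>R velocity T (X i) t + velocity T (\<zeta> i) t *\<^sub>R X i t)) (at t)"
        by (rule has_vector_derivative_sum)
      then have "(Z has_vector_derivative
          (\<Sum>i\<in>J. \<zeta> i t *\<^sub>R velocity T (X i) t + velocity T (\<zeta> i) t *\<^sub>R X i t)) (at t)"
        by (rule has_vector_derivative_transform_within_open[OF _ open_greaterThanLessThan ti]) (simp add: Z)
      then show "velocity T Z t = (\<Sum>i\<in>J. \<zeta> i t *\<^sub>R velocity T (X i) t + velocity T (\<zeta> i) t *\<^sub>R X i t)"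
        by (rule velocity_eqI[OF _ t T])
    qed
  qed
qed

lemma parallel_field_cong:
  assumes "\<And>t. t \<in> {0..T} \<Longrightarrow> X t = Y t"
  shows "parallel_field B T M \<alpha> X \<longleftrightarrow> parallel_field B T M \<alpha> Y"
proof -
  have "parallel_field B T M \<alpha> Y" if XY: "\<And>t. t \<in> {0..T} \<Longrightarrow> Y t = X t" and X: "parallel_field B T M \<alpha> X" for X Y
  proof -
    have "AE t\<in>{0..T} in lebesgue. cov_deriv B T M \<alpha> X t = 0" and "tangent_field T M \<alpha> X"
      using X unfolding parallel_field_def by auto
    moreover have v: "velocity T Y t = velocity T X t" if "t \<in> {0..T}" for t
      by (rule velocity_cong[OF XY that])
    moreover from calculation(1) have "AE t\<in>{0..T} in lebesgue. cov_deriv B T M \<alpha> Y t = 0"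
      by eventually_elim (simp add: cov_deriv_def v)
    ultimately show ?thesis
      using XY abs_cont_on_cong[of "{0..T}" X Y] unfolding parallel_field_def tangent_field_def by auto
  qed
  from this[of X Y] this[of Y X] assms show ?thesis by metis
qed

locale semi_riemannian = scalar_product B for B :: "'a::euclidean_space \<Rightarrow> 'a \<Rightarrow> real" +
  fixes M :: "'a set" and n :: nat and sig :: "nat \<times> nat"
  assumes manifold: "semi_riemannian_submanifold B n sig M"
begin

lemma submanifold: "submanifold n M"
  using manifold unfolding semi_riemannian_submanifold_def by simp

lemma tangent_subspace: "m \<in> M \<Longrightarrow> subspace (tangent_space M m)"
  by (rule subspace_tangent_space[OF submanifold])

lemma tangent_nondegenerate: "m \<in> M \<Longrightarrow> nondegenerate_on B (tangent_space M m)"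
  using manifold unfolding semi_riemannian_submanifold_def by simp

text \<open>
  The Leibniz rule for combinations of parallel fields: only the coefficients are differentiated.
\<close>

lemma cov_deriv_expansion:
  assumes T: "0 < T" and \<alpha>: "curve_in T M \<alpha>" and fin: "finite J"
    and X: "\<And>i. i \<in> J \<Longrightarrow> parallel_field B T M \<alpha> (X i)"
    and \<zeta>: "\<And>i. i \<in> J \<Longrightarrow> abs_cont_on {0..T} (\<zeta> i)"
    and Z: "\<And>t. t \<in> {0..T} \<Longrightarrow> Z t = (\<Sum>i\<in>J. \<zeta> i t *\<^sub>R X i t)"
  shows "AE t\<in>{0..T} in lebesgue. cov_deriv B T M \<alpha> Z t = (\<Sum>i\<in>J. velocity T (\<zeta> i) t *\<^sub>R X i t)"
proof -
  have tf: "tangent_field T M \<alpha> (X i)" and pf: "AE t\<in>{0..T} in lebesgue. cov_deriv B T M \<alpha> (X i) t = 0" if "i \<in> J" for i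
    using X[OF that] unfolding parallel_field_def by auto
  have "AE t in lebesgue. \<forall>i\<in>J. t \<in> {0..T} \<longrightarrow> cov_deriv B T M \<alpha> (X i) t = 0"
    by (rule AE_finite_allI[OF fin]) (rule pf)
  moreover have "AE t\<in>{0..T} in lebesgue. velocity T Z t =
      (\<Sum>i\<in>J. \<zeta> i t *\<^sub>R velocity T (X i) t + velocity T (\<zeta> i) t *\<^sub>R X i t)"
    by (rule velocity_sum_scaleR[OF T fin]) (use tf \<zeta> Z in \<open>auto simp: tangent_field_def\<close>)
  ultimately show ?thesis
  proof eventually_elim
    case (elim t)
    show ?case
    proof
      assume t: "t \<in> {0..T}"
      let ?W = "tangent_space M (\<alpha> t)"
      have m: "\<alpha> t \<in> M" using \<alpha> t unfolding curve_in_def by simp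
      note W = tangent_subspace[OF m] tangent_nondegenerate[OF m]
      note lin = linear_tan_part[OF W]
      have "cov_deriv B T M \<alpha> Z t = (\<Sum>i\<in>J. tan_part B ?W (\<zeta> i t *\<^sub>R velocity T (X i) t + velocity T (\<zeta> i) t *\<^sub>R X i t))"
        unfolding cov_deriv_def elim(2)[rule_format, OF t] by (rule linear_sum[OF lin])
      also have "\<dots> = (\<Sum>i\<in>J. velocity T (\<zeta> i) t *\<^sub>R X i t)"
      proof (rule sum.cong[OF refl])
        fix i assume i: "i \<in> J"
        have "tan_part B ?W (velocity T (X i) t) = 0" using elim(1) i t unfolding cov_deriv_def by blast
        moreover have "tan_part B ?W (X i t) = X i t"
          using tan_part_id[OF W] tf[OF i] t unfolding tangent_field_def by blast
        ultimately show "tan_part B ?W (\<zeta> i t *\<^sub>R velocity T (X i) t + velocity T (\<zeta> i) t *\<^sub>R X i t) = velocity T (\<zeta> i) t *\<^sub>R X i t"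
          by (simp add: linear_add[OF lin] linear_cmul[OF lin])
      qed
      finally show "cov_deriv B T M \<alpha> Z t = (\<Sum>i\<in>J. velocity T (\<zeta> i) t *\<^sub>R X i t)" .
    qed
  qed
qed

lemma exists_parallel_frame:
  assumes T: "0 < T" and \<alpha>: "curve_in T M \<alpha>"
  shows "\<exists>X Y :: 'a \<Rightarrow> real \<Rightarrow> 'a. (\<forall>b. parallel_field B T M \<alpha> (X b)) \<and> (\<forall>b. abs_cont_on {0..T} (Y b)) \<and>
    (\<forall>t\<in>{0..T}. \<forall>v\<in>tangent_space M (\<alpha> t). (\<Sum>b\<in>Basis. B v (Y b t) *\<^sub>R X b t) = v)"
proof -
  have m: "\<alpha> t \<in> M" if "t \<in> {0..T}" for t using \<alpha> that unfolding curve_in_def by simp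
  have ac: "abs_cont_on {0..T} \<alpha>" using \<alpha> unfolding curve_in_def by simp
  have K: "compact (\<alpha> ` {0..T})" "\<alpha> ` {0..T} \<subseteq> M"
    using m by (auto intro: compact_continuous_image abs_cont_on_imp_continuous_on[OF ac])
  obtain C where C: "0 \<le> C"
    "\<And>m m' w'. m \<in> \<alpha> ` {0..T} \<Longrightarrow> m' \<in> \<alpha> ` {0..T} \<Longrightarrow> w' \<in> tangent_space M m' \<Longrightarrow>
      \<exists>w\<in>tangent_space M m. norm (w - w') \<le> C * norm (m - m') * norm w'"
    by (rule tangent_gap_compact[OF submanifold K]) blast
  show ?thesis
  proof (rule parallel_frame[of T "\<lambda>t. tangent_space M (\<alpha> t)" \<alpha> C])
    fix X Y :: "'a \<Rightarrow> real \<Rightarrow> 'a"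
    assume XY: "\<And>b. abs_cont_on {0..T} (X b)" "\<And>b. abs_cont_on {0..T} (Y b)"
      "\<And>b t. t \<in> {0..T} \<Longrightarrow> X b t \<in> tangent_space M (\<alpha> t)"
      "\<And>b. AE t\<in>{0..T} in lebesgue. tan_part B (tangent_space M (\<alpha> t)) (velocity T (X b) t) = 0"
      "\<And>v t. t \<in> {0..T} \<Longrightarrow> v \<in> tangent_space M (\<alpha> t) \<Longrightarrow> v = (\<Sum>b\<in>Basis. B v (Y b t) *\<^sub>R X b t)"
    show ?thesis
    proof (rule exI[of _ X], rule exI[of _ Y], intro conjI allI ballI)
      show "parallel_field B T M \<alpha> (X b)" for b
        using XY(1,3,4)[where b=b] unfolding parallel_field_def tangent_field_def cov_deriv_def by blast
      show "abs_cont_on {0..T} (Y b)" for b by (rule XY(2))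
      show "(\<Sum>b\<in>Basis. B v (Y b t) *\<^sub>R X b t) = v" if "t \<in> {0..T}" "v \<in> tangent_space M (\<alpha> t)" for t v
        by (rule XY(5)[OF that, symmetric])
    qed
  next
    show "\<exists>w'\<in>tangent_space M (\<alpha> t). norm (w' - w) \<le> C * norm (\<alpha> t - \<alpha> s) * norm w"
      if "s \<in> {0..T}" "t \<in> {0..T}" "w \<in> tangent_space M (\<alpha> s)" for s t w
      by (rule C(2)) (use that in auto)
  qed (use T ac C(1) m tangent_subspace tangent_nondegenerate in auto)
qed

end

lemma isometry_group_eq_0:
  assumes B: "scalar_product_form B" and R: "R \<in> isometry_group B" and x: "blinfun_apply R x = 0"
  shows "x = 0"
proof -
  interpret scalar_product B by unfold_locales (rule B)
  have "B x y = 0" for y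
  proof -
    have "B x y = B (blinfun_apply R x) (blinfun_apply R y)" using R unfolding isometry_group_def by simp
    then show ?thesis by (simp only: x zero_left)
  qed
  then show ?thesis using nondegenerate_UNIV unfolding nondegenerate_on_def by blast
qed

lemma SO_isometry: "R \<in> SO B \<Longrightarrow> R \<in> isometry_group B"
  unfolding SO_def using connected_component_subset by blast

text \<open>
  The situation common to both directions of the theorem: an absolutely continuous curve of isometries of the ambient
  space that matches the tangent spaces along the two curves.
\<close>

locale moving_isometry =
  M: semi_riemannian B M n sig + M': semi_riemannian B M' n sig
  for B :: "'a::euclidean_space \<Rightarrow> 'a \<Rightarrow> real" and M M' :: "'a set" and n :: nat and sig :: "nat \<times> nat" +
  fixes T :: real and \<alpha> \<alpha>' :: "real \<Rightarrow> 'a" and R :: "real \<Rightarrow> 'a \<Rightarrow>\<^sub>L 'a" and s :: "real \<Rightarrow> 'a"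
  assumes T: "0 < T" and \<alpha>: "curve_in T M \<alpha>" and \<alpha>': "curve_in T M' \<alpha>'"
    and g: "curve_in T (SE B) (\<lambda>t. (R t, s t))"
    and R_tangent: "\<And>t. t \<in> {0..T} \<Longrightarrow> blinfun_apply (R t) ` tangent_space M (\<alpha> t) = tangent_space M' (\<alpha>' t)"
begin

lemma R_isometry: "t \<in> {0..T} \<Longrightarrow> R t \<in> isometry_group B"
  using g unfolding curve_in_def SE_def by (auto intro: SO_isometry)

lemma R_abs_cont: "abs_cont_on {0..T} R"
  using abs_cont_on_linear[OF bounded_linear_fst, of "{0..T}" "\<lambda>t. (R t, s t)"] g unfolding curve_in_def by simp

lemma R_field: "tangent_field T M \<alpha> X \<Longrightarrow> tangent_field T M' \<alpha>' (\<lambda>t. blinfun_apply (R t) (X t))"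
  using R_tangent abs_cont_on_bilinear[OF bounded_bilinear_blinfun_apply R_abs_cont]
  unfolding tangent_field_def by blast

text \<open>
  A tangent field is expanded as \<open>Z = \<Sum> \<zeta> b X b\<close> in a parallel frame. Then \<open>D Z = \<Sum> \<zeta>' b X b\<close>, and since
  the fields \<open>R (X b)\<close> are parallel by assumption, \<open>D (R Z) = \<Sum> \<zeta>' b R (X b) = R (D Z)\<close>.
\<close>

proposition tangential_no_twistI:
  assumes par: "\<And>X. parallel_field B T M \<alpha> X \<Longrightarrow> parallel_field B T M' \<alpha>' (\<lambda>t. blinfun_apply (R t) (X t))"
  shows "tangential_no_twist B T M M' \<alpha> \<alpha>' (\<lambda>t. (R t, s t))"
  unfolding tangential_no_twist_def se_diff_def fst_conv
proof (intro allI impI)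
  fix Z assume Z: "tangent_field T M \<alpha> Z"
  from M.exists_parallel_frame[OF T \<alpha>] obtain X Y :: "'a \<Rightarrow> real \<Rightarrow> 'a"
    where frame: "(\<forall>b. parallel_field B T M \<alpha> (X b)) \<and> (\<forall>b. abs_cont_on {0..T} (Y b)) \<and>
      (\<forall>t\<in>{0..T}. \<forall>v\<in>tangent_space M (\<alpha> t). (\<Sum>b\<in>Basis. B v (Y b t) *\<^sub>R X b t) = v)"
    by (elim exE) (rule that)
  have X: "parallel_field B T M \<alpha> (X b)" for b using conjunct1[OF frame] by (rule spec)
  have Y: "abs_cont_on {0..T} (Y b)" for b using conjunct1[OF conjunct2[OF frame]] by (rule spec)
  note XY = conjunct2[OF conjunct2[OF frame], rule_format]
  define \<zeta> where "\<zeta> b t = B (Z t) (Y b t)" for b t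
  have \<zeta>: "abs_cont_on {0..T} (\<zeta> b)" for b
    unfolding \<zeta>_def by (rule abs_cont_on_bilinear[OF M.bounded_bilin _ Y]) (use Z in \<open>simp add: tangent_field_def\<close>)
  have Zx: "Z t = (\<Sum>b\<in>Basis. \<zeta> b t *\<^sub>R X b t)" if "t \<in> {0..T}" for t
  proof -
    have "Z t \<in> tangent_space M (\<alpha> t)" using Z that unfolding tangent_field_def by blast
    from XY[OF that this] show ?thesis unfolding \<zeta>_def by (rule sym)
  qed
  have "AE t\<in>{0..T} in lebesgue. cov_deriv B T M \<alpha> Z t = (\<Sum>b\<in>Basis. velocity T (\<zeta> b) t *\<^sub>R X b t)"
    by (rule M.cov_deriv_expansion[OF T \<alpha> finite_Basis X \<zeta> Zx])
  moreover have "AE t\<in>{0..T} in lebesgue. cov_deriv B T M' \<alpha>' (\<lambda>r. blinfun_apply (R r) (Z r)) t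
      = (\<Sum>b\<in>Basis. velocity T (\<zeta> b) t *\<^sub>R blinfun_apply (R t) (X b t))"
    by (rule M'.cov_deriv_expansion[OF T \<alpha>' finite_Basis par[OF X] \<zeta>])
      (simp add: Zx blinfun.sum_right blinfun.scaleR_right)
  ultimately show "AE t\<in>{0..T} in lebesgue. blinfun_apply (R t) (cov_deriv B T M \<alpha> Z t)
      = cov_deriv B T M' \<alpha>' (\<lambda>r. blinfun_apply (R r) (Z r)) t"
    by eventually_elim (simp add: blinfun.sum_right blinfun.scaleR_right)
qed

text \<open>
  Commuting with covariant differentiation, \<open>R t\<close> maps \<open>D X\<close> to \<open>D (R X)\<close>; being injective, it maps
  only \<open>0\<close> to \<open>0\<close>.
\<close>

lemma parallel_field_iff:
  assumes E4: "tangential_no_twist B T M M' \<alpha> \<alpha>' (\<lambda>t. (R t, s t))" and X: "tangent_field T M \<alpha> X"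
  shows "parallel_field B T M' \<alpha>' (\<lambda>t. blinfun_apply (R t) (X t)) \<longleftrightarrow> parallel_field B T M \<alpha> X"
proof -
  have "AE t\<in>{0..T} in lebesgue. blinfun_apply (R t) (cov_deriv B T M \<alpha> X t)
      = cov_deriv B T M' \<alpha>' (\<lambda>r. blinfun_apply (R r) (X r)) t"
    using E4 X unfolding tangential_no_twist_def se_diff_def by simp
  then have "AE t in lebesgue. (t \<in> {0..T} \<longrightarrow> cov_deriv B T M' \<alpha>' (\<lambda>r. blinfun_apply (R r) (X r)) t = 0)
      = (t \<in> {0..T} \<longrightarrow> cov_deriv B T M \<alpha> X t = 0)"
  proof eventually_elim
    case (elim t)
    have "cov_deriv B T M \<alpha> X t = 0" if "t \<in> {0..T}" "blinfun_apply (R t) (cov_deriv B T M \<alpha> X t) = 0"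
      using isometry_group_eq_0[OF M.form R_isometry[OF that(1)] that(2)] .
    then show ?case using elim by (metis blinfun.zero_right)
  qed
  then have "(AE t\<in>{0..T} in lebesgue. cov_deriv B T M' \<alpha>' (\<lambda>r. blinfun_apply (R r) (X r)) t = 0)
      \<longleftrightarrow> (AE t\<in>{0..T} in lebesgue. cov_deriv B T M \<alpha> X t = 0)"
    by (rule eventually_subst)
  then show ?thesis unfolding parallel_field_def using X R_field[OF X] by simp
qed

end

lemma pos_frames_mem:
  assumes "subspace W" "e \<in> pos_frames B W"
  shows "e i \<in> W"
  using assms subspace_0 unfolding pos_frames_def by (cases "i < pos_index B W") auto

text \<open>
  The sequences that make up an orientation of \<open>W\<close> have all their values in \<open>W\<close>, including the padding by zeros.
\<close>

lemma preserves_orientation_cong: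
  assumes W: "subspace W" and \<omega>: "orientation_of B W \<omega>" and f: "preserves_orientation \<omega> \<omega>' f"
    and fg: "\<And>v. v \<in> W \<Longrightarrow> g v = f v"
  shows "preserves_orientation \<omega> \<omega>' g"
proof -
  have eq: "g \<circ> e = f \<circ> e" if "e \<in> fst \<omega> \<union> snd \<omega>" for e
  proof -
    have "e \<in> pos_frames B W \<or> e \<in> pos_frames (neg_form B) W"
      using \<omega> that in_components_subset unfolding orientation_of_def by blast
    then have "e i \<in> W" for i using pos_frames_mem[OF W] by blast
    then show ?thesis using fg by (simp add: fun_eq_iff)
  qed
  then show ?thesis using f unfolding preserves_orientation_def by simp
qed

theorem proposition3:
  fixes B :: "'a::euclidean_space \<Rightarrow> 'a \<Rightarrow> real"
    and M M' :: "'a set"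
    and \<omega> \<omega>' :: "'a \<Rightarrow> 'a orientation"
    and n :: nat and sig :: "nat \<times> nat" and T :: real
  assumes "scalar_product_form B"
    and "semi_riemannian_submanifold B n sig M"
    and "semi_riemannian_submanifold B n sig M'"
    and "oriented_by B M \<omega>"
    and "oriented_by B M' \<omega>'"
    and "T > 0"
  shows
    "(\<forall>\<alpha> \<alpha>' A R s.
        intrinsic_rolling B T M \<omega> M' \<omega>' \<alpha> \<alpha>' A \<and>
        curve_in T (SE B) (\<lambda>t. (R t, s t)) \<and>
        (\<forall>t\<in>{0..T}. \<forall>v\<in>tangent_space M (\<alpha> t). blinfun_apply (R t) v = A t v) \<and>
        (\<forall>t\<in>{0..T}. s t = \<alpha>' t - blinfun_apply (R t) (\<alpha> t)) \<longrightarrow>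
        maps_base_points T \<alpha> \<alpha>' (\<lambda>t. (R t, s t)) \<and>
        maps_tangent_spaces T M M' \<alpha> \<alpha>' (\<lambda>t. (R t, s t)) \<and>
        no_slip T \<alpha> \<alpha>' (\<lambda>t. (R t, s t)) \<and>
        tangential_no_twist B T M M' \<alpha> \<alpha>' (\<lambda>t. (R t, s t)) \<and>
        maps_orientations T \<omega> \<omega>' \<alpha> \<alpha>' (\<lambda>t. (R t, s t)))
     \<and>
     (\<forall>\<alpha> \<alpha>' R s.
        curve_in T M \<alpha> \<and> curve_in T M' \<alpha>' \<and>
        curve_in T (SE B) (\<lambda>t. (R t, s t)) \<and>
        maps_base_points T \<alpha> \<alpha>' (\<lambda>t. (R t, s t)) \<and>
        maps_tangent_spaces T M M' \<alpha> \<alpha>' (\<lambda>t. (R t, s t)) \<and>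
        no_slip T \<alpha> \<alpha>' (\<lambda>t. (R t, s t)) \<and>
        tangential_no_twist B T M M' \<alpha> \<alpha>' (\<lambda>t. (R t, s t)) \<and>
        maps_orientations T \<omega> \<omega>' \<alpha> \<alpha>' (\<lambda>t. (R t, s t)) \<longrightarrow>
        intrinsic_rolling B T M \<omega> M' \<omega>' \<alpha> \<alpha>'
          (\<lambda>t. restrict (blinfun_apply (R t)) (tangent_space M (\<alpha> t))))
     \<and>
     (\<forall>\<alpha> \<alpha>' R s.
        rolling_map B T M \<omega> M' \<omega>' \<alpha> \<alpha>' (\<lambda>t. (R t, s t)) \<longrightarrow>
        intrinsic_rolling B T M \<omega> M' \<omega>' \<alpha> \<alpha>'
          (\<lambda>t. restrict (blinfun_apply (R t)) (tangent_space M (\<alpha> t))))"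
proof -
  have key: "moving_isometry B M M' n sig T \<alpha> \<alpha>' R s"
    if "curve_in T M \<alpha>" "curve_in T M' \<alpha>'" "curve_in T (SE B) (\<lambda>t. (R t, s t))"
      "maps_tangent_spaces T M M' \<alpha> \<alpha>' (\<lambda>t. (R t, s t))" for \<alpha> \<alpha>' R s
    using that assms
    by unfold_locales (auto simp: maps_tangent_spaces_def se_diff_def)
  have part1: "maps_base_points T \<alpha> \<alpha>' (\<lambda>t. (R t, s t)) \<and>
        maps_tangent_spaces T M M' \<alpha> \<alpha>' (\<lambda>t. (R t, s t)) \<and>
        no_slip T \<alpha> \<alpha>' (\<lambda>t. (R t, s t)) \<and>
        tangential_no_twist B T M M' \<alpha> \<alpha>' (\<lambda>t. (R t, s t)) \<and>
        maps_orientations T \<omega> \<omega>' \<alpha> \<alpha>' (\<lambda>t. (R t, s t))"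
    if roll: "intrinsic_rolling B T M \<omega> M' \<omega>' \<alpha> \<alpha>' A" and g: "curve_in T (SE B) (\<lambda>t. (R t, s t))"
      and RA: "\<forall>t\<in>{0..T}. \<forall>v\<in>tangent_space M (\<alpha> t). blinfun_apply (R t) v = A t v"
      and s: "\<forall>t\<in>{0..T}. s t = \<alpha>' t - blinfun_apply (R t) (\<alpha> t)" for \<alpha> \<alpha>' A R s
  proof -
    have curves: "curve_in T M \<alpha>" "curve_in T M' \<alpha>'"
      and iso: "\<And>t. t \<in> {0..T} \<Longrightarrow> oriented_isometry B (tangent_space M (\<alpha> t)) (\<omega> (\<alpha> t))
                    (tangent_space M' (\<alpha>' t)) (\<omega>' (\<alpha>' t)) (A t)"
      and vel: "AE t\<in>{0..T} in lebesgue. velocity T \<alpha>' t = A t (velocity T \<alpha> t)"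
      and par: "\<And>X. tangent_field T M \<alpha> X \<Longrightarrow>
        parallel_field B T M' \<alpha>' (\<lambda>t. A t (X t)) \<longleftrightarrow> parallel_field B T M \<alpha> X"
      using roll unfolding intrinsic_rolling_def by blast+
    have E1: "maps_base_points T \<alpha> \<alpha>' (\<lambda>t. (R t, s t))"
      using s unfolding maps_base_points_def se_act_def by simp
    have E2: "maps_tangent_spaces T M M' \<alpha> \<alpha>' (\<lambda>t. (R t, s t))"
      unfolding maps_tangent_spaces_def se_diff_def fst_conv
    proof
      fix t assume t: "t \<in> {0..T}"
      have "blinfun_apply (R t) ` tangent_space M (\<alpha> t) = A t ` tangent_space M (\<alpha> t)"
        using RA t by (intro image_cong) auto
      also have "\<dots> = tangent_space M' (\<alpha>' t)"
        using iso[OF t] unfolding oriented_isometry_def isometry_between_def bij_betw_def by simp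
      finally show "blinfun_apply (R t) ` tangent_space M (\<alpha> t) = tangent_space M' (\<alpha>' t)" .
    qed
    interpret moving_isometry B M M' n sig T \<alpha> \<alpha>' R s by (rule key[OF curves g E2])
    have E3: "no_slip T \<alpha> \<alpha>' (\<lambda>t. (R t, s t))"
      unfolding no_slip_def se_diff_def fst_conv
      using vel curve_velocity_tangent[OF M.submanifold curves(1) T]
      by eventually_elim (use RA in auto)
    have E4: "tangential_no_twist B T M M' \<alpha> \<alpha>' (\<lambda>t. (R t, s t))"
    proof (rule tangential_no_twistI)
      fix X assume X: "parallel_field B T M \<alpha> X"
      then have tf: "tangent_field T M \<alpha> X" unfolding parallel_field_def by simp
      then have "parallel_field B T M' \<alpha>' (\<lambda>t. A t (X t))" using par X by simp
      moreover have "A t (X t) = blinfun_apply (R t) (X t)" if "t \<in> {0..T}" for t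
        using RA tf that unfolding tangent_field_def by simp
      ultimately show "parallel_field B T M' \<alpha>' (\<lambda>t. blinfun_apply (R t) (X t))"
        using parallel_field_cong[of T "\<lambda>t. A t (X t)" "\<lambda>t. blinfun_apply (R t) (X t)"] by blast
    qed
    have E6: "maps_orientations T \<omega> \<omega>' \<alpha> \<alpha>' (\<lambda>t. (R t, s t))"
      unfolding maps_orientations_def se_diff_def fst_conv
    proof
      fix t assume t: "t \<in> {0..T}"
      have m: "\<alpha> t \<in> M" using curves(1) t unfolding curve_in_def by simp
      have "orientation_of B (tangent_space M (\<alpha> t)) (\<omega> (\<alpha> t))"
        using assms(4) m unfolding oriented_by_def by blast
      moreover have "preserves_orientation (\<omega> (\<alpha> t)) (\<omega>' (\<alpha>' t)) (A t)"
        using iso[OF t] unfolding oriented_isometry_def by simp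
      ultimately show "preserves_orientation (\<omega> (\<alpha> t)) (\<omega>' (\<alpha>' t)) (blinfun_apply (R t))"
        by (rule preserves_orientation_cong[OF M.tangent_subspace[OF m]]) (use RA t in auto)
    qed
    show ?thesis using E1 E2 E3 E4 E6 by blast
  qed
  have part2: "intrinsic_rolling B T M \<omega> M' \<omega>' \<alpha> \<alpha>'
          (\<lambda>t. restrict (blinfun_apply (R t)) (tangent_space M (\<alpha> t)))"
    if curves: "curve_in T M \<alpha>" "curve_in T M' \<alpha>'" and g: "curve_in T (SE B) (\<lambda>t. (R t, s t))"
      and E2: "maps_tangent_spaces T M M' \<alpha> \<alpha>' (\<lambda>t. (R t, s t))"
      and E3: "no_slip T \<alpha> \<alpha>' (\<lambda>t. (R t, s t))"
      and E4: "tangential_no_twist B T M M' \<alpha> \<alpha>' (\<lambda>t. (R t, s t))"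
      and E6: "maps_orientations T \<omega> \<omega>' \<alpha> \<alpha>' (\<lambda>t. (R t, s t))" for \<alpha> \<alpha>' R s
  proof -
    interpret moving_isometry B M M' n sig T \<alpha> \<alpha>' R s by (rule key[OF curves g E2])
    let ?A = "\<lambda>t. restrict (blinfun_apply (R t)) (tangent_space M (\<alpha> t))"
    have A: "?A t (X t) = blinfun_apply (R t) (X t)" if "tangent_field T M \<alpha> X" "t \<in> {0..T}" for X t
      using that unfolding tangent_field_def by simp
    show ?thesis
      unfolding intrinsic_rolling_def
    proof (intro conjI curves ballI allI impI)
      fix t assume t: "t \<in> {0..T}"
      have m: "\<alpha> t \<in> M" using curves(1) t unfolding curve_in_def by simp
      note W = M.tangent_subspace[OF m]
      have "inj_on (blinfun_apply (R t)) (tangent_space M (\<alpha> t))"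
        using isometry_group_eq_0[OF M.form R_isometry[OF t]]
        by (intro inj_onI) (metis blinfun.diff_right eq_iff_diff_eq_0)
      then have "isometry_between B (tangent_space M (\<alpha> t)) (tangent_space M' (\<alpha>' t)) (?A t)"
        using R_tangent[OF t] R_isometry[OF t] W
        by (auto simp: isometry_between_def isometry_group_def bij_betw_def subspace_add subspace_scale
            blinfun.add_right blinfun.scaleR_right inj_on_def)
      moreover have "preserves_orientation (\<omega> (\<alpha> t)) (\<omega>' (\<alpha>' t)) (?A t)"
      proof (rule preserves_orientation_cong[OF W])
        show "orientation_of B (tangent_space M (\<alpha> t)) (\<omega> (\<alpha> t))"
          using assms(4) m unfolding oriented_by_def by blast
        show "preserves_orientation (\<omega> (\<alpha> t)) (\<omega>' (\<alpha>' t)) (blinfun_apply (R t))"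
          using E6 t unfolding maps_orientations_def se_diff_def by simp
      qed simp
      ultimately show "oriented_isometry B (tangent_space M (\<alpha> t)) (\<omega> (\<alpha> t))
                    (tangent_space M' (\<alpha>' t)) (\<omega>' (\<alpha>' t)) (?A t)"
        unfolding oriented_isometry_def by blast
    next
      fix X assume X: "tangent_field T M \<alpha> X"
      show "abs_cont_on {0..T} (\<lambda>t. ?A t (X t))"
        by (rule abs_cont_on_cong[of _ "\<lambda>t. blinfun_apply (R t) (X t)"])
          (use R_field[OF X] A[OF X] in \<open>auto simp: tangent_field_def\<close>)
    next
      show "AE t\<in>{0..T} in lebesgue. velocity T \<alpha>' t = ?A t (velocity T \<alpha> t)"
        using E3[unfolded no_slip_def se_diff_def fst_conv] curve_velocity_tangent[OF M.submanifold curves(1) T]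
        by eventually_elim simp
    next
      fix X assume X: "tangent_field T M \<alpha> X"
      have "parallel_field B T M' \<alpha>' (\<lambda>t. ?A t (X t)) \<longleftrightarrow> parallel_field B T M' \<alpha>' (\<lambda>t. blinfun_apply (R t) (X t))"
        by (rule parallel_field_cong) (rule A[OF X])
      also have "\<dots> \<longleftrightarrow> parallel_field B T M \<alpha> X" by (rule parallel_field_iff[OF E4 X])
      finally show "parallel_field B T M' \<alpha>' (\<lambda>t. ?A t (X t)) = parallel_field B T M \<alpha> X" .
    qed
  qed
  show ?thesis
    \<comment> \<open>The pattern restricts splitting to the three claims and keeps their conclusions intact.\<close>
    apply (intro conjI[of "\<forall>\<alpha>. _ \<alpha>"] allI impI)
    subgoal by (elim conjE) (rule part1)
    subgoal by (elim conjE) (rule part2)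
    subgoal unfolding rolling_map_def by (elim conjE) (rule part2)
    done
qed

end
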